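(* Let $\alpha\in\Delta^+\cup\Delta^{re}$ and $\beta\in\Delta^{im+}$. Let $x\in\mathfrak g_\alpha$ and $y\in\mathfrak g_\beta$ be such that $[x,y]\neq0$. Then $(\mathrm{ad}\,y)^n x\neq0$ for all $n\in\mathbb N$.
   Context: Let $A=(a_{ij})_{i,j\in I}$ be a symmetrisable generalised Cartan matrix indexed by a finite set $I$, and $\mathfrak g(A)$ the associated complex Kac–Moody algebra with Cartan subalgebra $\mathfrak h$, simple roots $\alpha_i$, simple coroots $\alpha_i^\vee$, root space decomposition $\mathfrak g(A)=\mathfrak h\oplus\bigoplus_{\alpha\in\Delta}\mathfrak g_\alpha$. $Q_+=\bigoplus_i\mathbb N\alpha_i$, $\Delta^+=\Delta\cap Q_+$; Weyl group $W$ generated by $s_i(\lambda)=\lambda-\langle\lambda,\alpha_i^\vee\rangle\alpha_i$; real roots $\Delta^{re}=W\cdot\{\alpha_i\}$, imaginary roots $\Delta^{im}=\Delta\setminus\Delta^{re}$, $\Delta^{im+}=\Delta^{im}\cap\Delta^+$. *)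

theory Defs
  imports Complex_Main "HOL-Library.Function_Algebras"
begin

definition gcm :: "('i::finite \<Rightarrow> 'i \<Rightarrow> int) \<Rightarrow> bool" where
  "gcm A \<longleftrightarrow> (\<forall>i. A i i = 2) \<and> (\<forall>i j. i \<noteq> j \<longrightarrow> A i j \<le> 0)
     \<and> (\<forall>i j. A i j = 0 \<longleftrightarrow> A j i = 0)"

definition symmetrisable :: "('i::finite \<Rightarrow> 'i \<Rightarrow> int) \<Rightarrow> bool" where
  "symmetrisable A \<longleftrightarrow> (\<exists>d::'i \<Rightarrow> real. (\<forall>i. d i > 0) \<and>
      (\<forall>i j. d i * of_int (A i j) = d j * of_int (A j i)))"

definition cartan_rank :: "('i::finite \<Rightarrow> 'i \<Rightarrow> int) \<Rightarrow> nat" where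
  "cartan_rank A = vector_space.dim (\<lambda>(c::complex) (v::'i \<Rightarrow> complex) k. c * v k)
      (range (\<lambda>j i. complex_of_int (A i j)))"

definition lie_algebra :: "(complex \<Rightarrow> 'g::ab_group_add \<Rightarrow> 'g) \<Rightarrow> ('g \<Rightarrow> 'g \<Rightarrow> 'g) \<Rightarrow> bool" where
  "lie_algebra smul br \<longleftrightarrow> vector_space smul
     \<and> (\<forall>x y z. br (x + y) z = br x z + br y z)
     \<and> (\<forall>x y z. br x (y + z) = br x y + br x z)
     \<and> (\<forall>c x y. br (smul c x) y = smul c (br x y))
     \<and> (\<forall>c x y. br x (smul c y) = smul c (br x y))
     \<and> (\<forall>x. br x x = 0)
     \<and> (\<forall>x y z. br x (br y z) + br y (br z x) + br z (br x y) = 0)"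

definition lie_generated :: "(complex \<Rightarrow> 'g::ab_group_add \<Rightarrow> 'g) \<Rightarrow> ('g \<Rightarrow> 'g \<Rightarrow> 'g) \<Rightarrow> 'g set \<Rightarrow> 'g set" where
  "lie_generated smul br S = \<Inter>{V. S \<subseteq> V \<and> module.subspace smul V \<and> (\<forall>x\<in>V. \<forall>y\<in>V. br x y \<in> V)}"

definition lie_ideal :: "(complex \<Rightarrow> 'g::ab_group_add \<Rightarrow> 'g) \<Rightarrow> ('g \<Rightarrow> 'g \<Rightarrow> 'g) \<Rightarrow> 'g set \<Rightarrow> bool" where
  "lie_ideal smul br J \<longleftrightarrow> module.subspace smul J \<and> (\<forall>x\<in>J. \<forall>y. br y x \<in> J)"

text \<open>The root lattice Q is identified with 'i => int (coefficients w.r.t. the simple roots).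
  The weight of gamma in Q, as a linear functional on h, given the simple roots al.\<close>

definition wt :: "('i::finite \<Rightarrow> 'g \<Rightarrow> complex) \<Rightarrow> ('i \<Rightarrow> int) \<Rightarrow> 'g \<Rightarrow> complex" where
  "wt al \<gamma> h = (\<Sum>i\<in>UNIV. of_int (\<gamma> i) * al i h)"

definition root_space :: "(complex \<Rightarrow> 'g::ab_group_add \<Rightarrow> 'g) \<Rightarrow> ('g \<Rightarrow> 'g \<Rightarrow> 'g) \<Rightarrow> 'g set
     \<Rightarrow> ('i::finite \<Rightarrow> 'g \<Rightarrow> complex) \<Rightarrow> ('i \<Rightarrow> int) \<Rightarrow> 'g set" where
  "root_space smul br H al \<gamma> = {x. \<forall>h\<in>H. br h x = smul (wt al \<gamma> h) x}"

definition roots :: "(complex \<Rightarrow> 'g::ab_group_add \<Rightarrow> 'g) \<Rightarrow> ('g \<Rightarrow> 'g \<Rightarrow> 'g) \<Rightarrow> 'g set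
     \<Rightarrow> ('i::finite \<Rightarrow> 'g \<Rightarrow> complex) \<Rightarrow> ('i \<Rightarrow> int) set" where
  "roots smul br H al = {\<gamma>. \<gamma> \<noteq> 0 \<and> root_space smul br H al \<gamma> \<noteq> {0}}"

definition pos_lattice :: "('i \<Rightarrow> int) set" where
  "pos_lattice = {\<gamma>. \<forall>i. \<gamma> i \<ge> 0}"

definition simple_root :: "'i \<Rightarrow> ('i \<Rightarrow> int)" where
  "simple_root i = (\<lambda>k. if k = i then 1 else 0)"

(* simple reflection s_i(lambda) = lambda - <lambda, alpha_i^vee> alpha_i, with <alpha_j, alpha_i^vee> = a_ij *)
definition refl :: "('i::finite \<Rightarrow> 'i \<Rightarrow> int) \<Rightarrow> 'i \<Rightarrow> ('i \<Rightarrow> int) \<Rightarrow> ('i \<Rightarrow> int)" where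
  "refl A i \<mu> = (\<lambda>k. \<mu> k - (if k = i then (\<Sum>j\<in>UNIV. \<mu> j * A i j) else 0))"

inductive_set real_roots :: "('i::finite \<Rightarrow> 'i \<Rightarrow> int) \<Rightarrow> ('i \<Rightarrow> int) set" for A where
  simple: "simple_root i \<in> real_roots A"
| reflect: "\<mu> \<in> real_roots A \<Longrightarrow> refl A i \<mu> \<in> real_roots A"

text \<open>Characterisation of g(A) (Kac, Ch. 1): a complex Lie algebra with a realisation
  (H, coroots hv, simple roots al) of A, generators e_i, f_i satisfying the defining relations,
  generated by e, f and H, and having no nonzero ideal meeting H trivially.\<close>

definition kac_moody :: "('i::finite \<Rightarrow> 'i \<Rightarrow> int) \<Rightarrow> (complex \<Rightarrow> 'g::ab_group_add \<Rightarrow> 'g) \<Rightarrow> ('g \<Rightarrow> 'g \<Rightarrow> 'g)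
   \<Rightarrow> 'g set \<Rightarrow> ('i \<Rightarrow> 'g) \<Rightarrow> ('i \<Rightarrow> 'g \<Rightarrow> complex) \<Rightarrow> ('i \<Rightarrow> 'g) \<Rightarrow> ('i \<Rightarrow> 'g) \<Rightarrow> bool" where
  "kac_moody A smul br H hv al e f \<longleftrightarrow>
     lie_algebra smul br
   \<and> module.subspace smul H
   \<and> (\<exists>B. finite B \<and> module.span smul B = H)
   \<and> vector_space.dim smul H = 2 * card (UNIV :: 'i set) - cartan_rank A
   \<and> (\<forall>i. hv i \<in> H)
   \<and> (\<forall>i. \<forall>c. \<forall>h\<in>H. \<forall>h'\<in>H. al i (h + h') = al i h + al i h' \<and> al i (smul c h) = c * al i h)
   \<and> (\<forall>i j. al j (hv i) = of_int (A i j))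
   \<and> (\<forall>c::'i \<Rightarrow> complex. (\<Sum>i\<in>UNIV. smul (c i) (hv i)) = 0 \<longrightarrow> (\<forall>i. c i = 0))
   \<and> (\<forall>c::'i \<Rightarrow> complex. (\<forall>h\<in>H. (\<Sum>i\<in>UNIV. c i * al i h) = 0) \<longrightarrow> (\<forall>i. c i = 0))
   \<and> (\<forall>h\<in>H. \<forall>h'\<in>H. br h h' = 0)
   \<and> (\<forall>i j. br (e i) (f j) = (if i = j then hv i else 0))
   \<and> (\<forall>i. \<forall>h\<in>H. br h (e i) = smul (al i h) (e i))
   \<and> (\<forall>i. \<forall>h\<in>H. br h (f i) = smul (- al i h) (f i))
   \<and> lie_generated smul br (H \<union> range e \<union> range f) = UNIV
   \<and> (\<forall>J. lie_ideal smul br J \<and> J \<inter> H = {0} \<longrightarrow> J = {0})"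

end

theory Submission
  imports Defs
begin

text \<open>
  Unitarity. On \<open>\<gg>(A)\<close> there is a contravariant Hermitian form \<open>S\<close>, for which the adjoint of
  \<open>ad z\<close> is \<open>ad z\<^sup>*\<close>, where \<open>*\<close> is the antilinear anti-involution exchanging \<open>e\<^sub>i\<close> and \<open>f\<^sub>i\<close>. It is
  positive definite on every root space: on a root space of weight \<open>\<alpha> > 0\<close>, the restricted
  Casimir sum \<open>\<Sum> ad v ad v\<^sup>*\<close> over dual bases of the root spaces strictly between \<open>0\<close> and \<open>\<alpha>\<close> is
  the scalar \<open>2(\<rho>|\<alpha>) - (\<alpha>|\<alpha>)\<close>, which is positive unless \<open>\<alpha>\<close> is simple, so that positivity
  propagates by induction on the height.

  For \<open>y \<in> \<gg>\<^sub>\<beta>\<close> and \<open>z \<in> \<gg>\<^sub>\<gamma>\<close> the relation \<open>[y, y\<^sup>*] = S(y,y) \<nu>\<^sup>-\<^sup>1(\<beta>)\<close> gives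
  \<open>S([y,z],[y,z]) = - (\<beta>|\<gamma>) S(y,y) S(z,z) + S([y\<^sup>*,z],[y\<^sup>*,z])\<close>. If \<open>z = [y,p] \<noteq> 0\<close>, then
  \<open>S([y\<^sup>*,z],p) = S(z,z) \<noteq> 0\<close>, hence \<open>[y,z] \<noteq> 0\<close> as soon as \<open>(\<beta>|\<gamma>) \<le> 0\<close>. Thus everything reduces to
  \<open>(\<beta>|\<beta>) \<le> 0\<close> and \<open>(\<beta>|\<alpha> + \<beta>) \<le> 0\<close>, which are statements about roots and are proved by moving
  \<open>\<beta>\<close> into the antidominant chamber.
\<close>

section \<open>Weights and strings\<close>

text \<open>The algebra is characterised by the absence of nonzero ideals meeting \<open>H\<close>
  trivially, not by a presentation, so neither \<open>*\<close> nor the form can be prescribed on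
  generators and extended through relations. Both arise as intertwiners into modules that have no
  lowest weight vectors in positive height and no highest ones in negative height. They are
  constructed on the derived algebra \<open>G\<close>, which contains every root space, so that no
  choice on a complement of \<open>G\<close> in \<open>H\<close> enters. The Casimir sum runs
  strictly between 0 and \<alpha> because its bases are obtained by Gram-Schmidt, which presupposes
  definiteness of \<open>S\<close>: only root spaces of smaller height occur, and the induction is
  well founded. Definiteness is claimed on root spaces only; on the coroots the form may be
  degenerate. Hence the weights \<alpha> + n\<beta> have to avoid 0 in addition to satisfying the
  sign condition. The assumption \<open>[x,y] \<noteq> 0\<close> is also what makes \<alpha> +
  \<beta> a root, on which the chamber argument relies.\<close>

definition ht :: "('i::finite \<Rightarrow> int) \<Rightarrow> int" where
  "ht \<gamma> = (\<Sum>i\<in>UNIV. \<gamma> i)"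

text \<open>The pairing of \<gamma> with the simple coroot of index i: the eigenvalue of
  \<open>hv i\<close> on weight \<gamma> and the coefficient subtracted by
  \<open>refl\<close>.\<close>

definition pair :: "('i::finite \<Rightarrow> 'i \<Rightarrow> int) \<Rightarrow> 'i \<Rightarrow> ('i \<Rightarrow> int) \<Rightarrow> int" where
  "pair A i \<gamma> = (\<Sum>j\<in>UNIV. \<gamma> j * A i j)"

definition nmult :: "nat \<Rightarrow> ('i \<Rightarrow> int) \<Rightarrow> ('i \<Rightarrow> int)" where
  "nmult n \<gamma> = (\<lambda>i. int n * \<gamma> i)"

lemma nmult_0 [simp]: "nmult 0 \<gamma> = 0"
  and nmult_Suc: "nmult (Suc n) \<gamma> = \<gamma> + nmult n \<gamma>"
  and nmult_minus [simp]: "nmult n (- \<gamma>) = - nmult n \<gamma>"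
  and nmult_add: "nmult (m + n) \<gamma> = nmult m \<gamma> + nmult n \<gamma>"
  by (auto simp: nmult_def fun_eq_iff algebra_simps)

lemma ht_simps [simp]:
  "ht 0 = 0" "ht (\<gamma> + \<delta>) = ht \<gamma> + ht \<delta>" "ht (\<gamma> - \<delta>) = ht \<gamma> - ht \<delta>" "ht (- \<gamma>) = - ht \<gamma>"
  by (simp_all add: ht_def sum.distrib sum_subtractf sum_negf)

lemma ht_simple_root [simp]: "ht (simple_root i) = 1"
  by (simp add: ht_def simple_root_def)

lemma pair_simps [simp]:
  "pair A i 0 = 0" "pair A i (\<gamma> + \<delta>) = pair A i \<gamma> + pair A i \<delta>"
  "pair A i (\<gamma> - \<delta>) = pair A i \<gamma> - pair A i \<delta>" "pair A i (- \<gamma>) = - pair A i \<gamma>"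
  by (simp_all add: pair_def sum.distrib sum_subtractf sum_negf algebra_simps)

lemma ht_nmult [simp]: "ht (nmult n \<gamma>) = int n * ht \<gamma>"
  by (simp add: ht_def nmult_def sum_distrib_left)

lemma pair_nmult [simp]: "pair A i (nmult n \<gamma>) = int n * pair A i \<gamma>"
  by (simp add: pair_def nmult_def sum_distrib_left mult.assoc)

lemma pair_simple_root [simp]: "pair A i (simple_root j) = A i j"
proof -
  have "pair A i (simple_root j) = (\<Sum>k\<in>UNIV. if k = j then A i k else 0)"
    unfolding pair_def simple_root_def by (rule sum.cong) auto
  then show ?thesis by simp
qed

lemma ht_pos: "0 \<le> \<gamma> \<Longrightarrow> \<gamma> \<noteq> 0 \<Longrightarrow> 0 < ht \<gamma>"
proof -
  assume "0 \<le> \<gamma>" "\<gamma> \<noteq> 0"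
  then obtain i where "\<gamma> i \<noteq> 0" by (auto simp: fun_eq_iff)
  then have "0 < \<gamma> i" using \<open>0 \<le> \<gamma>\<close> by (simp add: le_fun_def less_le)
  then show ?thesis unfolding ht_def
    using \<open>0 \<le> \<gamma>\<close> by (intro sum_pos2[where i = i]) (auto simp: le_fun_def)
qed

lemma ht_nonneg: "0 \<le> \<gamma> \<Longrightarrow> 0 \<le> ht \<gamma>"
  using ht_pos[of \<gamma>] by (cases "\<gamma> = 0") auto

lemma simple_root_ge0 [simp]: "0 \<le> simple_root i"
  by (simp add: simple_root_def le_fun_def)

lemma simple_root_ne0 [simp]: "simple_root i \<noteq> 0"
  by (simp add: simple_root_def fun_eq_iff)

lemma simple_root_eq_iff [simp]: "simple_root i = simple_root j \<longleftrightarrow> i = j"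
  by (auto simp: simple_root_def fun_eq_iff split: if_splits)

lemma wt_simps [simp]:
  "wt al 0 h = 0" "wt al (\<gamma> + \<delta>) h = wt al \<gamma> h + wt al \<delta> h"
  "wt al (\<gamma> - \<delta>) h = wt al \<gamma> h - wt al \<delta> h" "wt al (- \<gamma>) h = - wt al \<gamma> h"
  by (simp_all add: wt_def sum.distrib sum_subtractf sum_negf algebra_simps)

lemma wt_simple_root [simp]: "wt al (simple_root j) h = al j h"
proof -
  have "wt al (simple_root j) h = (\<Sum>k\<in>UNIV. if k = j then al k h else 0)"
    unfolding wt_def simple_root_def by (rule sum.cong) auto
  then show ?thesis by simp
qed

lemma wt_uminus_fun: "wt (\<lambda>i h. - al i h) \<gamma> h = - wt al \<gamma> h"
  by (simp add: wt_def sum_negf)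

section \<open>Bracket calculus, powers of ad, and sl2 strings\<close>

locale lie_alg = vector_space smul
  for smul :: "complex \<Rightarrow> 'g::ab_group_add \<Rightarrow> 'g" +
  fixes br :: "'g \<Rightarrow> 'g \<Rightarrow> 'g"
  assumes br_add_left: "br (x + y) z = br x z + br y z"
    and br_add_right: "br x (y + z) = br x y + br x z"
    and br_smul_left: "br (smul c x) y = smul c (br x y)"
    and br_smul_right: "br x (smul c y) = smul c (br x y)"
    and br_self [simp]: "br x x = 0"
    and jacobi: "br x (br y z) + br y (br z x) + br z (br x y) = 0"
begin

lemma br_0_left [simp]: "br 0 x = 0"
  using br_smul_left[of 0 0 x] by simp

lemma br_0_right [simp]: "br x 0 = 0"
  using br_smul_right[of x 0 0] by simp

lemma br_neg_left [simp]: "br (- x) y = - br x y"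
  using br_add_left[of x "- x" y] by (simp add: add_eq_0_iff)

lemma br_neg_right [simp]: "br x (- y) = - br x y"
  using br_add_right[of x y "- y"] by (simp add: add_eq_0_iff)

lemma br_diff_right: "br x (y - z) = br x y - br x z"
  using br_add_right[of x y "- z"] by simp

lemma br_sum_left: "br (sum g X) y = (\<Sum>x\<in>X. br (g x) y)"
  by (induction X rule: infinite_finite_induct) (simp_all add: br_add_left)

lemma br_sum_right: "br y (sum g X) = (\<Sum>x\<in>X. br y (g x))"
  by (induction X rule: infinite_finite_induct) (simp_all add: br_add_right)

lemma br_skew: "br x y = - br y x"
  using br_self[of "x + y"] by (simp add: br_add_left br_add_right add_eq_0_iff2 add.commute del: br_self) simp

lemma br_br: "br x (br y z) = br (br x y) z + br y (br x z)"
proof -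
  have "br x (br y z) - br y (br x z) - br (br x y) z = 0"
    using jacobi[of x y z] by (simp add: br_skew[of z x] br_skew[of z "br x y"])
  then show ?thesis by (simp add: algebra_simps)
qed

lemma br_pow_0 [simp]: "(br x ^^ n) 0 = 0"
  by (induction n) auto

lemma br_pow_add: "(br x ^^ n) (y + z) = (br x ^^ n) y + (br x ^^ n) z"
  by (induction n) (auto simp: br_add_right)

lemma br_pow_smul: "(br x ^^ n) (smul c y) = smul c ((br x ^^ n) y)"
  by (induction n) (auto simp: br_smul_right)

lemma br_pow_le: "(br x ^^ n) y = 0 \<Longrightarrow> n \<le> m \<Longrightarrow> (br x ^^ m) y = 0"
  by (metis br_pow_0 funpow_add le_add_diff_inverse2 o_apply)

text \<open>By the Leibniz rule one application of \<open>ad x\<close> to \<open>[a,b]\<close>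
  lowers either \<open>p\<close> or \<open>q\<close> by one, so induction on \<open>p + q\<close>
  replaces the binomial expansion.\<close>

lemma br_pow_br_eq_0:
  "(br x ^^ p) a = 0 \<Longrightarrow> (br x ^^ q) b = 0 \<Longrightarrow> (br x ^^ (p + q)) (br a b) = 0"
proof (induction "p + q" arbitrary: p q a b)
  case 0
  then show ?case by simp
next
  case (Suc n)
  show ?case
  proof (cases "p = 0 \<or> q = 0")
    case True
    then show ?thesis using Suc.prems by auto
  next
    case False
    then obtain p' q' where pq: "p = Suc p'" "q = Suc q'" by (metis not0_implies_Suc)
    have "(br x ^^ (p' + q)) (br (br x a) b) = 0" "(br x ^^ (p + q')) (br a (br x b)) = 0"
      using Suc.prems Suc.hyps(2)
      by (intro Suc.hyps(1); simp add: pq funpow_Suc_right del: funpow.simps; fail)+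
    moreover have "p + q = Suc (p' + q)" "p' + q = p + q'" using pq by auto
    ultimately show ?thesis
      by (simp add: funpow_Suc_right br_br[of x a b] br_pow_add del: funpow.simps)
  qed
qed

text \<open>The string above a lowest weight vector. The triple is left abstract so that the formula
  serves both \<open>(e i, f i, hv i)\<close> and \<open>(f i, e i, - hv i)\<close>.\<close>

lemma sl2_lowering:
  assumes "br E F = t" "br t E = smul 2 E" "br F v = 0" "br t v = smul \<mu> v"
  shows "br t ((br E ^^ n) v) = smul (\<mu> + 2 * of_nat n) ((br E ^^ n) v)"
    and "br F ((br E ^^ Suc n) v) = smul (- (of_nat (Suc n) * (\<mu> + of_nat n))) ((br E ^^ n) v)"
proof -
  have t: "br t ((br E ^^ n) v) = smul (\<mu> + 2 * of_nat n) ((br E ^^ n) v)" for n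
  proof (induction n)
    case 0
    then show ?case using assms by simp
  next
    case (Suc n)
    then show ?case
      using br_br[of t E "(br E ^^ n) v"] assms(2)
      by (simp add: br_smul_left br_smul_right scale_left_distrib[symmetric] add.commute)
  qed
  then show "br t ((br E ^^ n) v) = smul (\<mu> + 2 * of_nat n) ((br E ^^ n) v)" .
  have FE: "br F E = - t" using br_skew[of F E] assms(1) by simp
  show "br F ((br E ^^ Suc n) v) = smul (- (of_nat (Suc n) * (\<mu> + of_nat n))) ((br E ^^ n) v)"
  proof (induction n)
    case 0
    show ?case using br_br[of F E v] FE assms by simp
  next
    case (Suc n)
    have "br F ((br E ^^ Suc (Suc n)) v)
      = - br t ((br E ^^ Suc n) v) + br E (br F ((br E ^^ Suc n) v))"
      using br_br[of F E "(br E ^^ Suc n) v"] FE by simp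
    also have "\<dots> = smul (- (\<mu> + 2 * of_nat (Suc n))) ((br E ^^ Suc n) v)
        + smul (- (of_nat (Suc n) * (\<mu> + of_nat n))) ((br E ^^ Suc n) v)"
      unfolding Suc.IH t by (simp only: br_smul_right br_neg_right scale_minus_left funpow.simps o_apply)
    also have "\<dots> = smul (- (of_nat (Suc (Suc n)) * (\<mu> + of_nat (Suc n)))) ((br E ^^ Suc n) v)"
      unfolding scale_left_distrib[symmetric] by (simp add: algebra_simps)
    finally show ?case .
  qed
qed

end

lemma (in module) span_UN_sumE:
  assumes "x \<in> span (\<Union>(range D))" "\<And>\<gamma>. subspace (D \<gamma>)"
  obtains F us where "finite F" "\<And>\<gamma>. us \<gamma> \<in> D \<gamma>" "x = (\<Sum>\<gamma>\<in>F. us \<gamma>)"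
proof -
  have "\<exists>F us. finite F \<and> (\<forall>\<gamma>. us \<gamma> \<in> D \<gamma>) \<and> x = (\<Sum>\<gamma>\<in>F. us \<gamma>)"
    using assms(1)
  proof (induction rule: span_induct_alt)
    case base
    have "finite {} \<and> (\<forall>\<gamma>. 0 \<in> D \<gamma>) \<and> 0 = (\<Sum>\<gamma>\<in>{}. 0)"
      using assms(2) subspace_0 by auto
    then show ?case by (intro exI[of _ "{}"] exI[of _ "\<lambda>_. 0"]) auto
  next
    case (step c x y)
    then obtain F us where F: "finite F" "\<And>\<gamma>. us \<gamma> \<in> D \<gamma>" "y = (\<Sum>\<gamma>\<in>F. us \<gamma>)" by blast
    obtain \<delta> where \<delta>: "x \<in> D \<delta>" using step by auto
    define F' where "F' = insert \<delta> F"
    define us' where "us' \<gamma> = (if \<gamma> \<in> F then us \<gamma> else 0)" for \<gamma>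
    define vs where "vs = us'(\<delta> := us' \<delta> + c *s x)"
    have us': "us' \<gamma> \<in> D \<gamma>" for \<gamma> using F assms(2) subspace_0 by (auto simp: us'_def)
    have y: "y = (\<Sum>\<gamma>\<in>F'. us' \<gamma>)"
      unfolding F(3) F'_def using F(1) by (intro sum.mono_neutral_cong_left) (auto simp: us'_def)
    have "(\<Sum>\<gamma>\<in>F'. vs \<gamma>) = (\<Sum>\<gamma>\<in>F'. us' \<gamma> + (if \<gamma> = \<delta> then c *s x else 0))"
      by (rule sum.cong) (auto simp: vs_def)
    also have "\<dots> = c *s x + y"
      using F(1) unfolding y by (simp add: sum.distrib F'_def)
    finally have "c *s x + y = (\<Sum>\<gamma>\<in>F'. vs \<gamma>)" ..
    moreover have "vs \<gamma> \<in> D \<gamma>" for \<gamma>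
      using us' \<delta> assms(2) by (auto simp: vs_def subspace_add subspace_scale)
    ultimately show ?case using F(1) unfolding F'_def by blast
  qed
  then show ?thesis using that by blast
qed

section \<open>Singular vectors and local nilpotency\<close>

locale kac_moody_alg =
  fixes A :: "'i::finite \<Rightarrow> 'i \<Rightarrow> int"
    and smul :: "complex \<Rightarrow> 'g::ab_group_add \<Rightarrow> 'g" and br :: "'g \<Rightarrow> 'g \<Rightarrow> 'g"
    and H :: "'g set" and hv :: "'i \<Rightarrow> 'g" and al :: "'i \<Rightarrow> 'g \<Rightarrow> complex"
    and e f :: "'i \<Rightarrow> 'g"
  assumes gcm: "gcm A" and kac_moody: "kac_moody A smul br H hv al e f"

sublocale kac_moody_alg \<subseteq> lie_alg smul br
proof -
  have *: "lie_algebra smul br" using kac_moody by (simp add: kac_moody_def)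
  interpret vector_space smul using * by (simp add: lie_algebra_def)
  show "lie_alg smul br"
    using * by unfold_locales (auto simp: lie_algebra_def)
qed

context kac_moody_alg
begin

abbreviation "V \<equiv> root_space smul br H al"

lemma A_diag [simp]: "A i i = 2" and A_zero: "A i j = 0 \<Longrightarrow> A j i = 0" and A_offdiag: "i \<noteq> j \<Longrightarrow> A i j \<le> 0"
  using gcm by (auto simp: gcm_def)

lemma
  shows H_subspace: "subspace H"
    and hv_H [simp]: "hv i \<in> H"
    and al_add: "h \<in> H \<Longrightarrow> h' \<in> H \<Longrightarrow> al i (h + h') = al i h + al i h'"
    and al_smul: "h \<in> H \<Longrightarrow> al i (smul c h) = c * al i h"
    and al_hv [simp]: "al j (hv i) = of_int (A i j)"
    and hv_indep: "(\<Sum>i\<in>UNIV. smul (a i) (hv i)) = 0 \<Longrightarrow> a i = 0"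
    and al_indep: "(\<And>h. h \<in> H \<Longrightarrow> (\<Sum>i\<in>UNIV. a i * al i h) = 0) \<Longrightarrow> a i = 0"
    and br_H_H: "h \<in> H \<Longrightarrow> h' \<in> H \<Longrightarrow> br h h' = 0"
    and br_e_f: "br (e i) (f j) = (if i = j then hv i else 0)"
    and br_h_e: "h \<in> H \<Longrightarrow> br h (e i) = smul (al i h) (e i)"
    and br_h_f: "h \<in> H \<Longrightarrow> br h (f i) = smul (- al i h) (f i)"
    and lie_gen: "lie_generated smul br (H \<union> range e \<union> range f) = UNIV"
    and ideal_0: "lie_ideal smul br J \<Longrightarrow> J \<inter> H = {0} \<Longrightarrow> J = {0}"
  using kac_moody unfolding kac_moody_def by auto

lemma br_f_e: "br (f j) (e i) = (if i = j then - hv i else 0)"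
  using br_skew[of "f j" "e i"] br_e_f by simp

lemma br_e_hv: "br (e i) (hv k) = smul (- of_int (A k i)) (e i)"
  using br_skew[of "e i" "hv k"] br_h_e[of "hv k" i] by simp

lemma H_sum: "(\<And>x. x \<in> X \<Longrightarrow> g x \<in> H) \<Longrightarrow> sum g X \<in> H"
  using H_subspace by (rule subspace_sum)

lemma H_smul: "h \<in> H \<Longrightarrow> smul c h \<in> H"
  using H_subspace by (rule subspace_scale)

lemma al_0 [simp]: "al i 0 = 0"
  using al_smul[of 0 i 0] subspace_0[OF H_subspace] by simp

lemma V_I: "(\<And>h. h \<in> H \<Longrightarrow> br h x = smul (wt al \<gamma> h) x) \<Longrightarrow> x \<in> V \<gamma>"
  by (simp add: root_space_def)

lemma V_D: "x \<in> V \<gamma> \<Longrightarrow> h \<in> H \<Longrightarrow> br h x = smul (wt al \<gamma> h) x"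
  by (simp add: root_space_def)

lemma V_subspace: "subspace (V \<gamma>)"
  by (rule subspaceI)
    (auto simp: root_space_def br_add_right br_smul_right scale_right_distrib mult.commute)

lemma V_0 [simp]: "0 \<in> V \<gamma>" by (simp add: root_space_def)

lemmas V_add = subspace_add[OF V_subspace]
lemmas V_diff = subspace_diff[OF V_subspace]
lemmas V_neg = subspace_neg[OF V_subspace]
lemmas V_smul = subspace_scale[OF V_subspace]
lemmas V_sum = subspace_sum[OF V_subspace]

lemma V_br: "x \<in> V \<gamma> \<Longrightarrow> y \<in> V \<delta> \<Longrightarrow> br x y \<in> V (\<gamma> + \<delta>)"
  by (rule V_I) (simp add: br_br[of _ x y] V_D br_smul_left br_smul_right scale_left_distrib)

lemma e_V [simp]: "e i \<in> V (simple_root i)" and f_V [simp]: "f i \<in> V (- simple_root i)"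
  by (auto intro!: V_I simp: br_h_e br_h_f)

lemma H_V: "h \<in> H \<Longrightarrow> h \<in> V 0"
  by (rule V_I) (simp add: br_H_H)

lemma br_e_V: "x \<in> V \<gamma> \<Longrightarrow> br (e i) x \<in> V (\<gamma> + simple_root i)"
  using V_br[OF e_V, of x \<gamma> i] by (simp add: add.commute)

lemma br_f_V: "x \<in> V \<gamma> \<Longrightarrow> br (f i) x \<in> V (\<gamma> - simple_root i)"
  using V_br[OF f_V, of x \<gamma> i] by simp

lemma br_pow_V: "x \<in> V \<gamma> \<Longrightarrow> y \<in> V \<delta> \<Longrightarrow> (br y ^^ n) x \<in> V (\<gamma> + nmult n \<delta>)"
proof (induction n)
  case (Suc n)
  have "br y ((br y ^^ n) x) \<in> V (\<delta> + (\<gamma> + nmult n \<delta>))"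
    using V_br[OF Suc.prems(2) Suc.IH[OF Suc.prems]] .
  moreover have "\<delta> + (\<gamma> + nmult n \<delta>) = \<gamma> + nmult (Suc n) \<delta>"
    by (simp only: nmult_Suc ac_simps)
  ultimately show ?case by (simp only: funpow.simps o_apply)
qed simp

lemma wt_hv: "wt al \<gamma> (hv i) = of_int (pair A i \<gamma>)"
  by (simp add: wt_def pair_def)

lemma V_hv: "x \<in> V \<gamma> \<Longrightarrow> br (hv i) x = smul (of_int (pair A i \<gamma>)) x"
  by (simp add: V_D wt_hv)

text \<open>Independence of the simple roots on \<open>H\<close> embeds the root lattice into the
  dual of \<open>H\<close>, so distinct lattice elements have distinct weights.\<close>

lemma wt_inject:
  assumes "\<And>h. h \<in> H \<Longrightarrow> wt al \<gamma> h = wt al \<delta> h"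
  shows "\<gamma> = \<delta>"
proof
  fix i
  have "of_int ((\<gamma> - \<delta>) i) = (0::complex)"
  proof (rule al_indep)
    fix h assume "h \<in> H"
    then have "wt al (\<gamma> - \<delta>) h = 0" using assms by simp
    then show "(\<Sum>i\<in>UNIV. of_int ((\<gamma> - \<delta>) i) * al i h) = 0" by (simp only: wt_def)
  qed
  then show "\<gamma> i = \<delta> i" by simp
qed

lemma V_indep:
  assumes "finite F" "\<And>\<gamma>. \<gamma> \<in> F \<Longrightarrow> z \<gamma> \<in> V \<gamma>" "(\<Sum>\<gamma>\<in>F. z \<gamma>) = 0"
  shows "\<forall>\<gamma>\<in>F. z \<gamma> = 0"
  using assms
proof (induction F arbitrary: z rule: finite_induct)
  case (insert \<delta> F)
  have z0: "z \<gamma> = 0" if g: "\<gamma> \<in> F" for \<gamma>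
  proof -
    \<comment> \<open>Separate \<gamma> from \<delta> by some \<open>h\<close>; applying
      \<open>ad h\<close> minus the scalar \<open>wt al \<delta> h\<close> to the relation
      eliminates \<open>z \<delta>\<close>.\<close>
    obtain h where h: "h \<in> H" "wt al \<gamma> h \<noteq> wt al \<delta> h"
      using wt_inject[of \<gamma> \<delta>] g insert.hyps(2) by metis
    have s: "z \<delta> = - (\<Sum>\<gamma>\<in>F. z \<gamma>)" using insert by (simp add: eq_neg_iff_add_eq_0)
    have "0 = br h (z \<delta> + (\<Sum>\<gamma>\<in>F. z \<gamma>))" using insert by simp
    also have "\<dots> = smul (wt al \<delta> h) (z \<delta>) + (\<Sum>\<gamma>\<in>F. smul (wt al \<gamma> h) (z \<gamma>))"
      using V_D[OF insert.prems(1) h(1)] by (simp add: br_add_right br_sum_right)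
    also have "\<dots> = (\<Sum>\<gamma>\<in>F. smul (wt al \<gamma> h - wt al \<delta> h) (z \<gamma>))"
      by (simp add: s scale_sum_right scale_left_diff_distrib sum_subtractf)
    finally have "\<forall>\<gamma>\<in>F. smul (wt al \<gamma> h - wt al \<delta> h) (z \<gamma>) = 0"
      by (intro insert.IH) (auto intro: V_smul insert.prems)
    then show ?thesis using g h by auto
  qed
  then have "(\<Sum>\<gamma>\<in>F. z \<gamma>) = 0" by (intro sum.neutral) auto
  then show ?case using z0 insert by simp
qed simp

text \<open>Used with families \<open>D\<close> that are cut down in certain degrees: membership in
  the span then forces a homogeneous vector of such a degree into the smaller space, often
  0.\<close>

lemma V_component:
  assumes "x \<in> span (\<Union>(range D))" "x \<in> V \<delta>" "\<And>\<gamma>. D \<gamma> \<subseteq> V \<gamma>" "\<And>\<gamma>. subspace (D \<gamma>)"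
  shows "x \<in> D \<delta>"
proof -
  obtain F us where F: "finite F" "\<And>\<gamma>. us \<gamma> \<in> D \<gamma>" "x = (\<Sum>\<gamma>\<in>F. us \<gamma>)"
    using assms(1,4) by (rule span_UN_sumE) blast
  define us' where "us' \<gamma> = (if \<gamma> \<in> F then us \<gamma> else 0)" for \<gamma>
  have us': "us' \<gamma> \<in> D \<gamma>" for \<gamma> using F assms(4) subspace_0 by (auto simp: us'_def)
  have x: "x = (\<Sum>\<gamma>\<in>insert \<delta> F. us' \<gamma>)"
    unfolding F(3) using F(1) by (intro sum.mono_neutral_cong_left) (auto simp: us'_def)
  have "(\<Sum>\<gamma>\<in>insert \<delta> F. us' \<gamma> - (if \<gamma> = \<delta> then x else 0)) = 0"
    using F(1) by (simp add: sum_subtractf x[symmetric])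
  then have "\<forall>\<gamma>\<in>insert \<delta> F. us' \<gamma> - (if \<gamma> = \<delta> then x else 0) = 0"
    by (intro V_indep) (use F us' assms in \<open>auto intro!: V_diff\<close>)
  then have "us' \<delta> = x" by simp
  then show ?thesis using us' by metis
qed

lemma generated_induct:
  assumes "subspace K" "\<And>x y. x \<in> K \<Longrightarrow> y \<in> K \<Longrightarrow> br x y \<in> K"
    and "H \<subseteq> K" "\<And>i. e i \<in> K" "\<And>i. f i \<in> K"
  shows "x \<in> K"
proof -
  have "lie_generated smul br (H \<union> range e \<union> range f) \<subseteq> K"
    unfolding lie_generated_def by (rule Inter_lower) (use assms in auto)
  then show ?thesis using lie_gen by auto
qed

text \<open>The elements \<open>y\<close> whose adjoint action preserves \<open>J\<close> form a
  subalgebra by the Jacobi identity, and it contains the generators.\<close>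

lemma stable_imp_ideal:
  assumes "subspace J" "\<And>x i. x \<in> J \<Longrightarrow> br (e i) x \<in> J" "\<And>x i. x \<in> J \<Longrightarrow> br (f i) x \<in> J"
    "\<And>x h. x \<in> J \<Longrightarrow> h \<in> H \<Longrightarrow> br h x \<in> J"
  shows "x \<in> J \<Longrightarrow> br y x \<in> J"
proof -
  have "y \<in> {y. \<forall>x\<in>J. br y x \<in> J}"
  proof (rule generated_induct)
    show "subspace {y. \<forall>x\<in>J. br y x \<in> J}"
      using assms(1) by (intro subspaceI)
        (auto simp: br_add_left br_smul_left subspace_0 subspace_add subspace_scale)
    fix u v assume uv: "u \<in> {y. \<forall>x\<in>J. br y x \<in> J}" "v \<in> {y. \<forall>x\<in>J. br y x \<in> J}"
    have "br (br u v) x = br u (br v x) - br v (br u x)" for x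
      using br_br[of u v x] by simp
    then show "br u v \<in> {y. \<forall>x\<in>J. br y x \<in> J}"
      using uv assms(1) by (auto intro: subspace_diff)
  qed (use assms in auto)
  then show "x \<in> J \<Longrightarrow> br y x \<in> J" by simp
qed

text \<open>For a singular vector \<open>z\<close> of positive height, \<open>raised z\<close> is the ideal generated by \<open>z\<close>; it lives
  in positive heights, so it meets \<open>H\<close> trivially.\<close>

inductive_set raised :: "'g \<Rightarrow> 'g set" for z where
  raised_base: "z \<in> raised z"
| raised_e: "u \<in> raised z \<Longrightarrow> br (e i) u \<in> raised z"
| raised_add: "u \<in> raised z \<Longrightarrow> v \<in> raised z \<Longrightarrow> u + v \<in> raised z"
| raised_smul: "u \<in> raised z \<Longrightarrow> smul c u \<in> raised z"

text \<open>Minimality of the algebra enters the proof here and, through the swap, in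
  \<open>no_cosingular\<close>. Closure of \<open>raised z\<close> under \<open>e\<close> alone
  suffices: moving \<open>f j\<close> past \<open>e i\<close> leaves a term in \<open>hv i\<close>,
  and \<open>f j\<close> kills \<open>z\<close>.\<close>

lemma no_singular:
  assumes z: "z \<in> V \<gamma>" "ht \<gamma> > 0" and f0: "\<And>j. br (f j) z = 0"
  shows "z = 0"
proof -
  let ?J = "raised z"
  have sub: "subspace ?J"
    using raised_smul[OF raised_base, of 0] by (intro subspaceI) (auto intro: raised.intros)
  have H: "br h u \<in> ?J" if "u \<in> ?J" "h \<in> H" for u h
    using that(1)
  proof induction
    case raised_base
    then show ?case using V_D[OF z(1) that(2)] by (auto intro: raised.intros)
  next
    case (raised_e u i)
    have "br h (br (e i) u) = smul (al i h) (br (e i) u) + br (e i) (br h u)"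
      using br_br[of h "e i" u] that by (simp add: br_h_e br_smul_left)
    then show ?case using raised_e by (auto intro: raised.intros)
  qed (auto simp: br_add_right br_smul_right intro: raised.intros)
  have F: "br (f j) u \<in> ?J" if "u \<in> ?J" for u j
    using that
  proof induction
    case raised_base
    then show ?case using f0 subspace_0[OF sub] by simp
  next
    case (raised_e u i)
    have "br (f j) (br (e i) u) = (if i = j then - br (hv i) u else 0) + br (e i) (br (f j) u)"
      using br_br[of "f j" "e i" u] by (simp add: br_f_e)
    then show ?case
      using raised.raised_e[OF raised_e.IH] subspace_neg[OF sub H[OF raised_e.hyps hv_H]]
      by (simp add: raised_add add.commute[of "- _"] del: add_uminus_conv_diff uminus_add_conv_diff)
  qed (auto simp: br_add_right br_smul_right intro: raised.intros)
  \<comment> \<open>Degrees of nonpositive height are cut down to 0, so that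
    \<open>V_component\<close> in degree 0 yields the trivial intersection with
    \<open>H\<close>.\<close>
  define D where "D \<gamma> = (if ht \<gamma> > 0 then V \<gamma> else {0})" for \<gamma>
  have D: "D \<gamma> \<subseteq> V \<gamma>" "subspace (D \<gamma>)" for \<gamma> by (auto simp: D_def V_subspace)
  have J: "u \<in> span (\<Union>(range D))" if "u \<in> ?J" for u
    using that
  proof induction
    case raised_base
    have "z \<in> D \<gamma>" using z by (simp add: D_def)
    then show ?case by (intro span_base) auto
  next
    case (raised_e u i)
    from raised_e(2) show ?case
    proof (induction rule: span_induct_alt)
      case base
      then show ?case by (simp add: span_zero)
    next
      case (step c x y)
      then obtain \<delta> where "x \<in> D \<delta>" by auto
      then have "br (e i) x \<in> D (\<delta> + simple_root i)"
        using br_e_V[of x \<delta> i] by (auto simp: D_def split: if_splits)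
      then have "br (e i) x \<in> span (\<Union>(range D))" by (intro span_base) auto
      then show ?case using step by (simp add: br_add_right br_smul_right span_add span_scale)
    qed
  qed (auto intro: span_add span_scale)
  have "?J \<inter> H = {0}"
  proof (intro equalityI subsetI)
    fix x assume "x \<in> ?J \<inter> H"
    then have "x \<in> D 0" using V_component[of x D 0] J H_V D by auto
    then show "x \<in> {0}" by (simp add: D_def)
  qed (use sub H_subspace subspace_0 in auto)
  moreover have "lie_ideal smul br ?J"
    unfolding lie_ideal_def using sub stable_imp_ideal[OF sub] H F by (auto intro: raised_e)
  ultimately have "?J = {0}" using ideal_0 by blast
  then show ?thesis using raised_base[of z] by auto
qed

text \<open>The vector has positive height, so by \<open>no_singular\<close> it suffices that every
  \<open>f k\<close> kills it. For \<open>k = i\<close> the sl2 scalar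
  \<open>(n+1)(A i j + n)\<close> vanishes at \<open>n = - A i j\<close>.\<close>

lemma serre: "i \<noteq> j \<Longrightarrow> (br (e i) ^^ nat (1 - A i j)) (e j) = 0"
proof -
  assume ij: "i \<noteq> j"
  define n where "n = nat (- A i j)"
  have nA: "of_int (A i j) = - (of_nat n :: complex)" using A_offdiag[OF ij] by (simp add: n_def)
  have N: "nat (1 - A i j) = Suc n" using A_offdiag[OF ij] by (simp add: n_def nat_diff_distrib)
  let ?u = "(br (e i) ^^ Suc n) (e j)"
  have "?u = 0"
  proof (rule no_singular)
    show "?u \<in> V (simple_root j + nmult (Suc n) (simple_root i))"
      by (rule br_pow_V) auto
    show "0 < ht (simple_root j + nmult (Suc n) (simple_root i))" by simp
    fix k
    show "br (f k) ?u = 0"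
    proof (cases "k = i")
      case True
      have "br (f i) ?u = smul (- (of_nat (Suc n) * (of_int (A i j) + of_nat n))) ((br (e i) ^^ n) (e j))"
        by (rule sl2_lowering(2)[where t = "hv i"])
          (use ij in \<open>auto simp: br_e_f br_h_e br_f_e\<close>)
      then show ?thesis using True nA by simp
    next
      case False
      have "br (f k) ((br (e i) ^^ m) x) = (br (e i) ^^ m) (br (f k) x)" for m x
        by (induction m) (use False br_br[of "f k" "e i"] in \<open>auto simp: br_f_e\<close>)
      then have *: "br (f k) ?u = (br (e i) ^^ Suc n) (br (f k) (e j))" .
      show ?thesis
      proof (cases "k = j")
        case True
        \<comment> \<open>\<open>[f j, e j]\<close> is \<open>- hv j\<close>, and one
          \<open>e i\<close> turns it into a multiple of \<open>e i\<close> by \<open>A j i\<close>.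
          For \<open>n > 0\<close> the next \<open>e i\<close> kills this; for \<open>n = 0\<close>
          the entry \<open>A i j\<close> is zero, hence also \<open>A j i\<close>.\<close>
        have e1: "br (e i) (br (f k) (e j)) = smul (of_int (A j i)) (e i)"
          using True by (simp add: br_f_e br_e_hv)
        show ?thesis
        proof (cases "n = 0")
          case True
          then have "A i j = 0" using nA by simp
          then have "A j i = 0" by (rule A_zero)
          then show ?thesis unfolding * using e1 True by simp
        next
          case False
          then obtain m where "n = Suc m" by (metis not0_implies_Suc)
          then show ?thesis unfolding * using e1
            by (simp add: funpow_Suc_right br_pow_smul br_smul_right del: funpow.simps)
        qed
      qed (use * in \<open>auto simp: br_f_e simp del: funpow.simps\<close>)
    qed
  qed
  then show ?thesis using N by simp
qed

text \<open>By \<open>br_pow_br_eq_0\<close> the elements killed by some power of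
  \<open>ad (e i)\<close> form a subalgebra, so only generators need checking; \<open>serre\<close>
  does the \<open>e j\<close>.\<close>

lemma e_locally_nilpotent: "\<exists>n. (br (e i) ^^ n) x = 0"
proof -
  let ?K = "{x. \<exists>n. (br (e i) ^^ n) x = 0}"
  have "x \<in> ?K"
  proof (rule generated_induct)
    show "subspace ?K"
    proof (rule subspaceI)
      fix x y assume "x \<in> ?K" "y \<in> ?K"
      then obtain m n where "(br (e i) ^^ m) x = 0" "(br (e i) ^^ n) y = 0" by auto
      then have "(br (e i) ^^ max m n) (x + y) = 0"
        by (simp add: br_pow_add br_pow_le[of m _ x] br_pow_le[of n _ y])
      then show "x + y \<in> ?K" by blast
    qed (auto simp: br_pow_smul intro: exI[of _ 0])
  next
    fix x y assume "x \<in> ?K" "y \<in> ?K"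
    then show "br x y \<in> ?K" using br_pow_br_eq_0[of _ "e i" x _ y] by blast
  next
    show "H \<subseteq> ?K"
    proof
      fix h assume "h \<in> H"
      then have "(br (e i) ^^ 2) h = 0"
        using br_skew[of "e i" h] by (simp add: numeral_2_eq_2 br_h_e br_smul_right)
      then show "h \<in> ?K" by blast
    qed
  next
    fix j
    show "e j \<in> ?K"
      using serre[of i j] exI[of "\<lambda>n. (br (e i) ^^ n) (e i) = 0" 1] by (cases "i = j") auto
  next
    fix j
    \<comment> \<open>The exponent is dictated by \<open>j = i\<close>: \<open>f i\<close> goes to
      \<open>hv i\<close>, then to a multiple of \<open>e i\<close>, then to 0.\<close>
    have "(br (e i) ^^ 3) (f j) = 0"
      by (simp add: numeral_3_eq_3 br_e_f br_e_hv br_smul_right)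
    then show "f j \<in> ?K" by blast
  qed
  then show ?thesis by simp
qed

text \<open>Climb with \<open>e i\<close> to a vector \<open>v\<close> killed by \<open>e i\<close>,
  of \<open>hv i\<close>-eigenvalue \<open>L = m + 2p\<close>. Powers of \<open>f i\<close> up to
  \<open>L\<close> do not kill \<open>v\<close>, and \<open>m + p\<close> of them reach the
  reflected weight. Negative pairings are left to the swap, in \<open>reflect_V\<close>.\<close>

lemma reflect_down:
  assumes z: "z \<in> V \<gamma>" "z \<noteq> 0" and m: "0 \<le> pair A i \<gamma>"
  shows "\<exists>z'\<in>V (refl A i \<gamma>). z' \<noteq> 0"
proof -
  define m where "m = nat (pair A i \<gamma>)"
  have mp: "pair A i \<gamma> = int m" using assms by (simp add: m_def)
  have "\<exists>p. (br (e i) ^^ p) z \<noteq> 0 \<and> (br (e i) ^^ Suc p) z = 0"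
  proof (rule ccontr)
    assume "\<not> ?thesis"
    then have *: "(br (e i) ^^ p) z \<noteq> 0 \<Longrightarrow> (br (e i) ^^ Suc p) z \<noteq> 0" for p by auto
    have "(br (e i) ^^ p) z \<noteq> 0" for p
      by (induction p) (use z * in auto)
    then show False using e_locally_nilpotent[of i z] by auto
  qed
  then obtain p where p: "(br (e i) ^^ p) z \<noteq> 0" "br (e i) ((br (e i) ^^ p) z) = 0" by auto
  define v where "v = (br (e i) ^^ p) z"
  have v: "v \<in> V (\<gamma> + nmult p (simple_root i))" "v \<noteq> 0" "br (e i) v = 0"
    using p br_pow_V[OF z(1) e_V] by (auto simp: v_def)
  define L where "L = m + 2 * p"
  have hv: "br (- hv i) v = smul (- of_nat L) v"
    using V_hv[OF v(1), of i] by (simp add: mp L_def algebra_simps)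
  have ef: "br (e i) ((br (f i) ^^ Suc n) v)
      = smul (- (of_nat (Suc n) * (- of_nat L + of_nat n))) ((br (f i) ^^ n) v)" for n
    by (rule sl2_lowering(2)[where t = "- hv i"]) (use v hv in \<open>auto simp: br_f_e br_h_f\<close>)
  have fn: "n \<le> L \<Longrightarrow> (br (f i) ^^ n) v \<noteq> 0" for n
  proof (induction n)
    case 0
    then show ?case using v by simp
  next
    case (Suc n)
    have "of_nat n \<noteq> (of_nat L :: complex)" using Suc.prems by simp
    then have "- (of_nat (Suc n) * (- of_nat L + of_nat n)) \<noteq> (0 :: complex)"
      by (simp del: of_nat_Suc)
    then have "br (e i) ((br (f i) ^^ Suc n) v) \<noteq> 0"
      unfolding ef using Suc by (simp del: of_nat_Suc)
    then show ?case by auto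
  qed
  have "(br (f i) ^^ (m + p)) v \<in> V (\<gamma> + nmult p (simple_root i) + nmult (m + p) (- simple_root i))"
    by (rule br_pow_V) (use v in auto)
  also have "\<gamma> + nmult p (simple_root i) + nmult (m + p) (- simple_root i)
      = \<gamma> - nmult m (simple_root i)" by (simp add: nmult_add algebra_simps)
  also have "\<dots> = refl A i \<gamma>"
    using mp by (auto simp: refl_def pair_def simple_root_def nmult_def fun_eq_iff)
  finally show ?thesis using fn[of "m + p"] by (auto simp: L_def)
qed

end

section \<open>Maps out of the derived algebra\<close>

text \<open>As simp rules, the pointwise equations rewrite eta-expanded weights \<open>\<gamma> + \<delta>\<close> into abstractions,
  after which the lemmas on root spaces no longer match.\<close>

declare plus_fun_apply [simp del] zero_fun_apply [simp del] minus_apply [simp del]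
  uminus_apply [simp del]

lemmas fun_arith = plus_fun_apply zero_fun_apply minus_apply uminus_apply

lemma root_space_uminus:
  "root_space smul br H (\<lambda>i h. - al i h) \<gamma> = root_space smul br H al (- \<gamma>)"
  by (simp add: root_space_def wt_uminus_fun)

text \<open>The swap gives the lowering version of each statement about raising operators.\<close>

lemma (in kac_moody_alg) kac_moody_swap:
  "kac_moody_alg A smul br H (\<lambda>i. - hv i) (\<lambda>i h. - al i h) f e"
proof
  show "gcm A" by (rule gcm)
  have *: "lie_generated smul br (H \<union> range f \<union> range e) = UNIV"
    using lie_gen by (simp add: Un_assoc Un_commute[of "range f"])
  have hvi: "\<forall>i. c i = 0" if "(\<Sum>i\<in>UNIV. smul (c i) (- hv i)) = 0" for c
    using hv_indep[of "\<lambda>i. - c i"] that by simp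
  have ali: "\<forall>i. c i = 0" if "\<forall>h\<in>H. (\<Sum>i\<in>UNIV. c i * - al i h) = 0" for c
    using al_indep[of "\<lambda>i. - c i"] that by simp
  have hv: "- hv i \<in> H" for i using subspace_neg[OF H_subspace hv_H] .
  have alm: "al j (- hv i) = - of_int (A i j)" for i j
    using al_smul[of "hv i" j "-1"] by simp
  show "kac_moody A smul br H (\<lambda>i. - hv i) (\<lambda>i h. - al i h) f e"
    using kac_moody hvi ali hv * br_f_e
    unfolding kac_moody_def by (auto simp: alm)
qed

context kac_moody_alg
begin

text \<open>\<open>G\<close> is the derived algebra: the span of the coroots and all root spaces.\<close>

inductive_set G :: "'g set" where
  G_hv: "hv i \<in> G"
| G_e: "x \<in> G \<Longrightarrow> br (e i) x \<in> G"
| G_f: "x \<in> G \<Longrightarrow> br (f i) x \<in> G"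
| G_add: "x \<in> G \<Longrightarrow> y \<in> G \<Longrightarrow> x + y \<in> G"
| G_smul: "x \<in> G \<Longrightarrow> smul c x \<in> G"

lemma G_0: "0 \<in> G" using G_smul[OF G_hv, of 0] by simp

lemma G_subspace: "subspace G"
  using G_0 by (intro subspaceI) (auto intro: G.intros)

lemma e_G [simp]: "e i \<in> G" and f_G [simp]: "f i \<in> G"
proof -
  have "smul (- (1/2)) (br (e i) (hv i)) \<in> G" "smul (1/2) (br (f i) (hv i)) \<in> G"
    by (intro G.intros)+
  then show "e i \<in> G" "f i \<in> G"
    using br_skew[of "f i" "hv i"] by (simp_all add: br_e_hv br_h_f)
qed

lemma G_br_H: "x \<in> G \<Longrightarrow> h \<in> H \<Longrightarrow> br h x \<in> G"
proof (induction rule: G.induct)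
  case (G_hv i)
  then show ?case using br_H_H[of h "hv i"] G_0 by simp
next
  case (G_e x i)
  then show ?case using br_br[of h "e i" x]
    by (auto simp: br_h_e br_smul_left intro!: G.intros)
next
  case (G_f x i)
  have "br h (br (f i) x) = smul (- al i h) (br (f i) x) + br (f i) (br h x)"
    using br_br[of h "f i" x] G_f.prems by (simp only: br_h_f br_smul_left)
  then show ?case using G_f by (simp only: G.intros)
qed (auto simp: br_add_right br_smul_right intro: G.intros)

lemma G_ideal: "x \<in> G \<Longrightarrow> br y x \<in> G"
  using stable_imp_ideal[OF G_subspace, of x y] G_br_H by (auto intro: G.intros)

text \<open>Sums \<open>u + h\<close> are closed under the bracket because \<open>G\<close> is an
  ideal and \<open>H\<close> is abelian.\<close>

lemma ex_G_plus_H: "\<exists>u\<in>G. \<exists>h\<in>H. x = u + h"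
proof -
  have "x \<in> {u + h |u h. u \<in> G \<and> h \<in> H}"
  proof (rule generated_induct)
    show "subspace {u + h |u h. u \<in> G \<and> h \<in> H}"
      using G_subspace H_subspace by (rule subspace_sums)
    fix x y assume "x \<in> {u + h |u h. u \<in> G \<and> h \<in> H}" "y \<in> {u + h |u h. u \<in> G \<and> h \<in> H}"
    then obtain u h v h' where *: "x = u + h" "y = v + h'" "u \<in> G" "v \<in> G" "h \<in> H" "h' \<in> H"
      by auto
    then have "br x y = br x v - br h' u"
      using br_skew[of u h'] by (simp add: br_add_left br_add_right br_H_H)
    also have "\<dots> \<in> G" using * G_ideal subspace_diff[OF G_subspace] by blast
    finally have "br x y \<in> G" .
    then show "br x y \<in> {u + h |u h. u \<in> G \<and> h \<in> H}"
      using subspace_0[OF H_subspace] by force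
  next
    show "H \<subseteq> {u + h |u h. u \<in> G \<and> h \<in> H}" using G_0 by force
  qed (use subspace_0[OF H_subspace] e_G f_G in force)+
  then show ?thesis by auto
qed

end

text \<open>\<open>W\<close> is a graded module on which \<open>E i\<close>, \<open>F i\<close> act like \<open>e i\<close>, \<open>f i\<close> and whose vectors \<open>wv i\<close> behave like
  the coroots. Since \<open>W\<close> has no lowest weight vectors in positive height and no highest ones in
  negative height, \<open>hv i \<mapsto> wv i\<close> extends to an intertwiner from \<open>G\<close> to \<open>W\<close>. The anti-involution and
  the invariant form are both obtained in this way.\<close>

locale km_rep = kac_moody_alg A smul br H hv al e f + W: vector_space smulW
  for A :: "'i::finite \<Rightarrow> 'i \<Rightarrow> int"
    and smul :: "complex \<Rightarrow> 'g::ab_group_add \<Rightarrow> 'g" and br :: "'g \<Rightarrow> 'g \<Rightarrow> 'g"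
    and H :: "'g set" and hv :: "'i \<Rightarrow> 'g" and al :: "'i \<Rightarrow> 'g \<Rightarrow> complex"
    and e f :: "'i \<Rightarrow> 'g"
    and smulW :: "complex \<Rightarrow> 'w::ab_group_add \<Rightarrow> 'w" +
  fixes E F :: "'i \<Rightarrow> 'w \<Rightarrow> 'w" and Wt :: "('i \<Rightarrow> int) \<Rightarrow> 'w set" and wv :: "'i \<Rightarrow> 'w"
  assumes Wt_subspace: "W.subspace (Wt \<gamma>)"
    and E_add: "E i (w + w') = E i w + E i w'" and E_smul: "E i (smulW c w) = smulW c (E i w)"
    and F_add: "F i (w + w') = F i w + F i w'" and F_smul: "F i (smulW c w) = smulW c (F i w)"
    and E_Wt: "w \<in> Wt \<gamma> \<Longrightarrow> E i w \<in> Wt (\<gamma> + simple_root i)"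
    and F_Wt: "w \<in> Wt \<gamma> \<Longrightarrow> F i w \<in> Wt (\<gamma> - simple_root i)"
    and E_F: "w \<in> Wt \<gamma> \<Longrightarrow> E i (F j w)
        = F j (E i w) + (if i = j then smulW (of_int (pair A i \<gamma>)) w else 0)"
    and wv_Wt: "wv k \<in> Wt 0"
    and F_E_wv: "F j (E i (wv k)) = (if i = j then smulW (of_int (A k i)) (wv i) else 0)"
    and no_lowest: "w \<in> Wt \<gamma> \<Longrightarrow> ht \<gamma> > 0 \<Longrightarrow> (\<And>j. F j w = 0) \<Longrightarrow> w = 0"
    and no_highest: "w \<in> Wt \<gamma> \<Longrightarrow> ht \<gamma> < 0 \<Longrightarrow> (\<And>j. E j w = 0) \<Longrightarrow> w = 0"

lemma (in km_rep) km_rep_swap: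
  "km_rep A smul br H (\<lambda>i. - hv i) (\<lambda>i h. - al i h) f e smulW F E (\<lambda>\<gamma>. Wt (- \<gamma>)) (\<lambda>i. - wv i)"
proof -
  interpret sw: kac_moody_alg A smul br H "\<lambda>i. - hv i" "\<lambda>i h. - al i h" f e
    by (rule kac_moody_swap)
  have Em: "E i (- w) = - E i w" and Fm: "F i (- w) = - F i w" for i w
    using E_smul[of i "-1" w] F_smul[of i "-1" w] by simp_all
  show ?thesis
  proof unfold_locales
    fix w \<gamma> i j assume w: "w \<in> Wt (- \<gamma>)"
    show "F i (E j w) = E j (F i w) + (if i = j then smulW (of_int (pair A i \<gamma>)) w else 0)"
      using E_F[OF w, of j i] by auto
    show "E i w \<in> Wt (- (\<gamma> - simple_root i))" "F i w \<in> Wt (- (\<gamma> + simple_root i))"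
      using E_Wt[OF w, of i] F_Wt[OF w, of i] by (simp_all add: algebra_simps)
  next
    fix i j k
    \<comment> \<open>In weight 0 the commutator term of \<open>E_F\<close> is zero, so the two
      operators may be exchanged before \<open>F_E_wv\<close> is applied.\<close>
    show "E j (F i (- wv k)) = (if i = j then smulW (of_int (A k i)) (- wv i) else 0)"
      using E_F[OF wv_Wt, of j i k] by (auto simp: Em Fm F_E_wv)
  next
    fix w \<gamma> assume "w \<in> Wt (- \<gamma>)" "ht \<gamma> > 0" "\<And>j. E j w = 0"
    then show "w = 0" using no_highest[of w "- \<gamma>"] by simp
  next
    fix w \<gamma> assume "w \<in> Wt (- \<gamma>)" "ht \<gamma> < 0" "\<And>j. F j w = 0"
    then show "w = 0" using no_lowest[of w "- \<gamma>"] by simp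
  next
    show "- wv k \<in> Wt (- 0)" for k using W.subspace_neg[OF Wt_subspace wv_Wt] by simp
  qed (auto simp: Wt_subspace E_add E_smul F_add F_smul)
qed

context km_rep
begin

lemma E_0 [simp]: "E i 0 = 0" and F_0 [simp]: "F i 0 = 0"
  using E_smul[of i 0 0] F_smul[of i 0 0] by simp_all

lemma E_sum: "E i (sum g X) = (\<Sum>x\<in>X. E i (g x))" and F_sum: "F i (sum g X) = (\<Sum>x\<in>X. F i (g x))"
  by (induction X rule: infinite_finite_induct) (simp_all add: E_add F_add)

text \<open>The graph of the intertwiner in nonnegative degrees. It is stable under lowering, so a pair
  \<open>(0, w)\<close> in it of minimal height would make \<open>w\<close> a lowest weight vector.\<close>

inductive ladder :: "('i \<Rightarrow> int) \<Rightarrow> 'g \<Rightarrow> 'w \<Rightarrow> bool" where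
  ladder_hv: "ladder 0 (hv k) (wv k)"
| ladder_0: "ladder \<gamma> 0 0"
| ladder_e: "ladder \<gamma> u w \<Longrightarrow> \<delta> = \<gamma> + simple_root i \<Longrightarrow> ladder \<delta> (br (e i) u) (E i w)"
| ladder_add: "ladder \<gamma> u w \<Longrightarrow> ladder \<gamma> u' w' \<Longrightarrow> ladder \<gamma> (u + u') (w + w')"
| ladder_smul: "ladder \<gamma> u w \<Longrightarrow> ladder \<gamma> (smul c u) (smulW c w)"

lemma ladder_sum: "(\<And>x. x \<in> X \<Longrightarrow> ladder \<gamma> (g x) (k x)) \<Longrightarrow> ladder \<gamma> (sum g X) (sum k X)"
  by (induction X rule: infinite_finite_induct) (auto intro: ladder.intros)

lemma ladder_neg: "ladder \<gamma> u w \<Longrightarrow> ladder \<gamma> (- u) (- w)"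
  using ladder_smul[of \<gamma> u w "-1"] by simp

lemma ladder_V: "ladder \<gamma> u w \<Longrightarrow> u \<in> V \<gamma> \<and> w \<in> Wt \<gamma>"
proof (induction rule: ladder.induct)
  case (ladder_hv k)
  then show ?case using wv_Wt H_V by simp
next
  case (ladder_e \<gamma> u w \<delta> i)
  then show ?case using br_e_V E_Wt by blast
qed (auto simp: V_add V_smul W.subspace_add[OF Wt_subspace] W.subspace_scale[OF Wt_subspace]
    W.subspace_0[OF Wt_subspace])

lemma ladder_G: "ladder \<gamma> u w \<Longrightarrow> u \<in> G"
  by (induction rule: ladder.induct) (auto intro: G.intros G_0)

text \<open>The second alternative is there because \<open>ladder_0\<close> places
  \<open>(0, 0)\<close> in every degree.\<close>

lemma ladder_sign: "ladder \<gamma> u w \<Longrightarrow> 0 \<le> \<gamma> \<or> u = 0 \<and> w = 0"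
  by (induction rule: ladder.induct) (auto simp: add_nonneg_nonneg)

lemma ladder_zero:
  "ladder \<gamma> u w \<Longrightarrow> \<gamma> = 0 \<Longrightarrow>
    \<exists>c. u = (\<Sum>k\<in>UNIV. smul (c k) (hv k)) \<and> w = (\<Sum>k\<in>UNIV. smulW (c k) (wv k))"
proof (induction rule: ladder.induct)
  case (ladder_hv k)
  have "hv k = (\<Sum>j\<in>UNIV. smul (if j = k then 1 else 0) (hv j))"
       "wv k = (\<Sum>j\<in>UNIV. smulW (if j = k then 1 else 0) (wv j))"
    by (simp_all add: if_distrib[of "\<lambda>c. smul c _"] if_distrib[of "\<lambda>c. smulW c _"] cong: if_cong)
  then show ?case by (intro exI[of _ "\<lambda>j. if j = k then 1 else 0"]) auto
next
  case (ladder_0 \<gamma>)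
  show ?case by (rule exI[of _ "\<lambda>_. 0"]) simp
next
  case (ladder_e \<gamma> u w \<delta> i)
  \<comment> \<open>A raised pair in degree 0 comes from the degree of
    \<open>- simple_root i\<close>, where the ladder contains only \<open>(0, 0)\<close>.\<close>
  then have "\<gamma> = - simple_root i" by (simp add: eq_neg_iff_add_eq_0)
  then have "\<not> 0 \<le> \<gamma>" by (auto simp: le_fun_def simple_root_def fun_arith)
  then have "u = 0" "w = 0" using ladder_sign[OF ladder_e.hyps(1)] by auto
  then show ?case by (intro exI[of _ "\<lambda>_. 0"]) simp
next
  case (ladder_add \<gamma> u w u' w')
  then obtain c c' where
    "u = (\<Sum>k\<in>UNIV. smul (c k) (hv k)) \<and> w = (\<Sum>k\<in>UNIV. smulW (c k) (wv k))"
    "u' = (\<Sum>k\<in>UNIV. smul (c' k) (hv k)) \<and> w' = (\<Sum>k\<in>UNIV. smulW (c' k) (wv k))" by auto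
  then show ?case
    by (intro exI[of _ "\<lambda>k. c k + c' k"]) (simp add: scale_left_distrib W.scale_left_distrib sum.distrib)
next
  case (ladder_smul \<gamma> u w a)
  then obtain c where
    "u = (\<Sum>k\<in>UNIV. smul (c k) (hv k)) \<and> w = (\<Sum>k\<in>UNIV. smulW (c k) (wv k))" by auto
  then show ?case
    by (intro exI[of _ "\<lambda>k. a * c k"]) (simp add: scale_sum_right W.scale_sum_right)
qed

lemma ladder_0_sum:
  "ladder 0 (\<Sum>k\<in>UNIV. smul (c k) (hv k)) (\<Sum>k\<in>UNIV. smulW (c k) (wv k))"
  by (intro ladder_sum ladder_smul ladder_hv)

text \<open>Moving the lowering operator past the outermost raising one leaves a term scaled equally
  on both sides. Degree 0 is excluded because the ladder ends there; a pair raised out of degree 0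
  is handled by \<open>F_E_wv\<close>, which copies the bracket
  \<open>[f j, [e i, hv k]]\<close>.\<close>

lemma ladder_F:
  "ladder \<gamma> u w \<Longrightarrow> \<gamma> \<noteq> 0 \<Longrightarrow> ladder (\<gamma> - simple_root j) (br (f j) u) (F j w)"
proof (induction rule: ladder.induct)
  case (ladder_e \<gamma> u w \<delta> i)
  show ?case
  proof (cases "\<gamma> = 0")
    case True
    then obtain c where c: "u = (\<Sum>k\<in>UNIV. smul (c k) (hv k))" "w = (\<Sum>k\<in>UNIV. smulW (c k) (wv k))"
      using ladder_zero[OF ladder_e.hyps(1)] by auto
    define a where "a = (\<Sum>k\<in>UNIV. c k * of_int (A k i))"
    have "br (f j) (br (e i) u) = (if i = j then smul a (hv i) else 0)"
      unfolding c a_def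
      by (simp add: br_sum_right br_smul_right br_e_hv br_f_e scale_sum_left)
    moreover have "F j (E i w) = (if i = j then smulW a (wv i) else 0)"
      unfolding c a_def by (auto simp: E_sum F_sum E_smul F_smul F_E_wv W.scale_sum_left)
    ultimately show ?thesis
      using True ladder_e.hyps(2) by (auto intro!: ladder.intros)
  next
    case False
    have uw: "u \<in> V \<gamma>" "w \<in> Wt \<gamma>" using ladder_V[OF ladder_e.hyps(1)] by auto
    let ?c = "of_int (pair A i \<gamma>) :: complex"
    have "br (f j) (br (e i) u) = br (e i) (br (f j) u) + (if i = j then - smul ?c u else 0)"
      using br_br[of "f j" "e i" u] V_hv[OF uw(1), of i] by (cases "i = j") (simp_all add: br_f_e)
    moreover have "F j (E i w) = E i (F j w) + (if i = j then - smulW ?c w else 0)"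
      using E_F[OF uw(2), of i j] by auto
    moreover have "ladder (\<delta> - simple_root j) (br (e i) (br (f j) u)) (E i (F j w))"
      using ladder_e.IH[OF False] by (rule ladder.ladder_e) (simp add: ladder_e.hyps(2))
    moreover have "ladder (\<delta> - simple_root j)
        (if i = j then - smul ?c u else 0) (if i = j then - smulW ?c w else 0)"
      using ladder_e.hyps by (auto intro!: ladder_neg ladder.intros)
    ultimately show ?thesis by (simp only: ladder_add)
  qed
qed (auto simp: br_add_right br_smul_right F_add F_smul intro: ladder.intros)

lemma ladder_unique: "ladder \<gamma> 0 w \<Longrightarrow> w = 0"
proof (induction "nat (ht \<gamma>)" arbitrary: \<gamma> w rule: less_induct)
  case less
  show ?case
  proof (cases "\<gamma> = 0")
    case True
    then obtain c where "0 = (\<Sum>k\<in>UNIV. smul (c k) (hv k))" "w = (\<Sum>k\<in>UNIV. smulW (c k) (wv k))"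
      using ladder_zero[OF less.prems] by auto
    then show ?thesis using hv_indep[of c] by simp
  next
    case False
    show ?thesis
    proof (cases "0 \<le> \<gamma>")
      case True
      then have pos: "ht \<gamma> > 0" using False ht_pos by auto
      show ?thesis
      proof (rule no_lowest)
        show "w \<in> Wt \<gamma>" using ladder_V[OF less.prems] by simp
        show "F j w = 0" for j
          using ladder_F[OF less.prems False, of j] pos
          by (intro less.hyps[of "\<gamma> - simple_root j"]) auto
      qed (rule pos)
    next
      case False
      then show ?thesis using ladder_sign[OF less.prems] by simp
    qed
  qed
qed

text \<open>Only the first component matters: for the adjoint module this becomes
  \<open>V_step\<close>, the source of all inductions on height inside root spaces.\<close>

lemma ladder_step:
  "ladder \<gamma> u w \<Longrightarrow> \<gamma> \<noteq> 0 \<Longrightarrow>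
    \<exists>v. (\<forall>i. v i \<in> G \<and> v i \<in> V (\<gamma> - simple_root i)) \<and> u = (\<Sum>i\<in>UNIV. br (e i) (v i))"
proof (induction rule: ladder.induct)
  case (ladder_hv k)
  then show ?case by simp
next
  case (ladder_0 \<gamma>)
  show ?case by (rule exI[of _ "\<lambda>_. 0"]) (simp add: G_0)
next
  case (ladder_e \<gamma> u w \<delta> i)
  have "u \<in> G" "u \<in> V \<gamma>" using ladder_G ladder_V ladder_e.hyps(1) by blast+
  moreover have "br (e i) u = (\<Sum>k\<in>UNIV. br (e k) (if k = i then u else 0))"
    by (simp add: if_distrib[of "br _"] cong: if_cong)
  ultimately show ?case using ladder_e.hyps(2)
    by (intro exI[of _ "\<lambda>k. if k = i then u else 0"]) (auto simp: G_0)
next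
  case (ladder_add \<gamma> u w u' w')
  then obtain v v' where
    "(\<forall>i. v i \<in> G \<and> v i \<in> V (\<gamma> - simple_root i)) \<and> u = (\<Sum>i\<in>UNIV. br (e i) (v i))"
    "(\<forall>i. v' i \<in> G \<and> v' i \<in> V (\<gamma> - simple_root i)) \<and> u' = (\<Sum>i\<in>UNIV. br (e i) (v' i))" by auto
  then show ?case
    by (intro exI[of _ "\<lambda>i. v i + v' i"]) (auto simp: br_add_right sum.distrib V_add G_add)
next
  case (ladder_smul \<gamma> u w c)
  then obtain v where
    "(\<forall>i. v i \<in> G \<and> v i \<in> V (\<gamma> - simple_root i)) \<and> u = (\<Sum>i\<in>UNIV. br (e i) (v i))" by auto
  then show ?case
    by (intro exI[of _ "\<lambda>i. smul c (v i)"]) (auto simp: br_smul_right scale_sum_right V_smul G_smul)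
qed

text \<open>Iterated brackets of \<open>n\<close> generators \<open>e i\<close> with a coroot.
  Finiteness of this set will give finite-dimensional root spaces.\<close>

primrec words :: "nat \<Rightarrow> 'g set" where
  "words 0 = range hv"
| "words (Suc n) = (\<Union>i. br (e i) ` words n)"

lemma finite_words: "finite (words n)"
  by (induction n) auto

lemma ladder_words: "ladder \<gamma> u w \<Longrightarrow> u \<in> span (words (nat (ht \<gamma>)))"
proof (induction rule: ladder.induct)
  case (ladder_e \<gamma> u w \<delta> i)
  show ?case
  proof (cases "0 \<le> \<gamma>")
    case True
    then have n: "nat (ht \<delta>) = Suc (nat (ht \<gamma>))"
      using ladder_e.hyps(2) ht_nonneg[of \<gamma>] by (simp add: nat_add_distrib)
    have "br (e i) u \<in> span (words (Suc n))" if "u \<in> span (words n)" for n u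
      using that
    proof (induction rule: span_induct_alt)
      case base
      then show ?case using span_zero by simp
    next
      case (step c x y)
      have "br (e i) x \<in> span (words (Suc n))" using step by (intro span_base) auto
      then show ?case using step by (simp only: br_add_right br_smul_right span_add span_scale)
    qed
    then show ?thesis using ladder_e.IH n by simp
  next
    case False
    then have "u = 0" using ladder_sign[OF ladder_e.hyps(1)] by simp
    then show ?thesis using span_zero by simp
  qed
next
  case (ladder_hv k)
  then show ?case by (auto intro: span_base)
qed (auto intro: span_zero span_add span_scale)

end

section \<open>Gluing the positive and negative ladders into one intertwiner\<close>

locale km_rep_pair = km_rep A smul br H hv al e f smulW E F Wt wv
  for A :: "'i::finite \<Rightarrow> 'i \<Rightarrow> int"
    and smul :: "complex \<Rightarrow> 'g::ab_group_add \<Rightarrow> 'g" and br :: "'g \<Rightarrow> 'g \<Rightarrow> 'g"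
    and H :: "'g set" and hv :: "'i \<Rightarrow> 'g" and al :: "'i \<Rightarrow> 'g \<Rightarrow> complex"
    and e f :: "'i \<Rightarrow> 'g"
    and smulW :: "complex \<Rightarrow> 'w::ab_group_add \<Rightarrow> 'w"
    and E F :: "'i \<Rightarrow> 'w \<Rightarrow> 'w" and Wt :: "('i \<Rightarrow> int) \<Rightarrow> 'w set" and wv :: "'i \<Rightarrow> 'w"

sublocale km_rep_pair \<subseteq> neg: km_rep A smul br H "\<lambda>i. - hv i" "\<lambda>i h. - al i h" f e
  smulW F E "\<lambda>\<gamma>. Wt (- \<gamma>)" "\<lambda>i. - wv i"
  by (rule km_rep_swap)

context km_rep_pair
begin

text \<open>The two ladders overlap in degree 0, where both consist of the combinations of the pairs
  \<open>(hv k, wv k)\<close>: the sign in the swapped coroots is absorbed into the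
  coefficients.\<close>

definition graded :: "('i \<Rightarrow> int) \<Rightarrow> 'g \<Rightarrow> 'w \<Rightarrow> bool" where
  "graded \<gamma> u w \<longleftrightarrow> ladder \<gamma> u w \<or> neg.ladder (- \<gamma>) u w"

lemma neg_ladder_zero_imp: "neg.ladder 0 u w \<Longrightarrow> ladder 0 u w"
proof -
  assume "neg.ladder 0 u w"
  then obtain c where "u = (\<Sum>k\<in>UNIV. smul (c k) (- hv k))" "w = (\<Sum>k\<in>UNIV. smulW (c k) (- wv k))"
    using neg.ladder_zero by blast
  then show "ladder 0 u w"
    using ladder_0_sum[of "\<lambda>k. - c k"] by simp
qed

lemma ladder_zero_imp: "ladder 0 u w \<Longrightarrow> neg.ladder 0 u w"
proof -
  assume "ladder 0 u w"
  then obtain c where "u = (\<Sum>k\<in>UNIV. smul (c k) (hv k))" "w = (\<Sum>k\<in>UNIV. smulW (c k) (wv k))"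
    using ladder_zero by blast
  then show "neg.ladder 0 u w"
    using neg.ladder_0_sum[of "\<lambda>k. - c k"] by simp
qed

lemma graded_cases:
  assumes "graded \<gamma> u w"
  obtains "0 \<le> \<gamma>" "ladder \<gamma> u w" | "\<gamma> \<le> 0" "neg.ladder (- \<gamma>) u w" | "u = 0" "w = 0"
  using assms ladder_sign[of \<gamma> u w] neg.ladder_sign[of "- \<gamma>" u w] unfolding graded_def by fastforce

lemma graded_V: "graded \<gamma> u w \<Longrightarrow> u \<in> V \<gamma> \<and> w \<in> Wt \<gamma>"
  unfolding graded_def using ladder_V[of \<gamma> u w] neg.ladder_V[of "- \<gamma>" u w]
  by (auto simp: root_space_uminus)

lemma graded_zero: "graded \<gamma> 0 0"
  by (simp add: graded_def ladder_0)

lemma graded_hv: "graded 0 (hv k) (wv k)"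
  by (simp add: graded_def ladder_hv)

lemma graded_smul: "graded \<gamma> u w \<Longrightarrow> graded \<gamma> (smul c u) (smulW c w)"
  unfolding graded_def by (auto intro: ladder_smul neg.ladder_smul)

lemma graded_add: "graded \<gamma> u w \<Longrightarrow> graded \<gamma> u' w' \<Longrightarrow> graded \<gamma> (u + u') (w + w')"
proof (cases "\<gamma> = 0")
  case True
  then show "graded \<gamma> u w \<Longrightarrow> graded \<gamma> u' w' \<Longrightarrow> graded \<gamma> (u + u') (w + w')"
    unfolding graded_def using neg_ladder_zero_imp by (auto intro: ladder_add)
next
  case False
  assume 1: "graded \<gamma> u w" and 2: "graded \<gamma> u' w'"
  from 1 show ?thesis
  proof (cases rule: graded_cases)
    case 1
    from 2 show ?thesis
      by (cases rule: graded_cases) (use 1 False in \<open>auto simp: graded_def intro: ladder_add\<close>)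
  next
    case 3
    then show ?thesis using 2 by simp
  next
    case n: 2
    from 2 show ?thesis
      by (cases rule: graded_cases) (use n False in \<open>auto simp: graded_def intro: neg.ladder_add\<close>)
  qed
qed

text \<open>On the negative side \<open>e i\<close> is a lowering operator, covered by
  \<open>neg.ladder_F\<close> except in degree 0; there the pair also lies in the positive ladder,
  which can be raised.\<close>

lemma graded_e: "graded \<gamma> u w \<Longrightarrow> graded (\<gamma> + simple_root i) (br (e i) u) (E i w)"
proof (cases "\<gamma> = 0")
  case True
  then show "graded \<gamma> u w \<Longrightarrow> ?thesis"
    unfolding graded_def using neg_ladder_zero_imp ladder_e[of 0 u w "simple_root i" i] by auto
next
  case False
  then show "graded \<gamma> u w \<Longrightarrow> ?thesis"
    unfolding graded_def using neg.ladder_F[of "- \<gamma>" u w i] by (auto intro: ladder_e)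
qed

lemma graded_f: "graded \<gamma> u w \<Longrightarrow> graded (\<gamma> - simple_root i) (br (f i) u) (F i w)"
proof (cases "\<gamma> = 0")
  case True
  then show "graded \<gamma> u w \<Longrightarrow> ?thesis"
    unfolding graded_def using ladder_zero_imp neg.ladder_e[of 0 u w "simple_root i" i] by auto
next
  case False
  then show "graded \<gamma> u w \<Longrightarrow> ?thesis"
    unfolding graded_def using ladder_F[of \<gamma> u w i] by (auto intro: neg.ladder_e)
qed

lemma graded_unique: "graded \<gamma> 0 w \<Longrightarrow> w = 0"
  unfolding graded_def using ladder_unique neg.ladder_unique by blast

text \<open>The whole graph, as finite sums of graded pairs. Being a relation it needs no prior
  knowledge that it is single-valued.\<close>

inductive rel :: "'g \<Rightarrow> 'w \<Rightarrow> bool" where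
  rel_0: "rel 0 0"
| rel_add_graded: "rel u w \<Longrightarrow> graded \<gamma> u' w' \<Longrightarrow> rel (u + u') (w + w')"

lemma rel_graded: "graded \<gamma> u w \<Longrightarrow> rel u w"
  using rel_add_graded[OF rel_0, of \<gamma> u w] by simp

lemma rel_add: "rel u' w' \<Longrightarrow> rel u w \<Longrightarrow> rel (u + u') (w + w')"
  by (induction arbitrary: u w rule: rel.induct)
    (auto simp: add.assoc[symmetric] intro: rel_add_graded)

lemma rel_smul: "rel u w \<Longrightarrow> rel (smul c u) (smulW c w)"
  by (induction rule: rel.induct)
    (auto simp: scale_right_distrib W.scale_right_distrib rel_0 intro: rel_add_graded graded_smul)

lemma rel_e: "rel u w \<Longrightarrow> rel (br (e i) u) (E i w)"
  by (induction rule: rel.induct)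
    (auto simp: br_add_right E_add rel_0 intro: rel_add_graded graded_e)

lemma rel_f: "rel u w \<Longrightarrow> rel (br (f i) u) (F i w)"
  by (induction rule: rel.induct)
    (auto simp: br_add_right F_add rel_0 intro: rel_add_graded graded_f)

lemma ex_rel: "u \<in> G \<Longrightarrow> \<exists>w. rel u w"
  by (induction rule: G.induct)
    (blast intro: rel_graded[OF graded_hv] rel_e rel_f rel_smul rel_add)+

lemma rel_sum:
  "rel u w \<Longrightarrow> \<exists>X us ws. finite X \<and> (\<forall>\<gamma>. graded \<gamma> (us \<gamma>) (ws \<gamma>))
      \<and> u = (\<Sum>\<gamma>\<in>X. us \<gamma>) \<and> w = (\<Sum>\<gamma>\<in>X. ws \<gamma>)"
proof (induction rule: rel.induct)
  case rel_0
  then show ?case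
    by (intro exI[of _ "{}"] exI[of _ "\<lambda>_. 0"]) (simp add: graded_zero)
next
  case (rel_add_graded u w \<delta> u' w')
  then obtain X us ws where X: "finite X" "\<And>\<gamma>. graded \<gamma> (us \<gamma>) (ws \<gamma>)"
      "u = (\<Sum>\<gamma>\<in>X. us \<gamma>)" "w = (\<Sum>\<gamma>\<in>X. ws \<gamma>)" by blast
  define us' where "us' \<gamma> = (if \<gamma> \<in> X then us \<gamma> else 0) + (if \<gamma> = \<delta> then u' else 0)" for \<gamma>
  define ws' where "ws' \<gamma> = (if \<gamma> \<in> X then ws \<gamma> else 0) + (if \<gamma> = \<delta> then w' else 0)" for \<gamma>
  have "graded \<gamma> (us' \<gamma>) (ws' \<gamma>)" for \<gamma>
    unfolding us'_def ws'_def
    using X(2)[of \<gamma>] rel_add_graded.hyps(2) graded_add graded_zero[of \<gamma>] by auto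
  moreover have "u + u' = (\<Sum>\<gamma>\<in>insert \<delta> X. us' \<gamma>)" "w + w' = (\<Sum>\<gamma>\<in>insert \<delta> X. ws' \<gamma>)"
    using X(1) unfolding us'_def ws'_def X(3,4)
    by (simp_all add: sum.distrib sum.inter_restrict[symmetric] Int_absorb1 subset_insertI)
  ultimately show ?case using X(1) by blast
qed

text \<open>Independence of root spaces kills every component of \<open>u\<close> outside \<delta>,
  and \<open>graded_unique\<close> then kills the matching components of \<open>w\<close>.\<close>

lemma rel_graded_exists:
  assumes "rel u w" "u \<in> V \<delta>"
  shows "graded \<delta> u w"
proof -
  obtain X us ws where X: "finite X" "\<And>\<gamma>. graded \<gamma> (us \<gamma>) (ws \<gamma>)"
      "u = (\<Sum>\<gamma>\<in>X. us \<gamma>)" "w = (\<Sum>\<gamma>\<in>X. ws \<gamma>)" using rel_sum[OF assms(1)] by blast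
  let ?X = "insert \<delta> X"
  define us' where "us' \<gamma> = (if \<gamma> \<in> X then us \<gamma> else 0)" for \<gamma>
  define ws' where "ws' \<gamma> = (if \<gamma> \<in> X then ws \<gamma> else 0)" for \<gamma>
  have g: "graded \<gamma> (us' \<gamma>) (ws' \<gamma>)" for \<gamma>
    using X(2) by (simp add: us'_def ws'_def graded_zero)
  have s: "u = (\<Sum>\<gamma>\<in>?X. us' \<gamma>)" "w = (\<Sum>\<gamma>\<in>?X. ws' \<gamma>)"
    using X(1) unfolding us'_def ws'_def X(3,4)
    by (simp_all add: sum.inter_restrict[symmetric] Int_absorb1 subset_insertI)
  have "(\<Sum>\<gamma>\<in>?X. us' \<gamma> - (if \<gamma> = \<delta> then u else 0)) = 0"
    using X(1) by (simp add: sum_subtractf s(1)[symmetric] del: sum.insert)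
  then have "\<forall>\<gamma>\<in>?X. us' \<gamma> - (if \<gamma> = \<delta> then u else 0) = 0"
    using X(1) assms(2) graded_V[OF g] by (intro V_indep) (auto intro!: V_diff)
  then have us': "\<gamma> \<in> ?X \<Longrightarrow> us' \<gamma> = (if \<gamma> = \<delta> then u else 0)" for \<gamma> by auto
  have "ws' \<gamma> = (if \<gamma> = \<delta> then ws' \<delta> else 0)" if "\<gamma> \<in> ?X" for \<gamma>
    using graded_unique[of \<gamma> "ws' \<gamma>"] g[of \<gamma>] us'[OF that] by auto
  then have "w = (\<Sum>\<gamma>\<in>?X. if \<gamma> = \<delta> then ws' \<delta> else 0)"
    unfolding s(2) by (rule sum.cong[OF refl])
  then have "w = ws' \<delta>" using X(1) by simp
  moreover have "us' \<delta> = u" using us' by simp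
  ultimately show ?thesis using g[of \<delta>] by simp
qed

lemma rel_unique: "rel u w \<Longrightarrow> rel u w' \<Longrightarrow> w = w'"
proof -
  assume "rel u w" "rel u w'"
  then have "rel (u + smul (-1) u) (w' + smulW (-1) w)" by (intro rel_add rel_smul)
  then have "rel 0 (w' - w)" by simp
  then have "graded 0 0 (w' - w)" by (rule rel_graded_exists) simp
  then show "w = w'" using graded_unique by fastforce
qed

theorem ex_intertwiner:
  "\<exists>T. (\<forall>u\<in>G. \<forall>v\<in>G. T (u + v) = T u + T v) \<and> (\<forall>c. \<forall>u\<in>G. T (smul c u) = smulW c (T u))
    \<and> (\<forall>i. \<forall>u\<in>G. T (br (e i) u) = E i (T u)) \<and> (\<forall>i. \<forall>u\<in>G. T (br (f i) u) = F i (T u))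
    \<and> (\<forall>i. T (hv i) = wv i) \<and> (\<forall>\<gamma>. \<forall>u\<in>G. u \<in> V \<gamma> \<longrightarrow> T u \<in> Wt \<gamma>)"
proof -
  define T where "T u = (THE w. rel u w)" for u
  have T: "rel u w \<Longrightarrow> T u = w" for u w
    unfolding T_def using rel_unique by blast
  have R: "u \<in> G \<Longrightarrow> rel u (T u)" for u using ex_rel T by blast
  show ?thesis
  proof (intro exI[of _ T] conjI ballI allI impI)
    fix u v assume "u \<in> G" "v \<in> G"
    then show "T (u + v) = T u + T v" by (intro T rel_add R)
  next
    fix u \<gamma> assume "u \<in> G" "u \<in> V \<gamma>"
    then show "T u \<in> Wt \<gamma>" using rel_graded_exists[OF R] graded_V by blast
  qed (auto intro!: T rel_smul rel_e rel_f R rel_graded[OF graded_hv])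
qed

lemma graded_component: "u \<in> G \<Longrightarrow> u \<in> V \<delta> \<Longrightarrow> \<exists>w. graded \<delta> u w"
  using ex_rel rel_graded_exists by blast

end

section \<open>Triangular decomposition and the anti-involution\<close>

locale km_pair = kac_moody_alg A smul br H hv al e f
  for A :: "'i::finite \<Rightarrow> 'i \<Rightarrow> int"
    and smul :: "complex \<Rightarrow> 'g::ab_group_add \<Rightarrow> 'g" and br :: "'g \<Rightarrow> 'g \<Rightarrow> 'g"
    and H :: "'g set" and hv :: "'i \<Rightarrow> 'g" and al :: "'i \<Rightarrow> 'g \<Rightarrow> complex"
    and e f :: "'i \<Rightarrow> 'g"

sublocale km_pair \<subseteq> neg: kac_moody_alg A smul br H "\<lambda>i. - hv i" "\<lambda>i h. - al i h" f e
  by (rule kac_moody_swap)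

context km_pair
begin

lemma no_cosingular: "z \<in> V \<gamma> \<Longrightarrow> ht \<gamma> < 0 \<Longrightarrow> (\<And>j. br (e j) z = 0) \<Longrightarrow> z = 0"
  using neg.no_singular[of z "- \<gamma>"] by (simp add: root_space_uminus)

lemma br_f_hv: "br (f i) (hv k) = smul (of_int (A k i)) (f i)"
  using br_skew[of "f i" "hv k"] br_h_f[of "hv k" i] by simp

text \<open>For the adjoint module the intertwiner is merely the inclusion of \<open>G\<close>. What
  is wanted is the by-product: the ladders exhibit \<open>G\<close> as a sum of positive, zero and
  negative degrees.\<close>

lemma id_rep: "km_rep_pair A smul br H hv al e f smul (\<lambda>i. br (e i)) (\<lambda>i. br (f i)) V hv"
proof unfold_locales
  fix w \<gamma> i j assume w: "w \<in> V \<gamma>"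
  show "br (e i) (br (f j) w)
      = br (f j) (br (e i) w) + (if i = j then smul (of_int (pair A i \<gamma>)) w else 0)"
    using br_br[of "e i" "f j" w] V_hv[OF w, of i] by (auto simp: br_e_f)
next
  show "br (f j) (br (e i) (hv k)) = (if i = j then smul (of_int (A k i)) (hv i) else 0)" for i j k
    by (simp add: br_e_hv br_smul_right br_f_e)
qed (auto simp: V_subspace br_add_right br_smul_right br_e_V br_f_V H_V
    intro: no_singular no_cosingular)

end

sublocale km_pair \<subseteq> idr: km_rep_pair A smul br H hv al e f smul "\<lambda>i. br (e i)" "\<lambda>i. br (f i)" V hv
  by (rule id_rep)

context km_pair
begin

lemma graded_G: "idr.graded \<gamma> u w \<Longrightarrow> u \<in> G"
proof -
  have "idr.neg.ladder \<delta> u w \<Longrightarrow> u \<in> G" for \<delta>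
    by (induction rule: idr.neg.ladder.induct)
      (auto intro: G.intros G_0 subspace_neg[OF G_subspace])
  then show "idr.graded \<gamma> u w \<Longrightarrow> u \<in> G"
    unfolding idr.graded_def using idr.ladder_G by blast
qed

lemma G_V0: "u \<in> G \<Longrightarrow> u \<in> V 0 \<Longrightarrow> \<exists>c. u = (\<Sum>k\<in>UNIV. smul (c k) (hv k))"
  using idr.graded_component[of u 0] idr.neg_ladder_zero_imp idr.ladder_zero
  unfolding idr.graded_def by fastforce

lemma V_0_eq_H: "V 0 = H"
proof
  show "V 0 \<subseteq> H"
  proof
    fix x assume x: "x \<in> V 0"
    obtain u h where uh: "u \<in> G" "h \<in> H" "x = u + h" using ex_G_plus_H by blast
    then have "u \<in> V 0" using V_diff[OF x H_V[OF uh(2)]] by simp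
    then obtain c where "u = (\<Sum>k\<in>UNIV. smul (c k) (hv k))" using G_V0 uh(1) by blast
    then have "u \<in> H" by (auto intro!: H_sum H_smul)
    then show "x \<in> H" using uh subspace_add[OF H_subspace] by blast
  qed
qed (auto intro: H_V)

lemma G_span: "u \<in> G \<Longrightarrow> u \<in> span (\<Union>(range (\<lambda>\<gamma>. G \<inter> V \<gamma>)))"
proof -
  assume "u \<in> G"
  then obtain X us ws where X: "finite X" "\<And>\<gamma>. idr.graded \<gamma> (us \<gamma>) (ws \<gamma>)" "u = (\<Sum>\<gamma>\<in>X. us \<gamma>)"
    using idr.ex_rel idr.rel_sum by metis
  have "us \<gamma> \<in> G \<inter> V \<gamma>" for \<gamma> using X(2) graded_G idr.graded_V by blast
  then show ?thesis unfolding X(3) by (intro span_sum span_base) blast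
qed

text \<open>Degree 0 carries all of \<open>V 0\<close>, since \<open>H\<close> may exceed the span
  of the coroots; in the other degrees the intersection with \<open>G\<close> is what makes
  \<open>V_G\<close> follow from \<open>V_component\<close>.\<close>

lemma V_span: "x \<in> span (\<Union>(range (\<lambda>\<gamma>. if \<gamma> = 0 then V 0 else G \<inter> V \<gamma>)))"
proof -
  let ?D = "\<lambda>\<gamma>. if \<gamma> = 0 then V 0 else G \<inter> V \<gamma>"
  obtain u h where uh: "u \<in> G" "h \<in> H" "x = u + h" using ex_G_plus_H by blast
  have "span (\<Union>(range (\<lambda>\<gamma>. G \<inter> V \<gamma>))) \<subseteq> span (\<Union>(range ?D))"
  proof (intro span_mono UN_least)
    fix \<gamma> show "G \<inter> V \<gamma> \<subseteq> \<Union>(range ?D)"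
      by (rule order_trans[OF _ UN_upper[of \<gamma>]]) auto
  qed
  then have "u \<in> span (\<Union>(range ?D))" using G_span[OF uh(1)] by blast
  moreover have "h \<in> ?D 0" using uh H_V by simp
  then have "h \<in> span (\<Union>(range ?D))" by (intro span_base) blast
  ultimately show ?thesis using uh(3) span_add by blast
qed

lemma V_G: "\<gamma> \<noteq> 0 \<Longrightarrow> x \<in> V \<gamma> \<Longrightarrow> x \<in> G"
  using V_component[OF V_span, of x \<gamma>] subspace_inter[OF G_subspace V_subspace] V_subspace
  by (simp split: if_splits)

lemma V_linear_eq_0:
  assumes "\<And>x y. \<xi> (x + y) = \<xi> x + \<xi> y" "\<And>c x. \<xi> (smul c x) = c * \<xi> x"
    and "\<And>\<gamma> x. x \<in> V \<gamma> \<Longrightarrow> \<xi> x = (0::complex)"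
  shows "\<xi> x = 0"
  using V_span[of x]
proof (induction rule: span_induct_alt)
  case base
  then show ?case using assms(2)[of 0 0] by simp
next
  case (step c x y)
  then have "\<xi> x = 0" using assms(3) by (auto split: if_splits)
  then show ?case using step assms by simp
qed

lemma V_cases:
  assumes "x \<in> V \<gamma>" "\<gamma> \<noteq> 0"
  obtains w where "0 \<le> \<gamma>" "idr.ladder \<gamma> x w" | w where "\<gamma> \<le> 0" "idr.neg.ladder (- \<gamma>) x w" | "x = 0"
  using idr.graded_component[OF V_G[OF assms(2,1)] assms(1)] idr.graded_cases by metis

lemma V_sign: "x \<in> V \<gamma> \<Longrightarrow> x \<noteq> 0 \<Longrightarrow> 0 \<le> \<gamma> \<or> \<gamma> \<le> 0"
  by (cases "\<gamma> = 0"; force elim: V_cases)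

lemma V_mixed: "x \<in> V \<gamma> \<Longrightarrow> \<gamma> i < 0 \<Longrightarrow> \<gamma> j > 0 \<Longrightarrow> x = 0"
  using V_sign[of x \<gamma>] by (auto simp: le_fun_def fun_arith) (meson linorder_not_less)+

lemma V_step:
  assumes "x \<in> V \<gamma>" "0 \<le> \<gamma>" "\<gamma> \<noteq> 0"
  shows "\<exists>v. (\<forall>i. v i \<in> G \<and> v i \<in> V (\<gamma> - simple_root i)) \<and> x = (\<Sum>i\<in>UNIV. br (e i) (v i))"
  using assms(1,3)
proof (cases rule: V_cases)
  case (1 w)
  then show ?thesis using idr.ladder_step assms(3) by blast
next
  case 3
  then show ?thesis by (intro exI[of _ "\<lambda>_. 0"]) (simp add: G_0)
qed (use assms in auto)

lemma V_step_neg: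
  assumes "x \<in> V \<gamma>" "\<gamma> \<le> 0" "\<gamma> \<noteq> 0"
  shows "\<exists>v. (\<forall>i. v i \<in> V (\<gamma> + simple_root i)) \<and> x = (\<Sum>i\<in>UNIV. br (f i) (v i))"
  using assms(1,3)
proof (cases rule: V_cases)
  case (2 w)
  then obtain v where v: "\<forall>i. v i \<in> V (- (- \<gamma> - simple_root i))" "x = (\<Sum>i\<in>UNIV. br (f i) (v i))"
    using idr.neg.ladder_step[OF 2(2)] assms(3) by (auto simp: root_space_uminus)
  then show ?thesis by (intro exI[of _ v]) (simp add: algebra_simps)
next
  case 3
  then show ?thesis by (intro exI[of _ "\<lambda>_. 0"]) simp
qed (use assms in auto)

lemma V_finite_span:
  assumes "0 \<le> \<gamma>" "\<gamma> \<noteq> 0"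
  shows "\<exists>X. finite X \<and> V \<gamma> \<subseteq> span X"
proof (intro exI conjI subsetI)
  show "finite (idr.words (nat (ht \<gamma>)))" by (rule idr.finite_words)
  fix x assume "x \<in> V \<gamma>"
  then show "x \<in> span (idr.words (nat (ht \<gamma>)))"
    using assms(2) by (cases rule: V_cases) (use assms idr.ladder_words in \<open>auto intro: span_zero\<close>)
qed

text \<open>In the decomposition by \<open>V_step\<close> the weight of \<open>v j\<close> has mixed
  signs unless \<open>j = i\<close>, and \<open>v i\<close> is then a combination of
  coroots.\<close>

lemma V_simple: "x \<in> V (simple_root i) \<Longrightarrow> \<exists>c. x = smul c (e i)"
proof -
  assume "x \<in> V (simple_root i)"
  then obtain v where v: "\<And>j. v j \<in> G" "\<And>j. v j \<in> V (simple_root i - simple_root j)"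
    and x: "x = (\<Sum>j\<in>UNIV. br (e j) (v j))" using V_step by force
  have "v j = 0" if "j \<noteq> i" for j
    by (rule V_mixed[OF v(2), of j j i]) (use that in \<open>auto simp: simple_root_def fun_arith\<close>)
  then have "x = (\<Sum>j\<in>UNIV. if j = i then br (e i) (v i) else 0)"
    unfolding x by (intro sum.cong) auto
  then have x: "x = br (e i) (v i)" by simp
  obtain c where "v i = (\<Sum>k\<in>UNIV. smul (c k) (hv k))" using G_V0 v(1,2)[of i] by auto
  then have "x = smul (\<Sum>k\<in>UNIV. c k * - of_int (A k i)) (e i)"
    unfolding x by (simp add: br_sum_right br_smul_right br_e_hv scale_sum_left)
  then show ?thesis by blast
qed

text \<open>By \<open>V_step\<close> and the mixed-sign argument only the bracket with
  \<open>e i\<close> survives; at twice the simple root it is a multiple of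
  \<open>[e i, e i]\<close>, and above that induction applies.\<close>

lemma V_multiple: "x \<in> V (nmult (Suc (Suc n)) (simple_root i)) \<Longrightarrow> x = 0"
proof (induction n arbitrary: x)
  case (Suc n)
  show ?case
  proof -
    let ?\<gamma> = "nmult (Suc (Suc (Suc n))) (simple_root i)"
    have pos: "0 \<le> ?\<gamma>" "?\<gamma> \<noteq> 0"
      by (auto simp: nmult_def simple_root_def le_fun_def fun_arith fun_eq_iff)
    obtain v where v: "\<And>j. v j \<in> V (?\<gamma> - simple_root j)" and x: "x = (\<Sum>j\<in>UNIV. br (e j) (v j))"
      using V_step[OF Suc.prems pos] by auto
    have "v j = 0" for j
    proof (cases "j = i")
      case True
      then have "?\<gamma> - simple_root j = nmult (Suc (Suc n)) (simple_root i)"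
        using nmult_Suc[of "Suc (Suc n)" "simple_root i"] by simp
      then show ?thesis using Suc.IH[of "v j"] v[of j] by simp
    next
      case False
      then show ?thesis
        by (intro V_mixed[OF v, of j j i]) (auto simp: simple_root_def nmult_def fun_arith)
    qed
    then show ?thesis using x by simp
  qed
next
  case 0
  let ?\<gamma> = "nmult (Suc (Suc 0)) (simple_root i)"
  have pos: "0 \<le> ?\<gamma>" "?\<gamma> \<noteq> 0"
    by (auto simp: nmult_def simple_root_def le_fun_def fun_arith fun_eq_iff)
  obtain v where v: "\<And>j. v j \<in> V (?\<gamma> - simple_root j)" and x: "x = (\<Sum>j\<in>UNIV. br (e j) (v j))"
    using V_step[OF 0 pos] by auto
  have "br (e j) (v j) = 0" for j
  proof (cases "j = i")
    case True
    then have "?\<gamma> - simple_root j = simple_root i" by (simp add: nmult_Suc)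
    then obtain c where "v j = smul c (e i)" using V_simple[of "v j" i] v[of j] by auto
    then show ?thesis using True by (simp add: br_smul_right)
  next
    case False
    then have "v j = 0"
      by (intro V_mixed[OF v, of j j i]) (auto simp: simple_root_def nmult_def fun_arith)
    then show ?thesis by simp
  qed
  then show ?case using x by simp
qed

lemma reflect_V:
  assumes "z \<in> V \<gamma>" "z \<noteq> 0"
  shows "\<exists>z'\<in>V (refl A i \<gamma>). z' \<noteq> 0"
proof (cases "0 \<le> pair A i \<gamma>")
  case True
  then show ?thesis using reflect_down assms by blast
next
  case False
  have "refl A i (- \<gamma>) = - refl A i \<gamma>"
    by (auto simp: refl_def fun_eq_iff fun_arith sum_negf)
  then show ?thesis
    using neg.reflect_down[of z "- \<gamma>" i] assms False by (simp add: root_space_uminus)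
qed

text \<open>An antilinear anti-involution is a linear intertwiner into the algebra with conjugated
  scalars and negated weights. The action \<open>- ad (f i)\<close> of \<open>e i\<close> encodes
  \<open>[e i, u]* = [u*, f i]\<close>.\<close>

lemma star_rep: "km_rep_pair A smul br H hv al e f (\<lambda>c. smul (cnj c))
   (\<lambda>i x. - br (f i) x) (\<lambda>i x. - br (e i) x) (\<lambda>\<gamma>. V (- \<gamma>)) hv"
proof -
  interpret cs: vector_space "\<lambda>c. smul (cnj c)"
    by unfold_locales (auto simp: scale_left_distrib scale_right_distrib)
  show ?thesis
  proof unfold_locales
    fix \<gamma> show "cs.subspace (V (- \<gamma>))"
      by (rule cs.subspaceI) (auto simp: V_add V_smul)
  next
    fix w \<gamma> i j assume w: "w \<in> V (- \<gamma>)"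
    show "- br (f i) (- br (e j) w) = - br (e j) (- br (f i) w)
        + (if i = j then smul (cnj (of_int (pair A i \<gamma>))) w else 0)"
      using br_br[of "f i" "e j" w] V_hv[OF w, of i] by (auto simp: br_f_e)
    show "- br (f i) w \<in> V (- (\<gamma> + simple_root i))" "- br (e i) w \<in> V (- (\<gamma> - simple_root i))"
      using br_f_V[OF w, of i] br_e_V[OF w, of i] V_neg by (simp_all add: algebra_simps)
  next
    show "- br (e j) (- br (f i) (hv k)) = (if i = j then smul (cnj (of_int (A k i))) (hv i) else 0)"
      for i j k by (simp add: br_f_hv br_smul_right br_e_f)
  next
    fix w \<gamma> assume "w \<in> V (- \<gamma>)" "0 < ht \<gamma>" "\<And>j. - br (e j) w = 0"
    then show "w = 0" using no_cosingular[of w "- \<gamma>"] by simp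
  next
    fix w \<gamma> assume "w \<in> V (- \<gamma>)" "ht \<gamma> < 0" "\<And>j. - br (f j) w = 0"
    then show "w = 0" using no_singular[of w "- \<gamma>"] by simp
  qed (auto simp: br_add_right br_smul_right H_V)
qed

definition star :: "'g \<Rightarrow> 'g" where
  "star = (SOME T. (\<forall>u\<in>G. \<forall>v\<in>G. T (u + v) = T u + T v)
    \<and> (\<forall>c. \<forall>u\<in>G. T (smul c u) = smul (cnj c) (T u))
    \<and> (\<forall>i. \<forall>u\<in>G. T (br (e i) u) = - br (f i) (T u)) \<and> (\<forall>i. \<forall>u\<in>G. T (br (f i) u) = - br (e i) (T u))
    \<and> (\<forall>i. T (hv i) = hv i) \<and> (\<forall>\<gamma>. \<forall>u\<in>G. u \<in> V \<gamma> \<longrightarrow> T u \<in> V (- \<gamma>)))"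

lemma
  shows star_add: "u \<in> G \<Longrightarrow> v \<in> G \<Longrightarrow> star (u + v) = star u + star v"
    and star_smul: "u \<in> G \<Longrightarrow> star (smul c u) = smul (cnj c) (star u)"
    and star_br_e: "u \<in> G \<Longrightarrow> star (br (e i) u) = - br (f i) (star u)"
    and star_br_f: "u \<in> G \<Longrightarrow> star (br (f i) u) = - br (e i) (star u)"
    and star_hv [simp]: "star (hv i) = hv i"
    and star_V': "u \<in> G \<Longrightarrow> u \<in> V \<gamma> \<Longrightarrow> star u \<in> V (- \<gamma>)"
  using someI_ex[OF km_rep_pair.ex_intertwiner[OF star_rep], folded star_def] by blast+

lemma star_G: "u \<in> G \<Longrightarrow> star u \<in> G"
  by (induction rule: G.induct)
    (auto simp: star_add star_smul star_br_e star_br_f intro: G.intros subspace_neg[OF G_subspace])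

lemma star_V: "\<gamma> \<noteq> 0 \<Longrightarrow> u \<in> V \<gamma> \<Longrightarrow> star u \<in> V (- \<gamma>)"
  using star_V' V_G by blast

lemma star_0 [simp]: "star 0 = 0"
  using star_smul[OF G_0, of 0] by simp

lemma star_neg: "u \<in> G \<Longrightarrow> star (- u) = - star u"
  using star_smul[of u "-1"] by simp

lemma star_diff: "u \<in> G \<Longrightarrow> v \<in> G \<Longrightarrow> star (u - v) = star u - star v"
  using star_add[of u "- v"] star_neg[of v] subspace_neg[OF G_subspace] by simp

lemma star_sum: "(\<And>x. x \<in> X \<Longrightarrow> g x \<in> G) \<Longrightarrow> star (sum g X) = (\<Sum>x\<in>X. star (g x))"
  by (induction X rule: infinite_finite_induct) (auto simp: star_add subspace_sum[OF G_subspace])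

lemma star_e [simp]: "star (e i) = f i" and star_f [simp]: "star (f i) = e i"
proof -
  have "star (br (e i) (hv i)) = - br (f i) (hv i)" "star (br (f i) (hv i)) = - br (e i) (hv i)"
    by (simp_all add: star_br_e star_br_f G_hv)
  then show "star (e i) = f i" "star (f i) = e i"
    by (simp_all add: br_e_hv br_f_hv star_smul star_neg G_smul)
qed

lemma star_br: "z \<in> G \<Longrightarrow> u \<in> G \<Longrightarrow> star (br z u) = br (star u) (star z)"
proof (induction arbitrary: u rule: G.induct)
  case (G_hv i)
  have "br (hv i) u = br (e i) (br (f i) u) - br (f i) (br (e i) u)"
    using br_br[of "e i" "f i" u] by (simp add: br_e_f)
  then have "star (br (hv i) u) = br (f i) (br (e i) (star u)) - br (e i) (br (f i) (star u))"
    using G_hv by (simp add: star_diff star_br_e star_br_f G_e G_f)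
  also have "\<dots> = br (br (f i) (e i)) (star u)"
    using br_br[of "f i" "e i" "star u"] by simp
  also have "\<dots> = br (star u) (hv i)" using br_skew[of "star u" "hv i"] by (simp add: br_f_e)
  finally show ?case by simp
next
  case (G_e z i)
  have "br (br (e i) z) u = br (e i) (br z u) - br z (br (e i) u)"
    using br_br[of "e i" z u] by simp
  then have "star (br (br (e i) z) u) = - br (f i) (br (star u) (star z)) + br (br (f i) (star u)) (star z)"
    using G_e by (simp add: star_diff star_br_e G_ideal)
  also have "\<dots> = br (star u) (- br (f i) (star z))"
    using br_br[of "f i" "star u" "star z"] by simp
  finally show ?case using G_e by (simp add: star_br_e)
next
  case (G_f z i)
  have "br (br (f i) z) u = br (f i) (br z u) - br z (br (f i) u)"
    using br_br[of "f i" z u] by simp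
  then have "star (br (br (f i) z) u) = - br (e i) (br (star u) (star z)) + br (br (e i) (star u)) (star z)"
    using G_f by (simp add: star_diff star_br_f G_ideal)
  also have "\<dots> = br (star u) (- br (e i) (star z))"
    using br_br[of "e i" "star u" "star z"] by simp
  finally show ?case using G_f by (simp add: star_br_f)
next
  case (G_add x y)
  then show ?case by (simp add: br_add_left br_add_right star_add G_ideal)
next
  case (G_smul x c)
  then show ?case by (simp add: br_smul_left br_smul_right star_smul G_ideal)
qed

lemma star_star [simp]: "u \<in> G \<Longrightarrow> star (star u) = u"
  by (induction rule: G.induct)
    (auto simp: star_add star_smul star_br_e star_br_f star_neg star_G G_e G_f)

end

section \<open>The invariant form\<close>

context km_pair
begin

text \<open>Projection along the nonzero weight spaces; it extends functionals on \<open>H\<close>,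
  such as \<open>al k\<close>, to the whole algebra, as required for the dual module.\<close>

definition proj_H :: "'g \<Rightarrow> 'g" where
  "proj_H x = (THE h. h \<in> H \<and> x - h \<in> span (\<Union>\<gamma>\<in>-{0}. V \<gamma>))"

lemma proj_H_eqI:
  assumes "h \<in> H" "x - h \<in> span (\<Union>\<gamma>\<in>-{0}. V \<gamma>)"
  shows "proj_H x = h"
  unfolding proj_H_def
proof (rule the_equality)
  fix h' assume h': "h' \<in> H \<and> x - h' \<in> span (\<Union>\<gamma>\<in>-{0}. V \<gamma>)"
  let ?D = "\<lambda>\<gamma>. if \<gamma> = 0 then {0} else V \<gamma>"
  have "h' - h = (x - h) - (x - h')" by simp
  also have "\<dots> \<in> span (\<Union>\<gamma>\<in>-{0}. V \<gamma>)" using assms(2) h' by (intro span_diff[of "x - h" _ "x - h'"]) simp_all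
  also have "\<dots> \<subseteq> span (\<Union>(range ?D))"
  proof (intro span_mono UN_least)
    fix \<gamma> :: "'i \<Rightarrow> int" assume "\<gamma> \<in> -{0}"
    then show "V \<gamma> \<subseteq> \<Union>(range ?D)"
      by (intro order_trans[OF _ UN_upper[of \<gamma>]]) auto
  qed
  finally have "h' - h \<in> span (\<Union>(range ?D))" .
  moreover have "h' - h \<in> V 0" using h' assms(1) by (intro H_V subspace_diff[OF H_subspace]) auto
  ultimately have "h' - h \<in> ?D 0"
    using V_component[of "h' - h" ?D 0] by (auto simp: V_subspace)
  then show "h' = h" by simp
qed (use assms in auto)

lemma proj_H_spec: "proj_H x \<in> H \<and> x - proj_H x \<in> span (\<Union>\<gamma>\<in>-{0}. V \<gamma>)"
proof -
  have "\<exists>h\<in>H. x - h \<in> span (\<Union>\<gamma>\<in>-{0}. V \<gamma>)"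
    using V_span[of x]
  proof (induction rule: span_induct_alt)
    case base
    show ?case by (rule bexI[of _ 0]) (simp_all add: span_zero subspace_0[OF H_subspace])
  next
    case (step c x y)
    then obtain h where h: "h \<in> H" "y - h \<in> span (\<Union>\<gamma>\<in>-{0}. V \<gamma>)" by blast
    obtain \<gamma> where g: "x \<in> (if \<gamma> = 0 then V 0 else G \<inter> V \<gamma>)" using step by blast
    show ?case
    proof (cases "\<gamma> = 0")
      case True
      then have "smul c x + h \<in> H" using g h(1) subspace_add[OF H_subspace] by (simp add: V_0_eq_H H_smul)
      then show ?thesis using h by (intro bexI[of _ "smul c x + h"]) auto
    next
      case False
      then have "x \<in> span (\<Union>\<gamma>\<in>-{0}. V \<gamma>)" using g by (intro span_base) auto
      then have "smul c x + (y - h) \<in> span (\<Union>\<gamma>\<in>-{0}. V \<gamma>)" using h by (intro span_add span_scale)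
      then show ?thesis using h by (intro bexI[of _ h]) (auto simp: algebra_simps)
    qed
  qed
  then show ?thesis using proj_H_eqI by metis
qed

lemma proj_H_H: "h \<in> H \<Longrightarrow> proj_H h = h"
  by (rule proj_H_eqI) (auto intro: span_zero)

lemma proj_H_V: "\<gamma> \<noteq> 0 \<Longrightarrow> x \<in> V \<gamma> \<Longrightarrow> proj_H x = 0"
  using subspace_0[OF H_subspace] by (intro proj_H_eqI) (auto intro: span_base)

lemma proj_H_add: "proj_H (x + y) = proj_H x + proj_H y"
proof (rule proj_H_eqI)
  show "proj_H x + proj_H y \<in> H" using proj_H_spec subspace_add[OF H_subspace] by blast
  have "x + y - (proj_H x + proj_H y) = (x - proj_H x) + (y - proj_H y)" by simp
  then show "x + y - (proj_H x + proj_H y) \<in> span (\<Union>\<gamma>\<in>-{0}. V \<gamma>)"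
    using proj_H_spec span_add by metis
qed

lemma proj_H_smul: "proj_H (smul c x) = smul c (proj_H x)"
proof (rule proj_H_eqI)
  show "smul c (proj_H x) \<in> H" using proj_H_spec H_smul by blast
  show "smul c x - smul c (proj_H x) \<in> span (\<Union>\<gamma>\<in>-{0}. V \<gamma>)"
    using proj_H_spec span_scale by (metis scale_right_diff_distrib)
qed

end

locale km_form = km_pair A smul br H hv al e f
  for A :: "'i::finite \<Rightarrow> 'i \<Rightarrow> int"
    and smul :: "complex \<Rightarrow> 'g::ab_group_add \<Rightarrow> 'g" and br :: "'g \<Rightarrow> 'g \<Rightarrow> 'g"
    and H :: "'g set" and hv :: "'i \<Rightarrow> 'g" and al :: "'i \<Rightarrow> 'g \<Rightarrow> complex"
    and e f :: "'i \<Rightarrow> 'g" +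
  fixes d :: "'i \<Rightarrow> real"
  assumes d_pos: "d i > 0" and d_sym: "d i * of_int (A i j) = d j * of_int (A j i)"
begin

lemma d_ne0 [simp]: "d i \<noteq> 0" using d_pos[of i] by simp

lemma d_sym_complex: "of_real (d i) * of_int (A i j) = (of_real (d j) * of_int (A j i) :: complex)"
  using arg_cong[OF d_sym[of i j], of complex_of_real] by simp

lemma d_sym_divide: "of_int (A k i) / complex_of_real (d i) = of_int (A i k) / of_real (d k)"
  using d_sym_complex[of i k] by (simp add: field_simps)

text \<open>Linear functionals concentrated on the root space of weight \<open>- \<gamma>\<close>, that is, the weight \<open>\<gamma>\<close> part
  of the restricted dual of the adjoint module; \<open>u \<mapsto> B u\<close> is the intertwiner into it.\<close>

definition dual_wt :: "('i \<Rightarrow> int) \<Rightarrow> ('g \<Rightarrow> complex) set" where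
  "dual_wt \<gamma> = {\<xi>. (\<forall>x y. \<xi> (x + y) = \<xi> x + \<xi> y) \<and> (\<forall>c x. \<xi> (smul c x) = c * \<xi> x)
     \<and> (\<forall>\<delta>. \<delta> \<noteq> - \<gamma> \<longrightarrow> (\<forall>x\<in>V \<delta>. \<xi> x = 0))}"

lemma dual_wt_D:
  assumes "\<xi> \<in> dual_wt \<gamma>"
  shows "\<xi> (x + y) = \<xi> x + \<xi> y" "\<xi> (smul c x) = c * \<xi> x" "\<xi> 0 = 0" "\<xi> (- x) = - \<xi> x"
    and "x \<in> V \<delta> \<Longrightarrow> \<delta> \<noteq> - \<gamma> \<Longrightarrow> \<xi> x = 0"
proof -
  show 1: "\<xi> (x + y) = \<xi> x + \<xi> y" "\<xi> (smul c x) = c * \<xi> x" for x y c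
    using assms by (auto simp: dual_wt_def)
  show "\<xi> 0 = 0" "\<xi> (- x) = - \<xi> x" using 1(2)[of 0 0] 1(2)[of "-1" x] by simp_all
  show "x \<in> V \<delta> \<Longrightarrow> \<delta> \<noteq> - \<gamma> \<Longrightarrow> \<xi> x = 0" using assms by (auto simp: dual_wt_def)
qed

lemma dual_wt_sum: "\<xi> \<in> dual_wt \<gamma> \<Longrightarrow> \<xi> (sum g X) = (\<Sum>x\<in>X. \<xi> (g x))"
  by (induction X rule: infinite_finite_induct) (auto simp: dual_wt_D)

lemma dual_wt_br:
  assumes "\<xi> \<in> dual_wt \<gamma>" "z \<in> V \<delta>"
  shows "(\<lambda>x. - \<xi> (br z x)) \<in> dual_wt (\<gamma> + \<delta>)"
  unfolding dual_wt_def
proof (intro CollectI conjI allI impI ballI)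
  fix \<kappa> x assume "\<kappa> \<noteq> - (\<gamma> + \<delta>)" "x \<in> V \<kappa>"
  then show "- \<xi> (br z x) = 0"
    using dual_wt_D(5)[OF assms(1) V_br[OF assms(2), of x \<kappa>]]
    by (metis add.inverse_inverse add.inverse_neutral add_diff_cancel_left' diff_minus_eq_add
        minus_add_distrib)
qed (auto simp: br_add_right br_smul_right dual_wt_D[OF assms(1)])

lemma dual_wt_eqI:
  assumes "\<xi> \<in> dual_wt \<gamma>" "\<xi>' \<in> dual_wt \<gamma>" "\<And>x. x \<in> V (- \<gamma>) \<Longrightarrow> \<xi> x = \<xi>' x"
  shows "\<xi> x = \<xi>' x"
proof -
  have "\<xi> x - \<xi>' x = 0"
  proof (rule V_linear_eq_0[of "\<lambda>x. \<xi> x - \<xi>' x"])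
    fix \<delta> x assume "x \<in> V \<delta>"
    then show "\<xi> x - \<xi>' x = 0"
      using assms(3) dual_wt_D(5)[OF assms(1)] dual_wt_D(5)[OF assms(2)] by (cases "\<delta> = - \<gamma>") auto
  qed (simp_all add: dual_wt_D[OF assms(1)] dual_wt_D[OF assms(2)] algebra_simps)
  then show ?thesis by simp
qed

lemma dual_wt_scale:
  fixes a :: complex
  shows "\<xi> \<in> dual_wt \<gamma> \<Longrightarrow> (\<lambda>x. a * \<xi> x) \<in> dual_wt \<gamma>"
  by (auto simp: dual_wt_def algebra_simps)

lemma dual_wt_hv:
  assumes "\<xi> \<in> dual_wt \<gamma>"
  shows "\<xi> (br (hv i) x) = - of_int (pair A i \<gamma>) * \<xi> x"
proof (rule dual_wt_eqI[where \<gamma> = \<gamma>])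
  have "(\<lambda>x. - \<xi> (br (hv i) x)) \<in> dual_wt \<gamma>" using dual_wt_br[OF assms H_V[OF hv_H]] by simp
  from dual_wt_scale[OF this, of "-1"] show "(\<lambda>x. \<xi> (br (hv i) x)) \<in> dual_wt \<gamma>" by simp
  show "(\<lambda>x. - of_int (pair A i \<gamma>) * \<xi> x) \<in> dual_wt \<gamma>"
    using assms by (rule dual_wt_scale)
qed (simp add: V_hv dual_wt_D[OF assms])

text \<open>The functional that \<open>B (hv k)\<close> must be: in the normalisation
  \<open>(\<alpha>\<^sub>i|\<alpha>\<^sub>j) = d i * A i j\<close> the coroot corresponds to the
  simple root divided by \<open>d k\<close>.\<close>

abbreviation "wvB k \<equiv> \<lambda>x. al k (proj_H x) / of_real (d k)"

lemma wvB_dual: "wvB k \<in> dual_wt 0"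
  unfolding dual_wt_def using proj_H_spec
  by (auto simp: proj_H_add proj_H_smul al_add al_smul proj_H_V add_divide_distrib)

text \<open>This is the coadjoint action. A functional of positive height killed by all
  \<open>f j\<close> is zero because its only relevant root space is spanned by brackets with the
  \<open>f j\<close> (\<open>V_step_neg\<close>); dually in negative height.\<close>

lemma form_rep: "km_rep_pair A smul br H hv al e f (\<lambda>c \<xi> x. c * \<xi> x)
   (\<lambda>i \<xi> x. - \<xi> (br (e i) x)) (\<lambda>i \<xi> x. - \<xi> (br (f i) x)) dual_wt wvB"
proof -
  interpret fs: vector_space "\<lambda>c \<xi> x. c * (\<xi> x :: complex) :: complex"
    by unfold_locales (auto simp: fun_eq_iff fun_arith algebra_simps)
  show ?thesis
  proof unfold_locales
    fix \<gamma> show "fs.subspace (dual_wt \<gamma>)"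
      by (rule fs.subspaceI) (auto simp: dual_wt_def fun_arith algebra_simps)
  next
    fix w \<gamma> i j assume w: "w \<in> dual_wt \<gamma>"
    show Ew: "(\<lambda>x. - w (br (e i) x)) \<in> dual_wt (\<gamma> + simple_root i)" for i
      using w by (rule dual_wt_br) simp
    show Fw: "(\<lambda>x. - w (br (f i) x)) \<in> dual_wt (\<gamma> - simple_root i)" for i
      using dual_wt_br[OF w f_V] by simp
    note * = dual_wt_hv[OF w]
    show "(\<lambda>x. - (- w (br (f j) (br (e i) x))))
        = (\<lambda>x. - (- w (br (e i) (br (f j) x))))
          + (if i = j then (\<lambda>x. of_int (pair A i \<gamma>) * w x) else 0)"
      using br_br[of "f j" "e i"] *[of i] by (auto simp: fun_eq_iff fun_arith br_f_e dual_wt_D[OF w])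
  next
    fix i j k
    show "(\<lambda>x. - (- wvB k (br (e i) (br (f j) x))))
        = (if i = j then (\<lambda>x. of_int (A k i) * wvB i x) else 0)"
    proof (cases "i = j")
      case True
      have "- (- wvB k (br (e i) (br (f i) x))) = of_int (A k i) * wvB i x" for x
      proof (rule dual_wt_eqI[where \<gamma> = 0 and \<xi> = "\<lambda>x. - (- wvB k (br (e i) (br (f i) x)))"
            and \<xi>' = "\<lambda>x. of_int (A k i) * wvB i x"])
        show "(\<lambda>x. - (- wvB k (br (e i) (br (f i) x)))) \<in> dual_wt 0"
          using dual_wt_br[OF dual_wt_br[OF wvB_dual e_V] f_V, of k i i] by simp
        show "(\<lambda>x. of_int (A k i) * wvB i x) \<in> dual_wt 0"
          using wvB_dual by (rule dual_wt_scale)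
        fix x assume "x \<in> V (- 0)"
        then have x: "x \<in> H" by (simp add: V_0_eq_H)
        then have "br (e i) (br (f i) x) = smul (al i x) (hv i)"
          using br_skew[of "f i" x] by (simp add: br_h_f br_smul_right br_e_f)
        \<comment> \<open>Symmetry of the matrix \<open>d i * A i j\<close> is what reconciles the
          factors \<open>A i k / d k\<close> and \<open>A k i / d i\<close>.\<close>
        then show "- (- wvB k (br (e i) (br (f i) x))) = of_int (A k i) * wvB i x"
          using x d_sym_divide[of k i] by (simp add: proj_H_H H_smul al_smul field_simps)
      qed
      then show ?thesis using True by auto
    next
      case False
      have "- (- wvB k (br (e i) (br (f j) x))) = 0" for x
      proof (rule V_linear_eq_0[where \<xi> = "\<lambda>x. - (- wvB k (br (e i) (br (f j) x)))"])
        fix \<delta> x assume x: "x \<in> V \<delta>"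
        show "- (- wvB k (br (e i) (br (f j) x))) = 0"
        proof (cases "\<delta> = 0")
          case True
          then have "x \<in> H" using x by (simp add: V_0_eq_H)
          then have "br (e i) (br (f j) x) = 0"
            using br_skew[of "f j" x] False by (simp add: br_h_f br_smul_right br_e_f)
          then show ?thesis using proj_H_H[OF subspace_0[OF H_subspace]] by simp
        next
          case 0: False
          have y: "br (e i) (br (f j) x) \<in> V (\<delta> - simple_root j + simple_root i)"
            by (intro br_e_V br_f_V x)
          \<comment> \<open>Only from this one degree does the double bracket land in degree 0, and
            it carries no root since its coefficients have both signs.\<close>
          show ?thesis
          proof (cases "\<delta> = simple_root j - simple_root i")
            case True
            then have "x = 0"
              using False by (intro V_mixed[OF x, of i j]) (auto simp: simple_root_def fun_arith)
            then show ?thesis using proj_H_H[OF subspace_0[OF H_subspace]] by simp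
          next
            case False
            then have "\<delta> - simple_root j + simple_root i \<noteq> 0" by (auto simp: algebra_simps)
            then show ?thesis using proj_H_V[OF _ y] by simp
          qed
        qed
      qed (use dual_wt_D[OF wvB_dual[of k]] in \<open>simp_all add: br_add_right br_smul_right\<close>)
      then show ?thesis using False by (auto simp: fun_eq_iff fun_arith)
    qed
  next
    fix w \<gamma> assume w: "w \<in> dual_wt \<gamma>" "0 < ht \<gamma>" "\<And>j. (\<lambda>x. - w (br (f j) x)) = 0"
    have w0: "w (br (f j) x) = 0" for j x
      using fun_cong[OF w(3)[of j], of x] by (simp add: fun_arith)
    have "w x = 0" for x
    proof (rule V_linear_eq_0)
      fix \<delta> x assume x: "x \<in> V \<delta>"
      show "w x = 0"
      proof (cases "\<delta> = - \<gamma> \<and> x \<noteq> 0")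
        case True
        then have "\<not> 0 \<le> \<delta>" "\<delta> \<noteq> 0" using ht_nonneg[of \<delta>] w(2) by auto
        then have "\<delta> \<le> 0" using V_sign x True by blast
        then obtain v where "x = (\<Sum>i\<in>UNIV. br (f i) (v i))" using V_step_neg x \<open>\<delta> \<noteq> 0\<close> by blast
        then show ?thesis by (simp add: dual_wt_sum[OF w(1)] w0)
      qed (use dual_wt_D[OF w(1)] x in auto)
    qed (use dual_wt_D[OF w(1)] in auto)
    then show "w = 0" by (auto simp: fun_eq_iff fun_arith)
  next
    fix w \<gamma> assume w: "w \<in> dual_wt \<gamma>" "ht \<gamma> < 0" "\<And>j. (\<lambda>x. - w (br (e j) x)) = 0"
    have w0: "w (br (e j) x) = 0" for j x
      using fun_cong[OF w(3)[of j], of x] by (simp add: fun_arith)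
    have "w x = 0" for x
    proof (rule V_linear_eq_0)
      fix \<delta> x assume x: "x \<in> V \<delta>"
      show "w x = 0"
      proof (cases "\<delta> = - \<gamma> \<and> x \<noteq> 0")
        case True
        then have "\<not> \<delta> \<le> 0" "\<delta> \<noteq> 0" using ht_nonneg[of "- \<delta>"] w(2) by auto
        then have "0 \<le> \<delta>" using V_sign x True by blast
        then obtain v where "x = (\<Sum>i\<in>UNIV. br (e i) (v i))" using V_step x \<open>\<delta> \<noteq> 0\<close> by blast
        then show ?thesis by (simp add: dual_wt_sum[OF w(1)] w0)
      qed (use dual_wt_D[OF w(1)] x in auto)
    qed (use dual_wt_D[OF w(1)] in auto)
    then show "w = 0" by (auto simp: fun_eq_iff fun_arith)
  qed (auto simp: wvB_dual fun_eq_iff fun_arith)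
qed

definition B :: "'g \<Rightarrow> 'g \<Rightarrow> complex" where
  "B = (SOME T. (\<forall>u\<in>G. \<forall>v\<in>G. T (u + v) = T u + T v)
    \<and> (\<forall>c. \<forall>u\<in>G. T (smul c u) = (\<lambda>x. c * T u x))
    \<and> (\<forall>i. \<forall>u\<in>G. T (br (e i) u) = (\<lambda>x. - T u (br (e i) x)))
    \<and> (\<forall>i. \<forall>u\<in>G. T (br (f i) u) = (\<lambda>x. - T u (br (f i) x)))
    \<and> (\<forall>i. T (hv i) = wvB i) \<and> (\<forall>\<gamma>. \<forall>u\<in>G. u \<in> V \<gamma> \<longrightarrow> T u \<in> dual_wt \<gamma>))"

lemma
  shows B_add_left: "u \<in> G \<Longrightarrow> v \<in> G \<Longrightarrow> B (u + v) x = B u x + B v x"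
    and B_smul_left: "u \<in> G \<Longrightarrow> B (smul c u) x = c * B u x"
    and B_br_e: "u \<in> G \<Longrightarrow> B (br (e i) u) x = - B u (br (e i) x)"
    and B_br_f: "u \<in> G \<Longrightarrow> B (br (f i) u) x = - B u (br (f i) x)"
    and B_hv: "B (hv i) x = al i (proj_H x) / of_real (d i)"
    and B_dual: "u \<in> G \<Longrightarrow> u \<in> V \<gamma> \<Longrightarrow> B u \<in> dual_wt \<gamma>"
  using someI_ex[OF km_rep_pair.ex_intertwiner[OF form_rep], folded B_def]
  by (blast | simp add: fun_arith)+

lemma B_linear_right:
  assumes "u \<in> G"
  shows "B u (x + y) = B u x + B u y \<and> B u (smul c x) = c * B u x"
  using assms
proof (induction arbitrary: x y c rule: G.induct)
  case (G_hv i)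
  then show ?case using dual_wt_D[OF B_dual[OF G.G_hv H_V[OF hv_H]]] by auto
qed (simp_all add: B_br_e B_br_f B_add_left B_smul_left br_add_right br_smul_right algebra_simps)

lemma B_add_right: "u \<in> G \<Longrightarrow> B u (x + y) = B u x + B u y"
  and B_smul_right: "u \<in> G \<Longrightarrow> B u (smul c x) = c * B u x"
  using B_linear_right by auto

lemma B_neg_right: "u \<in> G \<Longrightarrow> B u (- x) = - B u x"
  using B_smul_right[of u "-1" x] by simp

lemma B_neg_left: "u \<in> G \<Longrightarrow> B (- u) x = - B u x"
  using B_smul_left[of u "-1" x] by simp

lemma B_diff_right: "u \<in> G \<Longrightarrow> B u (x - y) = B u x - B u y"
  using B_add_right[of u x "- y"] B_neg_right[of u y] by simp

lemma B_0_left [simp]: "B 0 x = 0"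
  using B_smul_left[OF G_0, of 0 x] by simp

lemma B_0_right [simp]: "u \<in> G \<Longrightarrow> B u 0 = 0"
  using B_smul_right[of u 0 0] by simp

lemma B_orth: "u \<in> G \<Longrightarrow> u \<in> V \<gamma> \<Longrightarrow> v \<in> V \<delta> \<Longrightarrow> \<delta> \<noteq> - \<gamma> \<Longrightarrow> B u v = 0"
  using dual_wt_D(5) B_dual by blast

lemma B_hv_hv: "B (hv i) (hv j) = of_int (A j i) / of_real (d i)"
  by (simp add: B_hv proj_H_H)

lemma B_invariant: "z \<in> G \<Longrightarrow> u \<in> G \<Longrightarrow> B (br z u) x = - B u (br z x)"
proof (induction arbitrary: u x rule: G.induct)
  case (G_hv i)
  have "br (hv i) y = br (e i) (br (f i) y) - br (f i) (br (e i) y)" for y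
    using br_br[of "e i" "f i" y] by (simp add: br_e_f)
  then show ?case
    using G_hv B_add_left[of "br (e i) (br (f i) u)" "- br (f i) (br (e i) u)" x]
    by (simp add: B_neg_left B_br_e B_br_f G_e G_f B_diff_right subspace_neg[OF G_subspace])
next
  case (G_e z i)
  have "br (br (e i) z) y = br (e i) (br z y) - br z (br (e i) y)" for y
    using br_br[of "e i" z y] by simp
  then show ?case
    using G_e B_add_left[of "br (e i) (br z u)" "- br z (br (e i) u)" x]
    by (simp add: B_neg_left B_br_e G.G_e G_ideal B_diff_right subspace_neg[OF G_subspace])
next
  case (G_f z i)
  have "br (br (f i) z) y = br (f i) (br z y) - br z (br (f i) y)" for y
    using br_br[of "f i" z y] by simp
  then show ?case
    using G_f B_add_left[of "br (f i) (br z u)" "- br z (br (f i) u)" x]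
    by (simp add: B_neg_left B_br_f G.G_f G_ideal B_diff_right subspace_neg[OF G_subspace])
next
  case (G_add z z')
  then show ?case by (simp add: br_add_left B_add_left B_add_right G_ideal)
next
  case (G_smul z c)
  then show ?case by (simp add: br_smul_left B_smul_left B_smul_right G_ideal)
qed

text \<open>Homogeneity is asked for only at zeros of \<xi>, so that antilinear expressions, as in
  \<open>B_star_star\<close>, are covered as well.\<close>

lemma G_linear_eq_0:
  assumes "\<And>x y. x \<in> G \<Longrightarrow> y \<in> G \<Longrightarrow> \<xi> (x + y) = \<xi> x + \<xi> y" "\<And>c x. x \<in> G \<Longrightarrow> \<xi> x = 0 \<Longrightarrow> \<xi> (smul c x) = 0"
    and "\<And>\<gamma> x. x \<in> G \<Longrightarrow> \<gamma> \<noteq> 0 \<Longrightarrow> x \<in> V \<gamma> \<Longrightarrow> \<xi> x = (0::complex)" "\<And>k. \<xi> (hv k) = 0"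
    and "u \<in> G"
  shows "\<xi> u = 0"
proof -
  have H: "\<xi> (\<Sum>k\<in>X. smul (c k) (hv k)) = 0" if "finite X" for c X
    using that
  proof (induction X rule: finite_induct)
    case empty
    show ?case using assms(2)[OF G_hv assms(4), of 0] by simp
  next
    case (insert k X)
    have "smul (c k) (hv k) \<in> G" "(\<Sum>k\<in>X. smul (c k) (hv k)) \<in> G"
      by (auto intro!: subspace_sum[OF G_subspace] G.intros)
    then show ?case using insert assms(1,2,4) by (simp add: G_hv)
  qed
  have "u \<in> G \<and> \<xi> u = 0"
    using G_span[OF assms(5)]
  proof (induction rule: span_induct_alt)
    case base
    then show ?case using H[of "{}"] G_0 by simp
  next
    case (step c x y)
    then obtain \<gamma> where x: "x \<in> G" "x \<in> V \<gamma>" by auto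
    have "\<xi> x = 0"
    proof (cases "\<gamma> = 0")
      case True
      then show ?thesis using G_V0 x H[of UNIV] by force
    qed (use assms(3) x in auto)
    then show ?case using step x assms(1,2) by (simp add: G_smul G_add)
  qed
  then show ?thesis by simp
qed

lemma B_sym: "u \<in> G \<Longrightarrow> v \<in> G \<Longrightarrow> B u v = B v u"
proof (induction arbitrary: v rule: G.induct)
  case (G_hv i)
  have "B (hv i) v - B v (hv i) = 0"
  proof (rule G_linear_eq_0[where \<xi> = "\<lambda>v. B (hv i) v - B v (hv i)"])
    show "B (hv i) (hv k) - B (hv k) (hv i) = 0" for k
      using d_sym_divide[of k i] by (simp add: B_hv_hv)
    show "B (hv i) x - B x (hv i) = 0" if "x \<in> G" "\<gamma> \<noteq> 0" "x \<in> V \<gamma>" for x \<gamma>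
      using B_orth[OF that(1,3) H_V[OF hv_H, of i]] B_orth[OF G.G_hv H_V[OF hv_H] that(3)] that by simp
  qed (auto simp: G_hv B_add_left B_add_right B_smul_left B_smul_right G.G_hv right_diff_distrib[symmetric])
  then show ?case by simp
next
  case (G_e u i)
  have "B (br (e i) u) v = - B (br (e i) v) u" using G_e by (simp add: B_br_e G.G_e)
  also have "\<dots> = B v (br (e i) u)" using G_e by (simp add: B_br_e)
  finally show ?case .
next
  case (G_f u i)
  have "B (br (f i) u) v = - B (br (f i) v) u" using G_f by (simp add: B_br_f G.G_f)
  also have "\<dots> = B v (br (f i) u)" using G_f by (simp add: B_br_f)
  finally show ?case .
qed (simp_all add: B_add_left B_add_right B_smul_left B_smul_right)

lemma B_star_star: "u \<in> G \<Longrightarrow> v \<in> G \<Longrightarrow> B (star u) (star v) = cnj (B u v)"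
proof (induction arbitrary: v rule: G.induct)
  case (G_hv i)
  have "B (hv i) (star v) - cnj (B (hv i) v) = 0"
  proof (rule G_linear_eq_0[where \<xi> = "\<lambda>v. B (hv i) (star v) - cnj (B (hv i) v)"])
    show "B (hv i) (star (hv k)) - cnj (B (hv i) (hv k)) = 0" for k
      by (simp add: B_hv_hv)
    show "B (hv i) (star x) - cnj (B (hv i) x) = 0" if "x \<in> G" "\<gamma> \<noteq> 0" "x \<in> V \<gamma>" for x \<gamma>
      using B_orth[OF G.G_hv H_V[OF hv_H] star_V'[OF that(1,3)], of i]
        B_orth[OF G.G_hv H_V[OF hv_H] that(3), of i] that by simp
  qed (auto simp: G_hv star_add star_smul B_add_right B_smul_right G.G_hv right_diff_distrib[symmetric])
  then show ?case by simp
next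
  case (G_e u i)
  then have "B (star (br (e i) u)) (star v) = - B (star u) (star (br (e i) v))"
    by (simp add: star_br_e B_neg_left B_neg_right B_br_f star_G G.G_f)
  then show ?case using G_e by (simp add: B_br_e G.G_e)
next
  case (G_f u i)
  then have "B (star (br (f i) u)) (star v) = - B (star u) (star (br (f i) v))"
    by (simp add: star_br_f B_neg_left B_neg_right B_br_e star_G G.G_e)
  then show ?case using G_f by (simp add: B_br_f G.G_f)
qed (simp_all add: star_add star_smul star_G B_add_left B_smul_left)

section \<open>The contravariant Hermitian form and the form on the root lattice\<close>

definition S :: "'g \<Rightarrow> 'g \<Rightarrow> complex" where
  "S u v = B u (star v)"

lemma S_add_left: "u \<in> G \<Longrightarrow> u' \<in> G \<Longrightarrow> S (u + u') v = S u v + S u' v"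
  by (simp add: S_def B_add_left)

lemma S_smul_left: "u \<in> G \<Longrightarrow> S (smul c u) v = c * S u v"
  by (simp add: S_def B_smul_left)

lemma S_sym: "u \<in> G \<Longrightarrow> v \<in> G \<Longrightarrow> S v u = cnj (S u v)"
  using B_star_star[of u "star v"] B_sym[of "star u" v] by (simp add: S_def star_G)

lemma S_add_right: "u \<in> G \<Longrightarrow> v \<in> G \<Longrightarrow> v' \<in> G \<Longrightarrow> S u (v + v') = S u v + S u v'"
  by (simp add: S_def B_add_right star_add)

lemma S_smul_right: "u \<in> G \<Longrightarrow> v \<in> G \<Longrightarrow> S u (smul c v) = cnj c * S u v"
  by (simp add: S_def B_smul_right star_smul)

lemma S_0_left [simp]: "S 0 v = 0" by (simp add: S_def)

lemma S_0_right [simp]: "u \<in> G \<Longrightarrow> S u 0 = 0" by (simp add: S_def)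

lemma S_sum_left: "(\<And>x. x \<in> X \<Longrightarrow> g x \<in> G) \<Longrightarrow> S (sum g X) v = (\<Sum>x\<in>X. S (g x) v)"
  by (induction X rule: infinite_finite_induct) (auto simp: S_add_left subspace_sum[OF G_subspace])

lemma S_br: "z \<in> G \<Longrightarrow> u \<in> G \<Longrightarrow> v \<in> G \<Longrightarrow> S (br z u) v = S u (br (star z) v)"
  by (simp add: S_def B_invariant star_br star_G B_neg_right[symmetric] br_skew[of "star v" z])

lemma S_star_star: "u \<in> G \<Longrightarrow> v \<in> G \<Longrightarrow> S (star u) (star v) = S v u"
  by (simp add: S_def B_sym star_G)

lemma S_Im: "u \<in> G \<Longrightarrow> Im (S u u) = 0"
  using S_sym[of u u] by (metis Im_complex_of_real Reals_cnj_iff Reals_cases)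

text \<open>\<open>cov \<gamma>\<close> is \<open>\<nu>\<^sup>-\<^sup>1(\<gamma>)\<close>, and \<open>ip\<close> is the induced form on the root lattice, normalised by
  \<open>(\<alpha>\<^sub>i|\<alpha>\<^sub>j) = d i * A i j\<close>.\<close>

definition cov :: "('i \<Rightarrow> int) \<Rightarrow> 'g" where
  "cov \<gamma> = (\<Sum>i\<in>UNIV. smul (of_int (\<gamma> i) * of_real (d i)) (hv i))"

definition ip :: "('i \<Rightarrow> int) \<Rightarrow> ('i \<Rightarrow> int) \<Rightarrow> real" where
  "ip \<gamma> \<delta> = (\<Sum>i\<in>UNIV. d i * of_int (\<gamma> i) * of_int (pair A i \<delta>))"

lemma cov_G: "cov \<gamma> \<in> G" and cov_H: "cov \<gamma> \<in> H"
  unfolding cov_def by (auto intro!: subspace_sum[OF G_subspace] H_sum H_smul G.intros)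

lemma br_cov: "x \<in> V \<delta> \<Longrightarrow> br (cov \<gamma>) x = smul (of_real (ip \<gamma> \<delta>)) x"
  by (simp add: cov_def ip_def br_sum_left br_smul_left V_hv scale_sum_left of_real_sum mult_ac)

lemma B_cov: "h \<in> H \<Longrightarrow> B (cov \<gamma>) h = wt al \<gamma> h"
proof -
  assume h: "h \<in> H"
  have "B (sum g X) h = (\<Sum>x\<in>X. B (g x) h)" if "\<And>x. g x \<in> G" for g :: "'i \<Rightarrow> 'g" and X
    by (induction X rule: infinite_finite_induct) (auto simp: that B_add_left subspace_sum[OF G_subspace])
  then have "B (cov \<gamma>) h = (\<Sum>i\<in>UNIV. B (smul (of_int (\<gamma> i) * of_real (d i)) (hv i)) h)"
    unfolding cov_def by (simp add: G.intros)
  then show ?thesis using h by (simp add: B_smul_left G_hv B_hv proj_H_H wt_def)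
qed

text \<open>By invariance the difference of the two sides is a combination of coroots that pairs to
  zero with \<open>H\<close>. It is tested against all of \<open>H\<close>, since the form may be
  degenerate on coroots; independence of the simple roots then applies.\<close>

lemma br_eq_B_cov:
  assumes u: "u \<in> V \<gamma>" and v: "v \<in> V (- \<gamma>)" and \<gamma>: "\<gamma> \<noteq> 0"
  shows "br u v = smul (B u v) (cov \<gamma>)"
proof -
  have G: "u \<in> G" "v \<in> G" using V_G u v \<gamma> by (metis neg_equal_0_iff_equal)+
  let ?x = "br u v - smul (B u v) (cov \<gamma>)"
  have xG: "?x \<in> G" by (intro subspace_diff[OF G_subspace] G_ideal G_smul cov_G G)
  have "br u v \<in> V 0" using V_br[OF u v] by simp
  then have "?x \<in> V 0" by (intro V_diff V_smul H_V[OF cov_H])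
  then obtain c where c: "?x = (\<Sum>k\<in>UNIV. smul (c k) (hv k))" using G_V0 xG by blast
  have "(\<Sum>k\<in>UNIV. (c k / of_real (d k)) * al k h) = 0" if h: "h \<in> H" for h
  proof -
    have "B ?x h = B (br u v) h + B (- smul (B u v) (cov \<gamma>)) h"
      using B_add_left[of "br u v" "- smul (B u v) (cov \<gamma>)" h] G
      by (simp add: G_ideal G_smul cov_G subspace_neg[OF G_subspace])
    also have "\<dots> = B (br u v) h - B u v * wt al \<gamma> h"
      by (simp add: B_neg_left G_smul cov_G B_smul_left B_cov h)
    also have "B (br u v) h = B v (br h u)"
      using B_invariant[OF G, of h] B_neg_right[OF G(2), of "br h u"] br_skew[of u h] by simp
    also have "\<dots> = B u v * wt al \<gamma> h"
      using V_D[OF u h] B_sym[OF G] by (simp add: B_smul_right G)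
    finally have 0: "B ?x h = 0" by simp
    have "B (sum g X) h = (\<Sum>x\<in>X. B (g x) h)" if "\<And>x. g x \<in> G" for g :: "'i \<Rightarrow> 'g" and X
      by (induction X rule: infinite_finite_induct) (auto simp: that B_add_left subspace_sum[OF G_subspace])
    then have "B ?x h = (\<Sum>k\<in>UNIV. B (smul (c k) (hv k)) h)"
      unfolding c by (simp add: G.intros)
    then show ?thesis using 0 h by (simp add: B_smul_left G_hv B_hv proj_H_H)
  qed
  then have "c k / of_real (d k) = 0" for k by (rule al_indep)
  then have "?x = 0" unfolding c by (simp add: divide_eq_0_iff)
  then show ?thesis by simp
qed

lemma S_e_e: "S (e i) (e i) = 1 / of_real (d i)"
proof -
  have "B (br (e i) (hv i)) (f i) = - B (hv i) (hv i)" by (simp add: B_br_e G_hv br_e_f)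
  then show ?thesis by (simp add: S_def br_e_hv B_neg_left G_smul B_smul_left B_hv_hv nonzero_eq_divide_eq mult.commute)
qed

section \<open>Positivity\<close>

lemma ip_simps [simp]:
  "ip 0 \<delta> = 0" "ip (\<gamma> + \<gamma>') \<delta> = ip \<gamma> \<delta> + ip \<gamma>' \<delta>" "ip (\<gamma> - \<gamma>') \<delta> = ip \<gamma> \<delta> - ip \<gamma>' \<delta>"
  "ip (- \<gamma>) \<delta> = - ip \<gamma> \<delta>"
  "ip \<gamma> 0 = 0" "ip \<gamma> (\<delta> + \<delta>') = ip \<gamma> \<delta> + ip \<gamma> \<delta>'" "ip \<gamma> (\<delta> - \<delta>') = ip \<gamma> \<delta> - ip \<gamma> \<delta>'"
  "ip \<gamma> (- \<delta>) = - ip \<gamma> \<delta>"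
  by (simp_all add: ip_def fun_arith algebra_simps sum.distrib sum_subtractf sum_negf)

lemma ip_sym: "ip \<gamma> \<delta> = ip \<delta> \<gamma>"
proof -
  have "ip \<gamma> \<delta> = (\<Sum>i\<in>UNIV. \<Sum>j\<in>UNIV. of_int (\<gamma> i) * of_int (\<delta> j) * (d i * of_int (A i j)))"
    by (simp add: ip_def pair_def sum_distrib_left mult_ac)
  also have "\<dots> = (\<Sum>j\<in>UNIV. \<Sum>i\<in>UNIV. of_int (\<gamma> i) * of_int (\<delta> j) * (d j * of_int (A j i)))"
    unfolding d_sym[of _ "_ :: 'i"] by (subst sum.swap) (simp add: d_sym)
  also have "\<dots> = ip \<delta> \<gamma>"
    by (simp add: ip_def pair_def sum_distrib_left mult_ac)
  finally show ?thesis .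
qed

lemma ip_simple: "ip (simple_root i) \<delta> = d i * of_int (pair A i \<delta>)"
proof -
  have "ip (simple_root i) \<delta> = (\<Sum>k\<in>UNIV. if k = i then d k * of_int (pair A k \<delta>) else 0)"
    unfolding ip_def by (rule sum.cong) (auto simp: simple_root_def)
  then show ?thesis by simp
qed

lemma refl_eq: "refl A i \<gamma> = (\<lambda>k. \<gamma> k - pair A i \<gamma> * simple_root i k)"
  by (auto simp: refl_def pair_def simple_root_def fun_eq_iff)

lemma pair_refl: "pair A j (refl A i \<gamma>) = pair A j \<gamma> - pair A i \<gamma> * A j i"
proof -
  have "pair A j (refl A i \<gamma>) = pair A j \<gamma> - pair A i \<gamma> * pair A j (simple_root i)"
    by (simp only: refl_eq pair_def) (simp add: algebra_simps sum_subtractf sum_distrib_left)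
  then show ?thesis by simp
qed

lemma refl_refl [simp]: "refl A i (refl A i \<gamma>) = \<gamma>"
  by (simp add: refl_eq[of i "refl A i \<gamma>"] pair_refl) (simp add: refl_eq fun_eq_iff algebra_simps)

lemma ip_refl_left: "ip (refl A i \<gamma>) \<delta> = ip \<gamma> \<delta> - d i * of_int (pair A i \<gamma>) * of_int (pair A i \<delta>)"
proof -
  have "ip (refl A i \<gamma>) \<delta> = ip \<gamma> \<delta> - of_int (pair A i \<gamma>) * ip (simple_root i) \<delta>"
    by (simp only: refl_eq ip_def) (simp add: algebra_simps sum_subtractf sum_distrib_left)
  then show ?thesis by (simp add: ip_simple)
qed

lemma ip_refl: "ip (refl A i \<gamma>) (refl A i \<delta>) = ip \<gamma> \<delta>"
proof -
  have "ip \<gamma> (refl A i \<delta>) = ip \<gamma> \<delta> - d i * of_int (pair A i \<gamma>) * of_int (pair A i \<delta>)"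
    using ip_refl_left[of i \<delta> \<gamma>] by (simp add: ip_sym[of \<gamma>])
  then show ?thesis by (simp add: ip_refl_left pair_refl algebra_simps)
qed

text \<open>\<open>N \<gamma> = 2(\<rho>|\<gamma>) - (\<gamma>|\<gamma>)\<close>, where \<open>2(\<rho>|\<alpha>\<^sub>i) = (\<alpha>\<^sub>i|\<alpha>\<^sub>i) = 2 d i\<close>.\<close>

definition N :: "('i \<Rightarrow> int) \<Rightarrow> real" where
  "N \<gamma> = 2 * (\<Sum>i\<in>UNIV. d i * of_int (\<gamma> i)) - ip \<gamma> \<gamma>"

lemma sum_d_simple: "(\<Sum>k\<in>UNIV. d k * of_int (simple_root i k)) = d i"
proof -
  have "(\<Sum>k\<in>UNIV. d k * of_int (simple_root i k)) = (\<Sum>k\<in>UNIV. if k = i then d k else 0)"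
    by (rule sum.cong) (auto simp: simple_root_def)
  then show ?thesis by simp
qed

lemma N_simple: "N (simple_root i) = 0"
  by (simp add: N_def sum_d_simple ip_simple)

lemma N_add_simple: "N (\<gamma> + simple_root i) = N \<gamma> - 2 * ip (simple_root i) \<gamma>"
  by (simp add: N_def fun_arith algebra_simps sum.distrib sum_d_simple ip_sym[of \<gamma> "simple_root i"])
    (simp add: ip_simple)

lemma N_refl: "N \<gamma> = N (refl A i \<gamma>) + 2 * d i * of_int (pair A i \<gamma>)"
proof -
  have "(\<Sum>k\<in>UNIV. d k * of_int (refl A i \<gamma> k))
      = (\<Sum>k\<in>UNIV. d k * of_int (\<gamma> k)) - of_int (pair A i \<gamma>) * (\<Sum>k\<in>UNIV. d k * of_int (simple_root i k))"
    unfolding refl_eq by (simp add: algebra_simps sum_subtractf sum_distrib_left)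
  then show ?thesis by (simp add: N_def ip_refl sum_d_simple algebra_simps)
qed

text \<open>Some coefficient of \<gamma> off \<open>i\<close> is positive, else \<gamma> would be a
  multiple of the simple root, against \<open>V_multiple\<close>. The reflection leaves that
  coefficient alone, and one positive coefficient decides the sign of a root.\<close>

lemma positive_root_refl:
  assumes z: "z \<in> V \<gamma>" "z \<noteq> 0" and pos: "0 \<le> \<gamma>" "\<gamma> \<noteq> 0" and ns: "\<gamma> \<noteq> simple_root i"
  shows "0 \<le> refl A i \<gamma>" "refl A i \<gamma> \<noteq> 0" "\<exists>z'\<in>V (refl A i \<gamma>). z' \<noteq> 0"
proof -
  obtain z' where z': "z' \<in> V (refl A i \<gamma>)" "z' \<noteq> 0" using reflect_V z by blast
  then show "\<exists>z'\<in>V (refl A i \<gamma>). z' \<noteq> 0" by blast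
  have "\<exists>k. k \<noteq> i \<and> \<gamma> k > 0"
  proof (rule ccontr)
    assume *: "\<not> ?thesis"
    then have k0: "\<gamma> k = 0" if "k \<noteq> i" for k
      using that pos(1) by (auto simp: le_fun_def fun_arith) (meson order_antisym_conv leI)
    have gi: "\<gamma> = nmult (nat (\<gamma> i)) (simple_root i)"
      using k0 pos(1) by (auto simp: nmult_def simple_root_def fun_eq_iff le_fun_def fun_arith)
    have "nat (\<gamma> i) \<noteq> 0" using gi pos(2) nmult_0 by metis
    moreover have "nat (\<gamma> i) \<noteq> 1" using gi ns nmult_Suc[of 0 "simple_root i"] by (metis One_nat_def add.right_neutral nmult_0)
    ultimately obtain n where "nat (\<gamma> i) = Suc (Suc n)"
      by (metis One_nat_def not0_implies_Suc)
    then have "z = 0" using V_multiple[of z n i] gi z(1) by simp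
    then show False using z by simp
  qed
  then obtain k where k: "k \<noteq> i" "\<gamma> k > 0" by blast
  then have r: "refl A i \<gamma> k > 0" by (simp add: refl_def)
  then show "refl A i \<gamma> \<noteq> 0" by (auto simp: fun_arith)
  have "\<not> refl A i \<gamma> \<le> 0" using r by (auto simp: le_fun_def fun_arith not_le)
  then show "0 \<le> refl A i \<gamma>" using V_sign z' by blast
qed

lemma ht_refl: "ht (refl A i \<gamma>) = ht \<gamma> - pair A i \<gamma>"
proof -
  have "ht (refl A i \<gamma>) = ht \<gamma> - pair A i \<gamma> * ht (simple_root i)"
    by (simp only: refl_eq ht_def sum_subtractf sum_distrib_left)
  then show ?thesis by simp
qed

lemma antidominant_ip_le_0:
  assumes "\<And>i. pair A i \<beta> \<le> 0" "0 \<le> \<gamma>"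
  shows "ip \<gamma> \<beta> \<le> 0"
  unfolding ip_def
proof (rule sum_nonpos)
  fix i
  have "0 \<le> d i * of_int (\<gamma> i)" using d_pos[of i] assms(2) by (auto simp: le_fun_def fun_arith)
  then show "d i * of_int (\<gamma> i) * of_int (pair A i \<beta>) \<le> 0"
    using assms(1)[of i] by (simp add: mult_nonneg_nonpos)
qed

text \<open>A positive pairing allows a reflection that lowers the height and strictly lowers
  \<open>N\<close>, to a value still nonnegative (0 at a simple root). If no pairing is positive,
  \<open>(\<gamma>|\<gamma>) \<le> 0\<close> while the \<rho>-term is positive.\<close>

lemma N_pos:
  "z \<in> V \<gamma> \<Longrightarrow> z \<noteq> 0 \<Longrightarrow> 0 \<le> \<gamma> \<Longrightarrow> \<gamma> \<noteq> 0 \<Longrightarrow> \<forall>i. \<gamma> \<noteq> simple_root i \<Longrightarrow> N \<gamma> > 0"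
proof (induction "nat (ht \<gamma>)" arbitrary: z \<gamma> rule: less_induct)
  case less
  show ?case
  proof (cases "\<exists>i. pair A i \<gamma> > 0")
    case True
    then obtain i where i: "pair A i \<gamma> > 0" by blast
    have ns: "\<gamma> \<noteq> simple_root i" using less.prems by blast
    note r = positive_root_refl[OF less.prems(1-4) ns]
    obtain z' where z': "z' \<in> V (refl A i \<gamma>)" "z' \<noteq> 0" using r(3) by blast
    have "nat (ht (refl A i \<gamma>)) < nat (ht \<gamma>)"
      using i ht_refl[of i \<gamma>] ht_pos[OF r(1,2)] by simp
    then have "N (refl A i \<gamma>) \<ge> 0"
      using less.hyps[OF _ z' r(1,2)] N_simple
      by (cases "\<forall>j. refl A i \<gamma> \<noteq> simple_root j") (blast intro: less_imp_le, metis order_refl)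
    moreover have "2 * d i * of_int (pair A i \<gamma>) > 0" using i d_pos[of i] by simp
    ultimately show ?thesis using N_refl[of \<gamma> i] by linarith
  next
    case False
    then have "ip \<gamma> \<gamma> \<le> 0" using less.prems(3) by (intro antidominant_ip_le_0) (auto simp: not_less)
    moreover obtain k where "\<gamma> k \<noteq> 0" using less.prems(4) by (auto simp: fun_eq_iff fun_arith)
    then have "\<gamma> k > 0" using less.prems(3) by (simp add: le_fun_def fun_arith order.not_eq_order_implies_strict)
    then have "0 < (\<Sum>i\<in>UNIV. d i * of_int (\<gamma> i))"
      using less.prems(3) d_pos by (intro sum_pos2[where i = k])
        (auto simp: le_fun_def fun_arith less_imp_le)
    ultimately show ?thesis by (simp add: N_def)
  qed
qed

section \<open>Orthonormal bases of root spaces\<close>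

definition reproducing :: "('i \<Rightarrow> int) \<Rightarrow> 'g set \<Rightarrow> bool" where
  "reproducing \<gamma> b \<longleftrightarrow> finite b \<and> b \<subseteq> V \<gamma> \<and> (\<forall>z\<in>V \<gamma>. z = (\<Sum>v\<in>b. smul (S z v) v))"

text \<open>Zero remainders are dropped, so \<open>X\<close> may be dependent. Of the result
  \<open>reproducing\<close> keeps only the expansion formula, which is how the dual bases
  \<open>v\<close>, \<open>star v\<close> enter the Casimir sum.\<close>

lemma gram_schmidt:
  assumes pos: "\<And>z. z \<in> V \<gamma> \<Longrightarrow> z \<noteq> 0 \<Longrightarrow> 0 < Re (S z z)" and \<gamma>: "\<gamma> \<noteq> 0"
  shows "finite X \<Longrightarrow> X \<subseteq> V \<gamma> \<Longrightarrow> \<exists>b. finite b \<and> b \<subseteq> V \<gamma>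
    \<and> (\<forall>u\<in>b. \<forall>v\<in>b. S u v = (if u = v then 1 else 0)) \<and> (\<forall>t\<in>X. t = (\<Sum>v\<in>b. smul (S t v) v))"
proof (induction X rule: finite_induct)
  case empty
  show ?case by (rule exI[of _ "{}"]) simp
next
  case (insert t X)
  have XV: "X \<subseteq> V \<gamma>" using insert.prems by simp
  obtain b where b0: "finite b \<and> b \<subseteq> V \<gamma> \<and> (\<forall>u\<in>b. \<forall>v\<in>b. S u v = (if u = v then 1 else 0))
      \<and> (\<forall>t\<in>X. t = (\<Sum>v\<in>b. smul (S t v) v))" using insert.IH[OF XV] ..
  have b: "finite b" "b \<subseteq> V \<gamma>"
      "\<And>u v. u \<in> b \<Longrightarrow> v \<in> b \<Longrightarrow> S u v = (if u = v then 1 else 0)"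
    using b0 by blast+
  note b4 = b0[THEN conjunct2, THEN conjunct2, THEN conjunct2, THEN bspec]
  have G: "u \<in> V \<gamma> \<Longrightarrow> u \<in> G" for u using V_G \<gamma> by blast
  have bG: "v \<in> b \<Longrightarrow> v \<in> G" for v using b(2) G by blast
  let ?p = "\<Sum>v\<in>b. smul (S t v) v"
  define r where "r = t - ?p"
  have t: "t \<in> V \<gamma>" "t = r + ?p" using insert.prems by (auto simp: r_def)
  have p: "?p \<in> V \<gamma>" using b(2) by (intro V_sum V_smul) auto
  have r: "r \<in> V \<gamma>" unfolding r_def using t(1) p by (rule V_diff)
  have Sp: "S ?p w = (\<Sum>v\<in>b. S t v * S v w)" for w
    using bG by (subst S_sum_left) (auto simp: S_smul_left G_smul)
  have St: "S t w = S r w + S ?p w" for w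
    using S_add_left[of r ?p w] G r p t(2) by simp
  have rv: "S r v = 0" if "v \<in> b" for v
  proof -
    have "S ?p v = (\<Sum>u\<in>b. if u = v then S t u else 0)"
      unfolding Sp by (rule sum.cong) (auto simp: b(3) that)
    also have "\<dots> = S t v" using b(1) that by simp
    finally show ?thesis using St[of v] by simp
  qed
  show ?case
  proof (cases "r = 0")
    case True
    then have "t = ?p" using t(2) by (metis add_0_left)
    then have "\<forall>x\<in>insert t X. x = (\<Sum>v\<in>b. smul (S x v) v)" using b4 by blast
    then show ?thesis by (intro exI[of _ b] conjI) (use b0 in blast)+
  next
    case False
    define c where "c = 1 / sqrt (Re (S r r))"
    define n where "n = smul (of_real c) r"
    have rr: "0 < Re (S r r)" using pos r False by blast
    have Srr: "S r r = of_real (Re (S r r))" using S_Im[OF G[OF r]] by (simp add: complex_eq_iff)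
    have cc: "of_real c * of_real c * S r r = 1"
      using rr by (subst Srr) (simp add: c_def power2_eq_square[symmetric] power_divide
        del: of_real_mult of_real_divide flip: of_real_mult of_real_power)
    have nV: "n \<in> V \<gamma>" unfolding n_def using r by (rule V_smul)
    have nn: "S n n = 1" using cc G[OF r] by (simp add: n_def S_smul_left S_smul_right G_smul mult_ac)
    have nv: "S n v = 0" "S v n = 0" if "v \<in> b" for v
      using rv[OF that] S_sym[OF G[OF r] bG[OF that]] G[OF r] bG[OF that]
      by (simp_all add: n_def S_smul_left S_smul_right)
    have nb: "n \<notin> b" using nv nn by force
    have pn: "S (\<Sum>v\<in>b. smul (a v) v) n = 0" for a
      using bG nv by (subst S_sum_left) (auto simp: S_smul_left G_smul)
    let ?b = "insert n b"
    have "x = (\<Sum>v\<in>?b. smul (S x v) v)" if "x \<in> insert t X" for x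
    proof (cases "x = t")
      case True
      have "S t n = of_real c * S r r" using St[of n] pn G[OF r] by (simp add: n_def S_smul_right)
      then have "smul (S t n) n = smul (of_real c * of_real c * S r r) r" by (simp add: n_def mult_ac)
      then have "smul (S t n) n = r" using cc by simp
      then show ?thesis using True t(2) b(1) nb by simp
    next
      case False
      then have x: "x = (\<Sum>v\<in>b. smul (S x v) v)" using b4 that by blast
      then have "S x n = 0" using pn by metis
      then show ?thesis using x b(1) nb by simp
    qed
    moreover have "\<forall>u\<in>?b. \<forall>v\<in>?b. S u v = (if u = v then 1 else 0)"
      using b(3) nv nn nb by auto
    ultimately show ?thesis using b(1,2) nV by (intro exI[of _ ?b]) auto
  qed
qed

lemma reproducing_exists:
  assumes pos: "\<And>z. z \<in> V \<gamma> \<Longrightarrow> z \<noteq> 0 \<Longrightarrow> 0 < Re (S z z)" and \<gamma>: "0 \<le> \<gamma>" "\<gamma> \<noteq> 0"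
  shows "\<exists>b. reproducing \<gamma> b"
proof -
  obtain Y where Y: "finite Y" "V \<gamma> \<subseteq> span Y" using V_finite_span[OF \<gamma>] by blast
  obtain X where X: "X \<subseteq> V \<gamma>" "independent X" "V \<gamma> \<subseteq> span X" using basis_exists[of "V \<gamma>"] by metis
  have "finite X" using independent_span_bound[OF Y(1) X(2)] X(1) Y(2) by auto
  then obtain b where b: "finite b" "b \<subseteq> V \<gamma>" "\<And>t. t \<in> X \<Longrightarrow> t = (\<Sum>v\<in>b. smul (S t v) v)"
    using gram_schmidt[OF pos \<gamma>(2) _ X(1)] by metis
  have "z \<in> V \<gamma> \<and> z = (\<Sum>v\<in>b. smul (S z v) v)" if "z \<in> span X" for z
    using that
  proof (induction rule: span_induct_alt)
    case base
    then show ?case by simp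
  next
    case (step c x y)
    have x: "x \<in> V \<gamma>" "x = (\<Sum>v\<in>b. smul (S x v) v)" using step X(1) b(3) by auto
    have y: "y \<in> V \<gamma>" "y = (\<Sum>v\<in>b. smul (S y v) v)" using step by auto
    have "(\<Sum>v\<in>b. smul (S (smul c x + y) v) v) = smul c (\<Sum>v\<in>b. smul (S x v) v) + (\<Sum>v\<in>b. smul (S y v) v)"
      using V_G[OF \<gamma>(2)] x(1) y(1)
      by (simp add: S_add_left S_smul_left G_smul scale_left_distrib sum.distrib scale_sum_right)
    then show ?case using x y by (simp add: V_add V_smul)
  qed
  then show ?thesis unfolding reproducing_def using b X(3) by blast
qed

text \<open>Invariance of the canonical tensor \<open>\<Sum> v \<otimes> v\<^sup>*\<close> under \<open>f j\<close>.\<close>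

lemma casimir_tensor:
  assumes b: "reproducing \<beta> b" and b': "reproducing (\<beta> + simple_root j) b'"
    and \<beta>: "\<beta> \<noteq> 0" "\<beta> + simple_root j \<noteq> 0"
  shows "(\<Sum>v\<in>b'. br (br (f j) v) (br (star v) x)) = - (\<Sum>w\<in>b. br w (br (br (f j) (star w)) x))"
proof -
  have bV: "w \<in> b \<Longrightarrow> w \<in> V \<beta>" and b'V: "v \<in> b' \<Longrightarrow> v \<in> V (\<beta> + simple_root j)" for v w
    using b b' by (auto simp: reproducing_def)
  have bG: "w \<in> b \<Longrightarrow> w \<in> G" and b'G: "v \<in> b' \<Longrightarrow> v \<in> G" for v w
    using V_G \<beta> bV b'V by blast+
  have 1: "br (f j) v = (\<Sum>w\<in>b. smul (S (br (f j) v) w) w)" if "v \<in> b'" for v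
    using b br_f_V[OF b'V[OF that], of j] by (simp add: reproducing_def)
  \<comment> \<open>The matrix of \<open>ad (f j)\<close> from \<open>b'\<close> to \<open>b\<close>
    is the adjoint of that of \<open>ad (e j)\<close>; applying \<open>star\<close> to the expansion
    of \<open>[e j, w]\<close> therefore reuses the coefficients of fact 1.\<close>
  have 2: "br (f j) (star w) = - (\<Sum>v\<in>b'. smul (S (br (f j) v) w) (star v))" if w: "w \<in> b" for w
  proof -
    have e: "br (e j) w = (\<Sum>v\<in>b'. smul (S (br (e j) w) v) v)"
      using b' br_e_V[OF bV[OF w], of j] by (simp add: reproducing_def)
    have "cnj (S (br (e j) w) v) = S (br (f j) v) w" if v: "v \<in> b'" for v
      using S_br[OF e_G bG[OF w] b'G[OF v], of j] S_sym[OF G_ideal[OF b'G[OF v]] bG[OF w], of "f j"] by simp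
    then have "star (br (e j) w) = (\<Sum>v\<in>b'. smul (S (br (f j) v) w) (star v))"
      using b'G by (subst e, subst star_sum) (auto simp: G_smul star_smul)
    then show ?thesis using star_br_e[OF bG[OF w], of j] by (metis add.inverse_inverse)
  qed
  have "(\<Sum>v\<in>b'. br (br (f j) v) (br (star v) x))
      = (\<Sum>v\<in>b'. \<Sum>w\<in>b. smul (S (br (f j) v) w) (br w (br (star v) x)))"
    by (rule sum.cong) (simp_all only: br_sum_left[symmetric] br_smul_left[symmetric] flip: 1)
  also have "\<dots> = (\<Sum>w\<in>b. \<Sum>v\<in>b'. smul (S (br (f j) v) w) (br w (br (star v) x)))"
    by (rule sum.swap)
  also have "\<dots> = (\<Sum>w\<in>b. - br w (br (br (f j) (star w)) x))"
    by (rule sum.cong) (simp_all add: 2 br_sum_left br_sum_right br_smul_left br_smul_right)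
  finally show ?thesis by (simp add: sum_negf)
qed

end

section \<open>The index set of the Casimir sum\<close>

lemma finite_between: "finite {\<beta>::'i::finite \<Rightarrow> int. 0 \<le> \<beta> \<and> \<beta> \<le> \<alpha>}"
proof (rule finite_subset)
  show "{\<beta>. 0 \<le> \<beta> \<and> \<beta> \<le> \<alpha>}
      \<subseteq> {\<beta>::'i \<Rightarrow> int. \<forall>i. (i \<in> UNIV \<longrightarrow> \<beta> i \<in> (\<Union>i. {0..\<alpha> i})) \<and> (i \<notin> UNIV \<longrightarrow> \<beta> i = 0)}"
    by (auto simp: le_fun_def fun_arith)
  show "finite {\<beta>::'i \<Rightarrow> int. \<forall>i. (i \<in> UNIV \<longrightarrow> \<beta> i \<in> (\<Union>i. {0..\<alpha> i})) \<and> (i \<notin> UNIV \<longrightarrow> \<beta> i = 0)}"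
    by (rule finite_set_of_finite_funs) auto
qed

definition below :: "('i::finite \<Rightarrow> int) \<Rightarrow> ('i \<Rightarrow> int) set" where
  "below \<alpha> = {\<beta>. 0 \<le> \<beta> \<and> \<beta> \<le> \<alpha> \<and> \<beta> \<noteq> 0 \<and> \<beta> \<noteq> \<alpha>}"

lemma finite_below: "finite (below \<alpha>)"
  by (rule finite_subset[OF _ finite_between[of \<alpha>]]) (auto simp: below_def)

lemma below_diff: "\<beta> \<in> below \<alpha> \<Longrightarrow> 0 \<le> \<alpha> - \<beta> \<and> \<alpha> - \<beta> \<noteq> 0"
  by (auto simp: below_def)

lemma below_ht: "\<beta> \<in> below \<alpha> \<Longrightarrow> 0 < ht \<beta> \<and> ht \<beta> < ht \<alpha>"
  using ht_pos[of \<beta>] ht_pos[of "\<alpha> - \<beta>"] below_diff[of \<beta> \<alpha>] by (auto simp: below_def)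

lemma nonneg_nonzero_coord: "0 \<le> \<gamma> \<Longrightarrow> \<gamma> \<noteq> 0 \<Longrightarrow> \<exists>i. (\<gamma>::'i \<Rightarrow> int) i > 0"
proof (rule ccontr)
  assume *: "0 \<le> \<gamma>" "\<gamma> \<noteq> 0" "\<not> (\<exists>i. \<gamma> i > 0)"
  have "\<gamma> i = 0" for i
    using spec[OF *(1)[unfolded le_fun_def], of i] *(3) by (simp add: fun_arith not_less) (meson order_antisym)
  then show False using *(2) by (auto simp: fun_eq_iff fun_arith)
qed

lemma ht_1_simple:
  assumes "0 \<le> \<gamma>" "ht \<gamma> = 1"
  shows "\<exists>i. \<gamma> = simple_root i"
proof -
  have "\<gamma> \<noteq> 0" using assms(2) by auto
  then obtain i where i: "\<gamma> i > 0" using nonneg_nonzero_coord assms(1) by blast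
  have "0 \<le> \<gamma> - simple_root i"
    using assms(1) i by (auto simp: le_fun_def fun_arith simple_root_def)
  then have "\<gamma> - simple_root i = 0" using ht_pos[of "\<gamma> - simple_root i"] assms(2) by auto
  then show ?thesis by auto
qed

text \<open>The index shift behind the telescoping: when the coefficient at \<open>j\<close> is
  zero, \<open>f j\<close> kills the root space of \<beta>, so these are the weights that contribute
  to the terms with \<open>[f j, v]\<close>. The simple root is a boundary term.\<close>

lemma below_decompose:
  assumes "0 \<le> \<alpha> - simple_root j" "\<alpha> - simple_root j \<noteq> 0"
  shows "{\<beta>\<in>below \<alpha>. \<beta> j \<noteq> 0}
    = insert (simple_root j) ((\<lambda>\<beta>. \<beta> + simple_root j) ` below (\<alpha> - simple_root j))"
proof (intro equalityI subsetI)
  fix \<beta> assume b: "\<beta> \<in> {\<beta>\<in>below \<alpha>. \<beta> j \<noteq> 0}"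
  then have b': "0 \<le> \<beta>" "\<beta> \<le> \<alpha>" "\<beta> \<noteq> \<alpha>" "\<beta> j \<noteq> 0" by (auto simp: below_def)
  then have "0 \<le> \<beta> - simple_root j"
    using spec[OF b'(1)[unfolded le_fun_def], of j]
    by (auto simp: le_fun_def fun_arith simple_root_def int_one_le_iff_zero_less less_le)
  then have "\<beta> - simple_root j \<in> below (\<alpha> - simple_root j)" if "\<beta> \<noteq> simple_root j"
    using b' that by (auto simp: below_def)
  then show "\<beta> \<in> insert (simple_root j) ((\<lambda>\<beta>. \<beta> + simple_root j) ` below (\<alpha> - simple_root j))"
    by (cases "\<beta> = simple_root j") (auto intro: image_eqI[of _ _ "\<beta> - simple_root j"])
next
  fix \<beta> assume "\<beta> \<in> insert (simple_root j) ((\<lambda>\<beta>. \<beta> + simple_root j) ` below (\<alpha> - simple_root j))"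
  then consider "\<beta> = simple_root j" | \<beta>' where "\<beta> = \<beta>' + simple_root j" "\<beta>' \<in> below (\<alpha> - simple_root j)"
    by auto
  then show "\<beta> \<in> {\<beta>\<in>below \<alpha>. \<beta> j \<noteq> 0}"
  proof cases
    case 1
    moreover have "simple_root j j = (1::int)" by (simp add: simple_root_def)
    ultimately show ?thesis using assms by (auto simp: below_def)
  next
    case 2
    then have b: "0 \<le> \<beta>'" "\<beta>' \<le> \<alpha> - simple_root j" "\<beta>' \<noteq> \<alpha> - simple_root j" by (auto simp: below_def)
    have j: "\<beta> j > 0"
      using spec[OF b(1)[unfolded le_fun_def], of j] 2(1) by (simp add: fun_arith simple_root_def)
    have "0 \<le> \<beta>" using b(1) 2(1) by (simp add: add_nonneg_nonneg)
    moreover have "\<beta> \<le> \<alpha>" using b(2) 2(1) by (simp add: le_diff_eq)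
    moreover have "\<beta> \<noteq> \<alpha>" using b(3) 2(1) by auto
    moreover have "\<beta> \<noteq> 0" using j by (auto simp: fun_arith)
    ultimately show ?thesis using j by (simp add: below_def)
  qed
qed

text \<open>The companion for the other two groups of terms; here the boundary is the top
  weight.\<close>

lemma below_le:
  assumes "0 \<le> \<alpha> - simple_root j" "\<alpha> - simple_root j \<noteq> 0"
  shows "{\<beta>\<in>below \<alpha>. \<beta> \<le> \<alpha> - simple_root j} = insert (\<alpha> - simple_root j) (below (\<alpha> - simple_root j))"
proof -
  have *: "\<alpha> - simple_root j \<le> \<alpha>" "\<alpha> - simple_root j \<noteq> \<alpha>" by simp_all
  then have "\<beta> \<noteq> \<alpha> \<and> \<beta> \<le> \<alpha>" if "\<beta> \<le> \<alpha> - simple_root j" for \<beta>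
    using that by (metis order_antisym order_trans)
  then show ?thesis using assms by (auto simp: below_def)
qed

context km_form
begin

definition casimir :: "(('i \<Rightarrow> int) \<Rightarrow> 'g set) \<Rightarrow> ('i \<Rightarrow> int) \<Rightarrow> 'g \<Rightarrow> 'g" where
  "casimir b \<alpha> x = (\<Sum>\<beta>\<in>below \<alpha>. \<Sum>v\<in>b \<beta>. br v (br (star v) x))"

lemma V_neg_coord:
  assumes "0 \<le> \<gamma>" "\<gamma> \<noteq> 0" "\<gamma> j = 0" "x \<in> V (\<gamma> - simple_root j)"
  shows "x = 0"
proof -
  obtain i where i: "\<gamma> i > 0" using nonneg_nonzero_coord assms by blast
  then have "i \<noteq> j" using assms(3) by auto
  then show ?thesis
    using i assms(3) by (intro V_mixed[OF assms(4), of j i]) (auto simp: fun_arith simple_root_def)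
qed

lemma below_facts:
  assumes "\<beta> \<in> below \<alpha>" "ht \<alpha> \<le> n"
  shows "0 \<le> \<beta>" "\<beta> \<noteq> 0" "ht \<beta> < n"
  using assms below_ht[of \<beta> \<alpha>] by (auto simp: below_def)

text \<open>Bases are assumed only below height \<open>n\<close>, because inside the induction for
  positivity definiteness is known only there.\<close>

context
  fixes b :: "('i \<Rightarrow> int) \<Rightarrow> 'g set" and n :: int
  assumes b: "\<And>\<beta>. 0 \<le> \<beta> \<Longrightarrow> \<beta> \<noteq> 0 \<Longrightarrow> ht \<beta> < n \<Longrightarrow> reproducing \<beta> (b \<beta>)"
begin

lemma reproducing_facts:
  assumes "0 \<le> \<beta>" "\<beta> \<noteq> 0" "ht \<beta> < n"
  shows "v \<in> b \<beta> \<Longrightarrow> v \<in> V \<beta>" "v \<in> b \<beta> \<Longrightarrow> v \<in> G" "v \<in> b \<beta> \<Longrightarrow> star v \<in> V (- \<beta>)"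
    "z \<in> V \<beta> \<Longrightarrow> (\<Sum>v\<in>b \<beta>. smul (S z v) v) = z"
proof -
  have r: "b \<beta> \<subseteq> V \<beta>" "\<forall>z\<in>V \<beta>. z = (\<Sum>v\<in>b \<beta>. smul (S z v) v)"
    using b[OF assms] by (auto simp only: reproducing_def)
  show 1: "v \<in> b \<beta> \<Longrightarrow> v \<in> V \<beta>" using r(1) by blast
  then show "v \<in> b \<beta> \<Longrightarrow> v \<in> G" using V_G[OF assms(2)] by blast
  show "v \<in> b \<beta> \<Longrightarrow> star v \<in> V (- \<beta>)" using star_V[OF assms(2)] 1 by blast
  show "z \<in> V \<beta> \<Longrightarrow> (\<Sum>v\<in>b \<beta>. smul (S z v) v) = z" using bspec[OF r(2), of z] by (rule sym)
qed

lemma casimir_V: "ht \<alpha> \<le> n \<Longrightarrow> x \<in> V \<alpha> \<Longrightarrow> casimir b \<alpha> x \<in> V \<alpha>"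
  unfolding casimir_def
proof (intro V_sum)
  fix \<beta> v assume *: "ht \<alpha> \<le> n" "x \<in> V \<alpha>" "\<beta> \<in> below \<alpha>" "v \<in> b \<beta>"
  note f = reproducing_facts[OF below_facts[OF *(3,1)]]
  show "br v (br (star v) x) \<in> V \<alpha>"
    using V_br[OF f(1)[OF *(4)] V_br[OF f(3)[OF *(4)] *(2)]] by simp
qed

text \<open>Each \<open>[f j, v]\<close> is a multiple of \<open>cov (simple_root j)\<close>, and
  summing the coefficients against \<open>star v\<close> reassembles
  \<open>star (e j) = f j\<close>.\<close>

lemma boundary_simple:
  assumes z: "z = br (f j) x" "z \<in> V \<gamma>" and n: "1 < n"
  shows "(\<Sum>v\<in>b (simple_root j). br (br (f j) v) (br (star v) x)) = smul (- of_real (ip (simple_root j) \<gamma>)) z"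
proof -
  let ?b = "b (simple_root j)" and ?c = "cov (simple_root j)"
  have s: "0 \<le> simple_root j" "simple_root j \<noteq> 0" "ht (simple_root j) < n" using n by simp_all
  note f = reproducing_facts[OF s]
  have "br (f j) v = smul (- S v (e j)) ?c" if "v \<in> ?b" for v
    using br_eq_B_cov[OF f(1)[OF that] f_V] br_skew[of "f j" v] by (simp add: S_def)
  then have "(\<Sum>v\<in>?b. br (br (f j) v) (br (star v) x))
      = (\<Sum>v\<in>?b. br (smul (- S v (e j)) ?c) (br (star v) x))"
    by (intro sum.cong) simp_all
  also have "\<dots> = - br ?c (br (\<Sum>v\<in>?b. smul (S v (e j)) (star v)) x)"
    by (simp add: br_sum_left br_sum_right br_smul_left br_smul_right sum_negf)
  also have "(\<Sum>v\<in>?b. smul (S v (e j)) (star v)) = (\<Sum>v\<in>?b. star (smul (S (e j) v) v))"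
    using S_sym[OF e_G f(2)] f(2) by (intro sum.cong refl) (simp add: star_smul)
  also have "\<dots> = star (\<Sum>v\<in>?b. smul (S (e j) v) v)"
    by (rule star_sum[symmetric]) (use f(2) G_smul in blast)
  also have "\<dots> = f j" using f(4)[OF e_V] by simp
  also have "br ?c (br (f j) x) = smul (of_real (ip (simple_root j) \<gamma>)) z"
    using br_cov z by simp
  finally show ?thesis by simp
qed

text \<open>The inner brackets have weight 0, hence equal \<open>S z w\<close> times
  \<open>cov \<alpha>\<close> and \<open>- S z w\<close> times \<open>cov \<gamma>\<close>; the
  expansion of \<open>z\<close> in \<open>b \<gamma>\<close> then sums them up.\<close>

lemma boundary_top:
  assumes z: "z = br (f j) x" "x \<in> V \<alpha>" and \<alpha>: "\<alpha> \<noteq> 0"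
    and \<gamma>: "\<gamma> = \<alpha> - simple_root j" "0 \<le> \<gamma>" "\<gamma> \<noteq> 0" "ht \<gamma> < n"
  shows "(\<Sum>w\<in>b \<gamma>. br w (br (br (f j) (star w)) x)) = smul (- of_real (ip \<alpha> \<gamma>)) z"
    and "(\<Sum>w\<in>b \<gamma>. br w (br (star w) z)) = smul (of_real (ip \<gamma> \<gamma>)) z"
proof -
  note f = reproducing_facts[OF \<gamma>(2-4)]
  have zV: "z \<in> V \<gamma>" using br_f_V[OF z(2)] z(1) \<gamma>(1) by simp
  have G: "x \<in> G" "z \<in> G" using V_G z(2) zV \<alpha> \<gamma> by blast+
  have "br w (br (br (f j) (star w)) x) = smul (- of_real (ip \<alpha> \<gamma>)) (smul (S z w) w)" if w: "w \<in> b \<gamma>" for w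
  proof -
    have "br (f j) (star w) \<in> V (- \<alpha>)" using br_f_V[OF f(3)[OF w], of j] \<gamma>(1) by simp
    then have "br x (br (f j) (star w)) = smul (B x (br (f j) (star w))) (cov \<alpha>)"
      using br_eq_B_cov z(2) \<alpha> by blast
    also have "B x (br (f j) (star w)) = - S z w" using B_br_f[OF G(1)] z(1) by (simp add: S_def)
    finally have "br (br (f j) (star w)) x = smul (S z w) (cov \<alpha>)"
      using br_skew[of "br (f j) (star w)" x] by simp
    then show ?thesis
      using br_skew[of w "cov \<alpha>"] br_cov[OF f(1)[OF w], of \<alpha>] by (simp add: br_smul_right mult_ac)
  qed
  then have "(\<Sum>w\<in>b \<gamma>. br w (br (br (f j) (star w)) x)) = (\<Sum>w\<in>b \<gamma>. smul (- of_real (ip \<alpha> \<gamma>)) (smul (S z w) w))"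
    by (intro sum.cong) simp_all
  then show "(\<Sum>w\<in>b \<gamma>. br w (br (br (f j) (star w)) x)) = smul (- of_real (ip \<alpha> \<gamma>)) z"
    by (simp only: scale_sum_right[symmetric] f(4)[OF zV])
  have "br w (br (star w) z) = smul (of_real (ip \<gamma> \<gamma>)) (smul (S z w) w)" if w: "w \<in> b \<gamma>" for w
  proof -
    have "br (star w) z = - smul (S z w) (cov \<gamma>)"
      using br_eq_B_cov[OF zV f(3)[OF w] \<gamma>(3)] br_skew[of "star w" z] by (simp add: S_def)
    then show ?thesis
      using br_skew[of w "cov \<gamma>"] br_cov[OF f(1)[OF w], of \<gamma>] by (simp add: br_smul_right mult_ac)
  qed
  then have "(\<Sum>w\<in>b \<gamma>. br w (br (star w) z)) = (\<Sum>w\<in>b \<gamma>. smul (of_real (ip \<gamma> \<gamma>)) (smul (S z w) w))"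
    by (intro sum.cong) simp_all
  then show "(\<Sum>w\<in>b \<gamma>. br w (br (star w) z)) = smul (of_real (ip \<gamma> \<gamma>)) z"
    by (simp only: scale_sum_right[symmetric] f(4)[OF zV])
qed

text \<open>By \<open>no_singular\<close> it suffices to compare the two sides after applying each \<open>f j\<close>. By
  \<open>casimir_tensor\<close> the sums telescope, leaving the Casimir sum of weight \<open>\<alpha> - \<alpha>\<^sub>j\<close> and the boundary
  terms at \<open>\<alpha>\<^sub>j\<close> and \<open>\<alpha> - \<alpha>\<^sub>j\<close>.\<close>

lemma casimir_eq:
  "0 \<le> \<alpha> \<Longrightarrow> \<alpha> \<noteq> 0 \<Longrightarrow> ht \<alpha> \<le> n \<Longrightarrow> x \<in> V \<alpha> \<Longrightarrow> casimir b \<alpha> x = smul (of_real (N \<alpha>)) x"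
proof (induction "nat (ht \<alpha>)" arbitrary: \<alpha> x rule: less_induct)
  case less
  note pos = less.prems(1,2) and n = less.prems(3) and x = less.prems(4)
  show ?case
  proof (cases "ht \<alpha> = 1")
    case True
    then obtain i where i: "\<alpha> = simple_root i" using ht_1_simple pos(1) by blast
    have "below \<alpha> = {}" using below_ht[of _ \<alpha>] True by fastforce
    then show ?thesis using i N_simple by (simp add: casimir_def)
  next
    case False
    then have ht2: "ht \<alpha> \<ge> 2" using ht_pos[OF pos] by simp
    let ?D = "casimir b \<alpha> x - smul (of_real (N \<alpha>)) x"
    have "?D = 0"
    proof (rule no_singular)
      show "?D \<in> V \<alpha>" using casimir_V[OF n x] V_smul[OF x] by (rule V_diff)
      show "0 < ht \<alpha>" using ht2 by simp
      fix j
      define \<gamma> where "\<gamma> = \<alpha> - simple_root j"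
      define z where "z = br (f j) x"
      have zV: "z \<in> V \<gamma>" using br_f_V[OF x] by (simp add: z_def \<gamma>_def)
      have ht\<gamma>: "ht \<gamma> = ht \<alpha> - 1" by (simp add: \<gamma>_def)
      have \<gamma>0: "\<gamma> \<noteq> 0" using ht\<gamma> ht2 by auto
      define a where "a \<beta> = (\<Sum>v\<in>b \<beta>. br (br (f j) v) (br (star v) x))" for \<beta>
      define c where "c \<beta> = (\<Sum>v\<in>b \<beta>. br v (br (br (f j) (star v)) x))" for \<beta>
      define g where "g \<beta> = (\<Sum>v\<in>b \<beta>. br v (br (star v) z))" for \<beta>
      have "br (f j) (br v (br (star v) x))
          = br (br (f j) v) (br (star v) x) + br v (br (br (f j) (star v)) x) + br v (br (star v) z)" for v
        using br_br[of "f j" v "br (star v) x"] br_br[of "f j" "star v" x]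
        by (simp add: z_def br_add_right)
      then have fT: "br (f j) (casimir b \<alpha> x) = sum a (below \<alpha>) + sum c (below \<alpha>) + sum g (below \<alpha>)"
        unfolding casimir_def a_def c_def g_def by (simp add: br_sum_right sum.distrib)
      have a0: "a \<beta> = 0" if "\<beta> \<in> below \<alpha>" "\<beta> j = 0" for \<beta>
      proof -
        note f = reproducing_facts[OF below_facts[OF that(1) n]]
        have "br (f j) v = 0" if "v \<in> b \<beta>" for v
          using V_neg_coord[OF _ _ \<open>\<beta> j = 0\<close> br_f_V[OF f(1)[OF that]]] below_facts[OF \<open>\<beta> \<in> below \<alpha>\<close> n] by blast
        then show ?thesis unfolding a_def by (intro sum.neutral) simp
      qed
      have cg0: "c \<beta> = 0" "g \<beta> = 0" if b: "\<beta> \<in> below \<alpha>" "\<not> \<beta> \<le> \<gamma>" for \<beta>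
      proof -
        note f = reproducing_facts[OF below_facts[OF b(1) n]]
        have le: "0 \<le> \<alpha> - \<beta>" "\<alpha> - \<beta> \<noteq> 0" using below_diff[OF b(1)] by auto
        obtain i where "\<beta> i > \<gamma> i" using b(2) by (auto simp: le_fun_def not_le)
        moreover have "\<beta> i \<le> \<alpha> i" using b(1) by (auto simp: below_def le_fun_def)
        \<comment> \<open>Subtracting the simple root changes only coordinate \<open>j\<close>, so
          failure of the bound there means that \<beta> and \<alpha> agree at
          \<open>j\<close>.\<close>
        ultimately have j0: "(\<alpha> - \<beta>) j = 0"
          by (auto simp: \<gamma>_def simple_root_def fun_arith split: if_splits)
        have V0: "y = 0" if "y \<in> V (\<alpha> - \<beta> - simple_root j)" for y
          using V_neg_coord[OF le j0 that] .
        have "br (br (f j) (star v)) x \<in> V (- \<beta> - simple_root j + \<alpha>)"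
             "br (star v) z \<in> V (- \<beta> + \<gamma>)" if "v \<in> b \<beta>" for v
          using V_br[OF br_f_V[OF f(3)[OF that]] x] V_br[OF f(3)[OF that] zV] by auto
        moreover have "- \<beta> - simple_root j + \<alpha> = \<alpha> - \<beta> - simple_root j"
            "- \<beta> + \<gamma> = \<alpha> - \<beta> - simple_root j"
          by (simp_all add: \<gamma>_def algebra_simps)
        ultimately have "br (br (f j) (star v)) x = 0 \<and> br (star v) z = 0" if "v \<in> b \<beta>" for v
          using that V0 by metis
        then show "c \<beta> = 0" "g \<beta> = 0"
          unfolding c_def g_def by (auto intro!: sum.neutral)
      qed
      have "sum a (below \<alpha>) + sum c (below \<alpha>) + sum g (below \<alpha>) = smul (of_real (N \<alpha>)) z"
      proof (cases "0 \<le> \<gamma>")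
        case True
        note dec = below_decompose[of \<alpha> j, folded \<gamma>_def, OF True \<gamma>0]
          and le = below_le[of \<alpha> j, folded \<gamma>_def, OF True \<gamma>0]
        have ns: "simple_root j \<notin> (\<lambda>\<beta>. \<beta> + simple_root j) ` below \<gamma>"
          by (auto simp: below_def)
        have "sum a (below \<alpha>) = sum a {\<beta>\<in>below \<alpha>. \<beta> j \<noteq> 0}"
          using a0 by (intro sum.mono_neutral_right) (auto simp: finite_below)
        also have "\<dots> = a (simple_root j) + sum a ((\<lambda>\<beta>. \<beta> + simple_root j) ` below \<gamma>)"
          unfolding dec using ns by (simp add: finite_below)
        also have "sum a ((\<lambda>\<beta>. \<beta> + simple_root j) ` below \<gamma>) = (\<Sum>\<beta>\<in>below \<gamma>. a (\<beta> + simple_root j))"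
          by (subst sum.reindex) (auto simp: inj_on_def)
        also have "\<dots> = (\<Sum>\<beta>\<in>below \<gamma>. - c \<beta>)"
        proof (rule sum.cong[OF refl])
          fix \<beta> assume \<beta>: "\<beta> \<in> below \<gamma>"
          have "\<beta> + simple_root j \<in> below \<alpha>" using dec \<beta> by blast
          note 1 = below_facts[OF this n]
          have 2: "0 \<le> \<beta>" "\<beta> \<noteq> 0" "ht \<beta> < n" using \<beta> 1(3) by (auto simp: below_def)
          show "a (\<beta> + simple_root j) = - c \<beta>"
            unfolding a_def c_def by (rule casimir_tensor[OF b[OF 2] b[OF 1] 2(2) 1(2)])
        qed
        also have "a (simple_root j) = smul (- of_real (ip (simple_root j) \<gamma>)) z"
          unfolding a_def using z_def zV ht2 n by (intro boundary_simple) auto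
        finally have sa: "sum a (below \<alpha>) = smul (- of_real (ip (simple_root j) \<gamma>)) z - sum c (below \<gamma>)"
          by (simp add: sum_negf)
        have n\<gamma>: "ht \<gamma> < n" using ht\<gamma> n by simp
        note top = boundary_top[OF z_def x pos(2) \<gamma>_def True \<gamma>0 n\<gamma>]
        have \<gamma>nb: "\<gamma> \<notin> below \<gamma>" by (simp add: below_def)
        have "sum c (below \<alpha>) = sum c {\<beta>\<in>below \<alpha>. \<beta> \<le> \<gamma>}"
          using cg0 by (intro sum.mono_neutral_right) (auto simp: finite_below)
        then have sc: "sum c (below \<alpha>) = smul (- of_real (ip \<alpha> \<gamma>)) z + sum c (below \<gamma>)"
          unfolding le using \<gamma>nb top(1) by (simp add: finite_below c_def)
        have "sum g (below \<alpha>) = sum g {\<beta>\<in>below \<alpha>. \<beta> \<le> \<gamma>}"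
          using cg0 by (intro sum.mono_neutral_right) (auto simp: finite_below)
        also have "\<dots> = smul (of_real (ip \<gamma> \<gamma>)) z + casimir b \<gamma> z"
          unfolding le using \<gamma>nb top(2) by (simp add: finite_below g_def casimir_def)
        also have "casimir b \<gamma> z = smul (of_real (N \<gamma>)) z"
          using ht\<gamma> ht2 n by (intro less.hyps True \<gamma>0 zV) auto
        finally have sg: "sum g (below \<alpha>) = smul (of_real (ip \<gamma> \<gamma>)) z + smul (of_real (N \<gamma>)) z" .
        \<comment> \<open>Expanding \<open>(\<alpha>|\<gamma>)\<close> shows that the three boundary
          coefficients add up to \<open>- 2 (\<alpha>\<^sub>j|\<gamma>)\<close>, exactly the
          increment in \<open>N_add_simple\<close>.\<close>
        have "N \<alpha> = - ip (simple_root j) \<gamma> - ip \<alpha> \<gamma> + ip \<gamma> \<gamma> + N \<gamma>"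
          using N_add_simple[of \<gamma> j] by (simp add: \<gamma>_def)
        then have "complex_of_real (N \<alpha>) = - of_real (ip (simple_root j) \<gamma>) + (- of_real (ip \<alpha> \<gamma>) + (of_real (ip \<gamma> \<gamma>) + of_real (N \<gamma>))) "
          by simp
        then show ?thesis unfolding sa sc sg by (simp only: scale_left_distrib) simp
      next
        case False
        \<comment> \<open>With no simple root to remove at \<open>j\<close>, every term and also
          \<open>z\<close> lie in weights of mixed sign, and both sides are zero.\<close>
        have aj: "\<alpha> j = 0"
        proof (rule ccontr)
          assume "\<alpha> j \<noteq> 0"
          then have "0 \<le> \<gamma>"
            using pos(1) spec[OF pos(1)[unfolded le_fun_def], of j]
            by (auto simp: \<gamma>_def le_fun_def fun_arith simple_root_def int_one_le_iff_zero_less less_le)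
          then show False using False by simp
        qed
        have "\<beta> j = 0" if "\<beta> \<in> below \<alpha>" for \<beta>
          using that aj by (auto simp: below_def le_fun_def fun_arith) (metis order_antisym)
        moreover have "\<not> \<beta> \<le> \<gamma>" if "\<beta> \<in> below \<alpha>" for \<beta>
          using False that order_trans[of 0 \<beta> \<gamma>] by (auto simp: below_def)
        ultimately have "sum a (below \<alpha>) = 0" "sum c (below \<alpha>) = 0" "sum g (below \<alpha>) = 0"
          using a0 cg0 by (auto intro!: sum.neutral)
        moreover have "z = 0" using V_neg_coord[OF pos aj] zV by (simp add: \<gamma>_def)
        ultimately show ?thesis by simp
      qed
      then show "br (f j) ?D = 0"
        using fT by (simp add: br_diff_right br_smul_right z_def)
    qed
    then show ?thesis by simp
  qed
qed

end

text \<open>Pairing the Casimir identity with \<open>z\<close> gives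
  \<open>N \<gamma> * S z z\<close> as a sum of values \<open>S\<close> at the vectors
  \<open>[star v, z]\<close>, of smaller height. For strictness: if the sum were zero, all these
  vectors would vanish, so \<open>casimir b \<gamma> z = 0\<close> and then \<open>z = 0\<close> as
  \<open>N \<gamma> > 0\<close>.\<close>

lemma S_pos_positive:
  "0 \<le> \<gamma> \<Longrightarrow> \<gamma> \<noteq> 0 \<Longrightarrow> z \<in> V \<gamma> \<Longrightarrow> z \<noteq> 0 \<Longrightarrow> 0 < Re (S z z)"
proof (induction "nat (ht \<gamma>)" arbitrary: \<gamma> z rule: less_induct)
  case less
  note pos = less.prems(1,2) and z = less.prems(3,4)
  have zG: "z \<in> G" using V_G pos z by blast
  show ?case
  proof (cases "\<exists>i. \<gamma> = simple_root i")
    case True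
    then obtain i c where c: "\<gamma> = simple_root i" "z = smul c (e i)" using V_simple z by blast
    then have "c \<noteq> 0" using z(2) by auto
    moreover have "cnj c * c = of_real ((cmod c)\<^sup>2)"
      using complex_norm_square[of c] by (simp add: mult.commute)
    then have "S z z = of_real ((cmod c)\<^sup>2 / d i)"
      unfolding c(2) by (simp add: S_smul_left S_smul_right S_e_e G_smul)
    ultimately show ?thesis using d_pos[of i] by simp
  next
    case False
    have IH: "0 < Re (S u u)" if "0 \<le> \<beta>" "\<beta> \<noteq> 0" "ht \<beta> < ht \<gamma>" "u \<in> V \<beta>" "u \<noteq> 0" for \<beta> u
      using less.hyps[OF _ that(1,2,4,5)] that(3) ht_pos[OF that(1,2)] by simp
    have "\<exists>b. reproducing \<beta> b" if "0 \<le> \<beta>" "\<beta> \<noteq> 0" "ht \<beta> < ht \<gamma>" for \<beta>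
      using reproducing_exists[OF IH[OF that] that(1,2)] by blast
    then obtain b where b: "\<And>\<beta>. 0 \<le> \<beta> \<Longrightarrow> \<beta> \<noteq> 0 \<Longrightarrow> ht \<beta> < ht \<gamma> \<Longrightarrow> reproducing \<beta> (b \<beta>)"
      by metis
    have T: "casimir b \<gamma> z = smul (of_real (N \<gamma>)) z"
      by (rule casimir_eq[where n = "ht \<gamma>"]) (use b pos z in auto)
    have nn: "0 \<le> Re (S (br (star v) z) (br (star v) z))"
        "br (star v) z \<noteq> 0 \<Longrightarrow> 0 < Re (S (br (star v) z) (br (star v) z))"
      and vG: "v \<in> G" if "\<beta> \<in> below \<gamma>" "v \<in> b \<beta>" for \<beta> v
    proof -
      note bf = below_facts[OF that(1) order_refl]
      have v: "v \<in> V \<beta>" using b[OF bf] that(2) by (auto simp only: reproducing_def)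
      show "v \<in> G" using V_G[OF bf(2) v] .
      have "br (star v) z \<in> V (\<gamma> - \<beta>)" using V_br[OF star_V[OF bf(2) v] z(1)] by simp
      moreover have "ht (\<gamma> - \<beta>) < ht \<gamma>" using below_ht[OF that(1)] by simp
      ultimately show *: "br (star v) z \<noteq> 0 \<Longrightarrow> 0 < Re (S (br (star v) z) (br (star v) z))"
        using IH below_diff[OF that(1)] by blast
      show "0 \<le> Re (S (br (star v) z) (br (star v) z))"
        using * by (cases "br (star v) z = 0") auto
    qed
    have "S (casimir b \<gamma> z) z = (\<Sum>\<beta>\<in>below \<gamma>. \<Sum>v\<in>b \<beta>. S (br v (br (star v) z)) z)"
      unfolding casimir_def by (simp add: S_sum_left subspace_sum[OF G_subspace] G_ideal zG)
    also have "\<dots> = (\<Sum>\<beta>\<in>below \<gamma>. \<Sum>v\<in>b \<beta>. S (br (star v) z) (br (star v) z))"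
      by (intro sum.cong refl S_br vG G_ideal zG)
    finally have "of_real (N \<gamma>) * S z z = (\<Sum>\<beta>\<in>below \<gamma>. \<Sum>v\<in>b \<beta>. S (br (star v) z) (br (star v) z))"
      unfolding T by (simp add: S_smul_left zG)
    from arg_cong[OF this, of Re] have eq: "N \<gamma> * Re (S z z) = (\<Sum>\<beta>\<in>below \<gamma>. \<Sum>v\<in>b \<beta>. Re (S (br (star v) z) (br (star v) z)))"
      by simp
    have N: "N \<gamma> > 0" using N_pos[OF z pos] False by blast
    show ?thesis
    proof (rule ccontr)
      assume "\<not> 0 < Re (S z z)"
      then have "N \<gamma> * Re (S z z) \<le> 0" using N by (simp add: mult_nonneg_nonpos)
      moreover have "0 \<le> (\<Sum>\<beta>\<in>below \<gamma>. \<Sum>v\<in>b \<beta>. Re (S (br (star v) z) (br (star v) z)))"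
        using nn(1) by (intro sum_nonneg) blast
      ultimately have "(\<Sum>\<beta>\<in>below \<gamma>. \<Sum>v\<in>b \<beta>. Re (S (br (star v) z) (br (star v) z))) = 0"
        using eq by linarith
      then have s0: "(\<Sum>v\<in>b \<beta>. Re (S (br (star v) z) (br (star v) z))) = 0" if "\<beta> \<in> below \<gamma>" for \<beta>
        using sum_nonneg_eq_0_iff[OF finite_below, of \<gamma> "\<lambda>\<beta>. \<Sum>v\<in>b \<beta>. Re (S (br (star v) z) (br (star v) z))"]
          nn(1) that by (simp add: sum_nonneg)
      have "br (star v) z = 0" if "\<beta> \<in> below \<gamma>" "v \<in> b \<beta>" for \<beta> v
      proof -
        have "finite (b \<beta>)" using b[OF below_facts[OF that(1) order_refl]]
          by (simp add: reproducing_def)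
        then have "Re (S (br (star v) z) (br (star v) z)) = 0"
          using s0[OF that(1)] sum_nonneg_eq_0_iff[of "b \<beta>" "\<lambda>v. Re (S (br (star v) z) (br (star v) z))"]
            nn(1) that by simp
        then show ?thesis using nn(2)[OF that] by force
      qed
      then have "casimir b \<gamma> z = 0" unfolding casimir_def by (intro sum.neutral ballI) simp
      then have "z = 0" using T N by simp
      then show False using z by simp
    qed
  qed
qed

lemma S_pos: "\<gamma> \<noteq> 0 \<Longrightarrow> z \<in> V \<gamma> \<Longrightarrow> z \<noteq> 0 \<Longrightarrow> 0 < Re (S z z)"
proof -
  assume *: "\<gamma> \<noteq> 0" "z \<in> V \<gamma>" "z \<noteq> 0"
  then consider "0 \<le> \<gamma>" | "\<gamma> \<le> 0" using V_sign by blast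
  then show ?thesis
  proof cases
    case 1
    then show ?thesis using S_pos_positive * by blast
  next
    case 2
    have zG: "z \<in> G" using V_G * by blast
    have "star z \<noteq> 0" using star_star[OF zG] *(3) by force
    moreover have "star z \<in> V (- \<gamma>)" "- \<gamma> \<noteq> 0" "0 \<le> - \<gamma>" using star_V * 2 by auto
    ultimately have "0 < Re (S (star z) (star z))" using S_pos_positive by blast
    then show ?thesis using S_star_star zG by simp
  qed
qed

end

section \<open>Imaginary roots\<close>

lemma refl_uminus: "refl A i (- \<gamma>) = - refl A i \<gamma>"
  by (auto simp: refl_def fun_eq_iff fun_arith sum_negf)

lemma refl_add: "refl A i (\<gamma> + \<delta>) = refl A i \<gamma> + refl A i \<delta>"
  by (auto simp: refl_def fun_eq_iff fun_arith sum.distrib algebra_simps)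

context km_form
begin

lemma ip_nmult [simp]: "ip (nmult n \<gamma>) \<delta> = real n * ip \<gamma> \<delta>" "ip \<gamma> (nmult n \<delta>) = real n * ip \<gamma> \<delta>"
proof -
  show "ip (nmult n \<gamma>) \<delta> = real n * ip \<gamma> \<delta>" for \<gamma> \<delta>
    by (simp add: ip_def nmult_def sum_distrib_left mult_ac)
  then show "ip \<gamma> (nmult n \<delta>) = real n * ip \<gamma> \<delta>"
    using ip_sym[of \<gamma>] by metis
qed

lemma e_ne_0: "e i \<noteq> 0"
  using S_e_e[of i] by auto

text \<open>Everything holds at simple roots and is transported by invariance of \<open>ip\<close>;
  the last clause is the integrality of \<open>2(\<gamma>|\<mu>)/(\<mu>|\<mu>)\<close>.\<close>

lemma real_root_facts:
  "\<mu> \<in> real_roots A \<Longrightarrow> (\<exists>z\<in>V \<mu>. z \<noteq> 0) \<and> 0 < ip \<mu> \<mu> \<and> - \<mu> \<in> real_roots A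
    \<and> (\<forall>\<gamma>. \<exists>k::int. 2 * ip \<gamma> \<mu> = of_int k * ip \<mu> \<mu>)"
proof (induction rule: real_roots.induct)
  case (simple i)
  have ii: "ip (simple_root i) (simple_root i) = 2 * d i" by (simp add: ip_simple)
  have "- simple_root i = refl A i (simple_root i)"
    by (simp add: refl_eq fun_eq_iff fun_arith)
  then have "- simple_root i \<in> real_roots A" using real_roots.intros by metis
  moreover have "2 * ip \<gamma> (simple_root i) = of_int (pair A i \<gamma>) * ip (simple_root i) (simple_root i)" for \<gamma>
    by (simp add: ii ip_sym[of \<gamma>]) (simp add: ip_simple)
  moreover have "\<exists>z\<in>V (simple_root i). z \<noteq> 0"
    by (rule bexI[of _ "e i"]) (simp_all add: e_ne_0)
  ultimately show ?case using ii d_pos[of i] by auto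
next
  case (reflect \<mu> i)
  have "2 * ip \<gamma> (refl A i \<mu>) = 2 * ip (refl A i \<gamma>) \<mu>" for \<gamma>
    using ip_refl[of i "refl A i \<gamma>" \<mu>] by simp
  then show ?case
    using reflect.IH reflect_V[of _ \<mu> i] real_roots.reflect[of "- \<mu>" A i]
    by (auto simp: ip_refl refl_uminus)
qed

lemma refl_real_iff: "refl A i \<mu> \<in> real_roots A \<longleftrightarrow> \<mu> \<in> real_roots A"
  using real_roots.reflect[of \<mu> A i] real_roots.reflect[of "refl A i \<mu>" A i] by auto

lemma imaginary_root_refl:
  assumes "\<beta> \<notin> real_roots A" "0 \<le> \<beta>" "\<beta> \<noteq> 0" "z \<in> V \<beta>" "z \<noteq> 0"
  shows "refl A i \<beta> \<notin> real_roots A" "0 \<le> refl A i \<beta>" "refl A i \<beta> \<noteq> 0"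
    "\<exists>z'\<in>V (refl A i \<beta>). z' \<noteq> 0"
proof -
  have "\<beta> \<noteq> simple_root i" using assms(1) real_roots.simple by blast
  then show "0 \<le> refl A i \<beta>" "refl A i \<beta> \<noteq> 0" "\<exists>z'\<in>V (refl A i \<beta>). z' \<noteq> 0"
    using positive_root_refl assms(2-5) by blast+
qed (use assms refl_real_iff in blast)

text \<open>The descent stops because an imaginary root stays positive under every simple
  reflection, so heights remain positive.\<close>

lemma imaginary_ip_le_0:
  "\<beta> \<notin> real_roots A \<Longrightarrow> 0 \<le> \<beta> \<Longrightarrow> \<beta> \<noteq> 0 \<Longrightarrow> z \<in> V \<beta> \<Longrightarrow> z \<noteq> 0 \<Longrightarrow> ip \<beta> \<beta> \<le> 0"
proof (induction "nat (ht \<beta>)" arbitrary: \<beta> z rule: less_induct)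
  case less
  show ?case
  proof (cases "\<exists>i. pair A i \<beta> > 0")
    case True
    then obtain i where i: "pair A i \<beta> > 0" by blast
    note r = imaginary_root_refl[OF less.prems, of i]
    have "nat (ht (refl A i \<beta>)) < nat (ht \<beta>)"
      using i ht_refl[of i \<beta>] ht_pos[OF r(2,3)] by simp
    then show ?thesis using less.hyps r by (metis ip_refl)
  next
    case False
    then show ?thesis using less.prems(2) by (intro antidominant_ip_le_0) (auto simp: not_less)
  qed
qed

text \<open>The critical case is \<open>\<alpha> = - (\<eta> + \<beta>)\<close> with \<open>\<eta>\<close> a positive root. As \<open>(\<alpha>|\<alpha>) > 0\<close>, the root \<open>\<eta>\<close> is real,
  and then integrality of \<open>2(\<beta>|\<eta>)/(\<eta>|\<eta>)\<close> forces \<open>(\<beta>|\<eta>) = 0\<close>.\<close>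

lemma antidominant_real_case:
  assumes \<beta>: "\<beta> \<notin> real_roots A" "0 \<le> \<beta>" "\<And>i. pair A i \<beta> \<le> 0"
    and \<alpha>: "\<alpha> \<in> real_roots A" and z: "z \<in> V (\<alpha> + \<beta>)" "z \<noteq> 0"
  shows "ip (\<alpha> + \<beta>) \<beta> \<le> 0"
proof -
  note adm = antidominant_ip_le_0[OF \<beta>(3)]
  consider "0 \<le> \<alpha> + \<beta>" | "\<alpha> + \<beta> \<le> 0" using V_sign z by blast
  then show ?thesis
  proof cases
    case 1
    then show ?thesis by (rule adm)
  next
    case 2
    define \<eta> where "\<eta> = - (\<alpha> + \<beta>)"
    have \<alpha>\<eta>: "\<alpha> = - (\<eta> + \<beta>)" by (simp add: \<eta>_def)
    have "\<alpha> + \<beta> \<noteq> 0"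
    proof
      assume "\<alpha> + \<beta> = 0"
      then have "\<beta> = - \<alpha>" by (simp add: eq_neg_iff_add_eq_0 add.commute)
      then show False using \<beta>(1) \<alpha> real_root_facts by blast
    qed
    then have \<eta>: "0 \<le> \<eta>" "\<eta> \<noteq> 0" and st: "star z \<in> V \<eta>" "star z \<noteq> 0"
      using 2 z star_V[of "\<alpha> + \<beta>" z] star_star[OF V_G, of "\<alpha> + \<beta>" z]
      by (auto simp: \<eta>_def neg_equal_0_iff_equal[symmetric, of "\<alpha> + \<beta>"] simp del: minus_add_distrib neg_equal_0_iff_equal)
    have le: "ip \<eta> \<beta> \<le> 0" "ip \<beta> \<beta> \<le> 0" using adm \<eta>(1) \<beta>(2) by auto
    have "0 < ip \<alpha> \<alpha>" using real_root_facts \<alpha> by blast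
    then have pos: "0 < ip \<eta> \<eta> + 2 * ip \<eta> \<beta> + ip \<beta> \<beta>"
      by (simp add: \<alpha>\<eta> ip_sym[of \<beta> \<eta>])
    \<comment> \<open>An imaginary \<eta> would make all three terms of \<open>pos\<close>
      nonpositive.\<close>
    have "\<eta> \<in> real_roots A"
      using imaginary_ip_le_0[OF _ \<eta> st] pos le by force
    then obtain k :: int where k: "2 * ip \<beta> \<eta> = of_int k * ip \<eta> \<eta>" and E: "0 < ip \<eta> \<eta>"
      using real_root_facts by blast
    \<comment> \<open>Dropping \<open>(\<beta>|\<beta>) \<le> 0\<close> and inserting
      \<open>2(\<beta>|\<eta>) = k(\<eta>|\<eta>)\<close> leaves \<open>k > -1\<close>; as
      \<open>k\<close> is an integer, \<open>k \<ge> 0\<close>.\<close>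
    have "0 < (1 + of_int k) * ip \<eta> \<eta>"
      using pos le k ip_sym[of \<beta> \<eta>] by (simp add: algebra_simps)
    then have "0 < 1 + real_of_int k" using E by (simp add: zero_less_mult_iff)
    then have "0 \<le> k" by linarith
    then have "0 \<le> ip \<eta> \<beta>" using k E ip_sym[of \<beta> \<eta>]
      by (metis mult_nonneg_nonneg of_int_0_le_iff less_imp_le zero_le_mult_iff zero_less_numeral not_less)
    then show ?thesis using le by (simp add: \<alpha>\<eta>)
  qed
qed

text \<open>The alternative for \<alpha> is shaped to survive reflections: a real root may change
  sign but stays real, an imaginary one stays positive. The vectors witness that the three weights
  occur.\<close>

lemma ip_sum_le_0:
  "\<beta> \<notin> real_roots A \<Longrightarrow> 0 \<le> \<beta> \<Longrightarrow> \<beta> \<noteq> 0 \<Longrightarrow> y \<in> V \<beta> \<Longrightarrow> y \<noteq> 0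
    \<Longrightarrow> 0 \<le> \<alpha> \<and> \<alpha> \<noteq> 0 \<or> \<alpha> \<in> real_roots A \<Longrightarrow> x \<in> V \<alpha> \<Longrightarrow> x \<noteq> 0
    \<Longrightarrow> z \<in> V (\<alpha> + \<beta>) \<Longrightarrow> z \<noteq> 0 \<Longrightarrow> ip (\<alpha> + \<beta>) \<beta> \<le> 0"
proof (induction "nat (ht \<beta>)" arbitrary: \<alpha> \<beta> x y z rule: less_induct)
  case less
  show ?case
  proof (cases "\<exists>i. pair A i \<beta> > 0")
    case True
    then obtain i where i: "pair A i \<beta> > 0" by blast
    note r = imaginary_root_refl[OF less.prems(1-5), of i]
    have h: "nat (ht (refl A i \<beta>)) < nat (ht \<beta>)"
      using i ht_refl[of i \<beta>] ht_pos[OF r(2,3)] by simp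
    obtain x' y' z' where xyz: "x' \<in> V (refl A i \<alpha>)" "x' \<noteq> 0" "y' \<in> V (refl A i \<beta>)" "y' \<noteq> 0"
        "z' \<in> V (refl A i \<alpha> + refl A i \<beta>)" "z' \<noteq> 0"
      using reflect_V less.prems r(4) refl_add by metis
    have "0 \<le> refl A i \<alpha> \<and> refl A i \<alpha> \<noteq> 0 \<or> refl A i \<alpha> \<in> real_roots A"
      using less.prems(6-8) imaginary_root_refl[of \<alpha> x i] refl_real_iff[of i \<alpha>] by blast
    then have "ip (refl A i \<alpha> + refl A i \<beta>) (refl A i \<beta>) \<le> 0"
      using less.hyps[OF h r(1-3) xyz(3,4) _ xyz(1,2,5,6)] by blast
    then show ?thesis by (simp only: refl_add[symmetric] ip_refl)
  next
    case False
    then have ad: "pair A i \<beta> \<le> 0" for i by (auto simp: not_less)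
    from less.prems(6) show ?thesis
    proof
      assume "0 \<le> \<alpha> \<and> \<alpha> \<noteq> 0"
      then have "0 \<le> \<alpha> + \<beta>" using less.prems(2) by (simp add: add_nonneg_nonneg)
      then show ?thesis using antidominant_ip_le_0 ad by blast
    next
      assume "\<alpha> \<in> real_roots A"
      then show ?thesis using antidominant_real_case less.prems(1,2,9,10) ad by blast
    qed
  qed
qed

section \<open>Nonvanishing of the powers of \<open>ad y\<close>\<close>

lemma ad_step_nonzero:
  assumes y: "y \<in> V \<beta>" and p: "p \<in> V \<gamma>" "br y p \<noteq> 0"
    and ne: "\<beta> \<noteq> 0" "\<gamma> \<noteq> 0" "\<gamma> + \<beta> \<noteq> 0" and le: "ip \<beta> (\<gamma> + \<beta>) \<le> 0"
  shows "br y (br y p) \<noteq> 0"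
proof -
  define z where "z = br y p"
  define w where "w = br (star y) z"
  have z: "z \<in> V (\<gamma> + \<beta>)" "z \<noteq> 0" using V_br[OF y p(1)] p(2) by (simp_all add: z_def add.commute)
  have sy: "star y \<in> V (- \<beta>)" using star_V ne y by blast
  have w: "w \<in> V \<gamma>" using V_br[OF sy z(1)] by (simp add: w_def)
  have G: "y \<in> G" "p \<in> G" "z \<in> G" "w \<in> G" "star y \<in> G"
    using V_G y p z w ne star_G by blast+
  have "S w p = S z z"
    using S_br[OF G(5,3,2)] G(1) by (simp add: w_def z_def)
  then have "w \<noteq> 0" using S_pos[OF ne(3) z] by auto
  then have wpos: "0 < Re (S w w)" using S_pos ne(2) w by blast
  have "S y y = of_real (Re (S y y))" "S z z = of_real (Re (S z z))"
    using S_Im G by (simp_all add: complex_eq_iff)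
  have "br (star y) y = smul (- S y y) (cov \<beta>)"
    using br_eq_B_cov[OF y sy ne(1)] br_skew[of "star y" y] by (simp add: S_def)
  then have e: "br (star y) (br y z) = smul (- S y y * of_real (ip \<beta> (\<gamma> + \<beta>))) z + br y w"
    using br_br[of "star y" y z] br_cov[OF z(1), of \<beta>] by (simp add: br_smul_left w_def)
  have "S z (br y w) = S w w"
    using S_br[OF G(5,3,4)] G(1) by (simp add: w_def)
  then have Y: "S (br y z) (br y z) = cnj (- S y y * of_real (ip \<beta> (\<gamma> + \<beta>))) * S z z + S w w"
    using S_br[OF G(1,3) G_ideal[OF G(3), of y]] G
    by (simp only: e S_add_right G_smul G_ideal S_smul_right)
  have "Re (S (br y z) (br y z)) = - (Re (S y y) * ip \<beta> (\<gamma> + \<beta>) * Re (S z z)) + Re (S w w)"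
    unfolding Y using S_Im[OF G(1)] S_Im[OF G(3)] by simp
  also have "\<dots> > 0"
  proof -
    have "0 \<le> Re (S y y)" "0 \<le> Re (S z z)"
      using S_pos[OF ne(1) y] S_pos[OF ne(3) z] by (cases "y = 0"; simp)+
    then have "Re (S y y) * ip \<beta> (\<gamma> + \<beta>) * Re (S z z) \<le> 0"
      using le by (intro mult_nonpos_nonneg mult_nonneg_nonpos)
    then show ?thesis using wpos by linarith
  qed
  finally have "0 < Re (S (br y z) (br y z))" .
  then show ?thesis by (auto simp: z_def)
qed

lemma ad_power_nonzero:
  assumes \<alpha>: "0 \<le> \<alpha> \<and> \<alpha> \<noteq> 0 \<or> \<alpha> \<in> real_roots A" and \<beta>: "\<beta> \<notin> real_roots A" "0 \<le> \<beta>" "\<beta> \<noteq> 0"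
    and x: "x \<in> V \<alpha>" and y: "y \<in> V \<beta>" and xy: "br x y \<noteq> 0"
  shows "(br y ^^ n) x \<noteq> 0"
proof -
  have x0: "x \<noteq> 0" and y0: "y \<noteq> 0" using xy by auto
  have yx: "br y x \<noteq> 0" using xy br_skew[of x y] by auto
  have bb: "ip \<beta> \<beta> \<le> 0" using imaginary_ip_le_0 \<beta> y y0 by blast
  have "br y x \<in> V (\<alpha> + \<beta>)" using V_br[OF y x] by (simp add: add.commute)
  then have ab: "ip (\<alpha> + \<beta>) \<beta> \<le> 0"
    using ip_sum_le_0[OF \<beta> y y0 \<alpha> x x0 _ yx] by blast
  \<comment> \<open>Positivity of \<open>S\<close> is available only in nonzero weights. Positive
    \<alpha> keeps the height positive; for real \<alpha> a zero would give
    \<open>(\<alpha>|\<alpha>) = n^2 (\<beta>|\<beta>) \<le> 0\<close>.\<close>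
  have ne: "\<alpha> + nmult n \<beta> \<noteq> 0" for n
    using \<alpha>
  proof
    assume "0 \<le> \<alpha> \<and> \<alpha> \<noteq> 0"
    then have "0 < ht \<alpha>" "0 \<le> ht \<beta>" using ht_pos ht_nonneg \<beta> by auto
    then have "0 < ht (\<alpha> + nmult n \<beta>)" by (simp add: add_pos_nonneg)
    then show ?thesis by force
  next
    assume "\<alpha> \<in> real_roots A"
    then have "0 < ip \<alpha> \<alpha>" using real_root_facts by blast
    moreover have "ip \<alpha> \<alpha> = real n * (real n * ip \<beta> \<beta>)" if "\<alpha> + nmult n \<beta> = 0"
    proof -
      have "\<alpha> = - nmult n \<beta>" using that by (simp add: eq_neg_iff_add_eq_0)
      then show ?thesis by simp
    qed
    moreover have "real n * (real n * ip \<beta> \<beta>) \<le> 0" using bb by (simp add: mult_nonneg_nonpos)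
    ultimately show ?thesis by force
  qed
  have V: "(br y ^^ n) x \<in> V (\<alpha> + nmult n \<beta>)" for n using x y by (rule br_pow_V)
  have "(br y ^^ Suc n) x \<noteq> 0" for n
  proof (induction n)
    case 0
    then show ?case using yx by simp
  next
    case (Suc n)
    have s: "\<alpha> + nmult n \<beta> + \<beta> = \<alpha> + nmult (Suc n) \<beta>" by (simp add: nmult_Suc add_ac)
    have "\<alpha> + nmult n \<beta> + \<beta> = (\<alpha> + \<beta>) + nmult n \<beta>" by (simp add: add_ac)
    \<comment> \<open>Each further copy of \<beta> adds \<open>(\<beta>|\<beta>) \<le> 0\<close>, so
      the sign at \<alpha> + \<beta> persists along the string.\<close>
    then have "ip \<beta> (\<alpha> + nmult n \<beta> + \<beta>) = ip (\<alpha> + \<beta>) \<beta> + real n * ip \<beta> \<beta>"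
      by (simp only: ip_simps ip_nmult ip_sym[of \<beta> "\<alpha>"])
    moreover have "real n * ip \<beta> \<beta> \<le> 0" using bb by (simp add: mult_nonneg_nonpos)
    ultimately have "ip \<beta> (\<alpha> + nmult n \<beta> + \<beta>) \<le> 0" using ab by linarith
    then show ?case
      using ad_step_nonzero[OF y V[of n] _ \<beta>(3) ne[of n]] ne[of "Suc n"] Suc.IH s by simp
  qed
  then show ?thesis using x0 by (cases n) auto
qed

end

theorem theorem5p3:
  fixes A :: "'i::finite \<Rightarrow> 'i \<Rightarrow> int"
    and smul :: "complex \<Rightarrow> 'g::ab_group_add \<Rightarrow> 'g" and br :: "'g \<Rightarrow> 'g \<Rightarrow> 'g"
    and H :: "'g set" and hv :: "'i \<Rightarrow> 'g" and al :: "'i \<Rightarrow> 'g \<Rightarrow> complex"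
    and e f :: "'i \<Rightarrow> 'g"
    and \<alpha> \<beta> :: "'i \<Rightarrow> int" and x y :: 'g
  assumes "gcm A" and "symmetrisable A"
    and "kac_moody A smul br H hv al e f"
    and "\<alpha> \<in> (roots smul br H al \<inter> pos_lattice) \<union> real_roots A"
    and "\<beta> \<in> (roots smul br H al \<inter> pos_lattice) - real_roots A"
    and "x \<in> root_space smul br H al \<alpha>" and "y \<in> root_space smul br H al \<beta>"
    and "br x y \<noteq> 0"
  shows "\<forall>n::nat. (br y ^^ n) x \<noteq> 0"
proof -
  obtain d :: "'i \<Rightarrow> real" where d: "\<And>i. d i > 0" "\<And>i j. d i * of_int (A i j) = d j * of_int (A j i)"
    using assms(2) unfolding symmetrisable_def by blast
  interpret km_form A smul br H hv al e f d
    using assms(1,3) d by unfold_locales auto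
  have "0 \<le> \<alpha> \<and> \<alpha> \<noteq> 0 \<or> \<alpha> \<in> real_roots A" "\<beta> \<notin> real_roots A" "0 \<le> \<beta>" "\<beta> \<noteq> 0"
    using assms(4,5) by (auto simp: roots_def pos_lattice_def le_fun_def fun_arith)
  then show ?thesis using ad_power_nonzero assms(6-8) by blast
qed

end
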